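(* Let $k,\ell\in\mathbb{N}$ and let $\bar{x}=(x_1,\ldots,x_k)$, $\bar{y}=(y_1,\ldots,y_\ell)$ be tuples of $k+\ell$ pairwise distinct variables. For every $\mathrm{FOW}_1[\mathbb{P}](\sigma',\mathcal{S},\mathbf{W})$-formula $\varphi$ with $\mathrm{free}(\varphi)\subseteq\{x_1,\ldots,x_k,y_1,\ldots,y_\ell\}$ there exists a Feferman-Vaught decomposition $\Delta$ of $\varphi$ in $\mathcal{L}_\varphi$ with respect to $(\bar{x};\bar{y})$, where $\mathcal{L}_\varphi$ is the class of all $\mathrm{FOW}_1[\mathbb{P}](\sigma,\mathcal{S},\mathbf{W})$-formulas of quantifier rank at most $\mathrm{qr}(\varphi)$ that use only those $P\in\mathbb{P}$ and $S\in\mathcal{S}$ that occur in $\varphi$, and only those $\mathcal{S}$-terms that occur in $\varphi$ or are of the form $s$ for an element $s\in S\in\mathcal{S}$ where $S$ is finite and occurs in $\varphi$. Moreover, there is an algorithm that computes such a $\Delta$ on input $\varphi,\bar{x},\bar{y}$.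
   Context: Weighted structures. A signature $\sigma$ is a finite set of relation symbols $R$, each with an arity $\mathrm{ar}(R)\in\mathbb{N}$ (arity $0$ allowed). Let $\mathcal{S}$ be a collection of rings and/or abelian groups (for $S\in\mathcal{S}$ write $+_S$, $\cdot_S$, $0_S$). Let $\mathbf{W}$ be a finite set of weight symbols, each $\mathtt{w}$ with an arity $\mathrm{ar}(\mathtt{w})\ge 1$ and a type $\mathrm{type}(\mathtt{w})\in\mathcal{S}$. A $(\sigma,\mathbf{W})$-structure $\mathcal{A}$ consists of a finite non-empty universe $A$, relations $R^{\mathcal{A}}\subseteq A^{\mathrm{ar}(R)}$ for $R\in\sigma$, and for each $\mathtt{w}\in\mathbf{W}$ a function $\mathtt{w}^{\mathcal{A}}:A^{\mathrm{ar}(\mathtt{w})}\to\mathrm{type}(\mathtt{w})$ such that whenever $\mathtt{w}^{\mathcal{A}}(a_1,\ldots,a_k)\neq 0_S$ (with $S=\mathrm{type}(\mathtt{w})$, $k=\mathrm{ar}(\mathtt{w})$), then $k=1$, or $a_1=\cdots=a_k$, or some tuple of some relation $R^{\mathcal{A}}$ contains all of $a_1,\ldots,a_k$. An $\mathcal{S}$-predicate collection $(\mathbb{P},\mathrm{ar},\mathrm{type},[\![\cdot]\!])$ consists of a countable set $\mathbb{P}$ of predicate names, each $P$ with an arity $m=\mathrm{ar}(P)\ge 1$, a type $\mathrm{type}(P)=(S_1,\ldots,S_m)\in\mathcal{S}^m$ and a semantics $[\![P]\!]\subseteq S_1\times\cdots\times S_m$. A $\mathbf{W}$-product of type $S$: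 if $S\in\mathcal{S}$ is an abelian group that is not a ring, it is either an element $s\in S$ or an expression $\mathtt{w}(y_1,\ldots,y_k)$ with $\mathrm{type}(\mathtt{w})=S$, $k=\mathrm{ar}(\mathtt{w})$ and $y_1,\ldots,y_k$ pairwise distinct variables; if $S$ is a ring, it is an expression $t_1\cdot\cdots\cdot t_\ell$ ($\ell\ge1$) where each $t_i$ is an element of $S$ or such an expression $\mathtt{w}(y_1,\ldots,y_k)$ of type $S$. $\mathrm{vars}(p)$ is the set of variables in $p$. The logic. Formulas and $\mathcal{S}$-terms of $\mathrm{WA}[\mathbb{P}](\sigma,\mathcal{S},\mathbf{W})$ are built by: (1) $x_1=x_2$ and $R(x_1,\ldots,x_{\mathrm{ar}(R)})$ are formulas; (2) $(s=\mathtt{w}(x_1,\ldots,x_k))$ is a formula for $\mathtt{w}\in\mathbf{W}$, $s\in\mathrm{type}(\mathtt{w})$, $k=\mathrm{ar}(\mathtt{w})$, pairwise distinct $x_i$; (3) $\neg\varphi$, $(\varphi\vee\psi)$; (4) $\exists y\,\varphi$; (5) $(s=\sum\mathtt{w}(y_1,\ldots,y_k).\varphi)$ for a formula $\varphi$, $\mathtt{w}\in\mathbf{W}$, $s\in\mathrm{type}(\mathtt{w})$, $k=\mathrm{ar}(\mathtt{w})$, pairwise distinct $y_i$; (6) $P(t_1,\ldots,t_m)$ for $P\in\mathbb{P}$, $m=\mathrm{ar}(P)$ and $\mathcal{S}$-terms with $(\mathrm{type}(t_1),\ldots,\mathrm{type}(t_m))=\mathrm{type}(P)$; (7) each $s\in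 S\in\mathcal{S}$ is a term of type $S$; (8) $\mathtt{w}(x_1,\ldots,x_k)$ (pairwise distinct variables) is a term of type $\mathrm{type}(\mathtt{w})$; (9) if $t_1,t_2$ are terms of type $S$ then so are $(t_1+t_2)$, $(t_1-t_2)$, and, if $S$ is a ring, $(t_1\cdot t_2)$; (10) if $\varphi$ is a formula and $p$ a $\mathbf{W}$-product of type $S$, then $\sum p.\varphi$ is a term of type $S$. Semantics under an assignment $\beta$ of elements of $A$ to variables: (1),(3),(4) as usual; (2) holds iff $s=\mathtt{w}^{\mathcal{A}}(\beta(x_1),\ldots,\beta(x_k))$; (5) holds iff $s$ equals the $S$-sum of $\mathtt{w}^{\mathcal{A}}(\bar{a})$ over all $\bar{a}\in A^k$ such that $\varphi$ holds when $\bar{y}$ is assigned $\bar{a}$ (empty sum $=0_S$); (6) holds iff the tuple of values of the $t_i$ lies in $[\![P]\!]$; (7) has value $s$; (8) value $\mathtt{w}^{\mathcal{A}}(\beta(\bar{x}))$; (9) the operations of $S$; (10) the $S$-sum, over all assignments to the variables in $\mathrm{vars}(p)$ (other variables given by $\beta$) that satisfy $\varphi$, of the value of $p$ (the $S$-product of its factors). Free variables are as usual, with $\mathrm{free}$ of (5) being $\mathrm{free}(\varphi)\setminus\{y_1,\ldots,y_k\}$, of (6) $\bigcup_i\mathrm{free}(t_i)$, of (10) $\mathrm{free}(\varphi)\setminus\mathrm{vars}(p)$. $\mathrm{WA}_1[\mathbb{P}](\sigma,\mathcal{S},\mathbf{W})$ allows rule (5) only if $\mathrm{type}(\mathtt{w})$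 is finite and rule (6) only if $|\mathrm{free}(t_1)\cup\cdots\cup\mathrm{free}(t_m)|\le 1$; $\mathrm{FOW}_1[\mathbb{P}](\sigma,\mathcal{S},\mathbf{W})$ is the restriction of $\mathrm{WA}_1$ in which rule (10) is not used. The quantifier rank $\mathrm{qr}$ is the maximal nesting depth of rules (4) and (5). Feferman-Vaught decompositions. Let $X,Y$ be new unary relation symbols and $\sigma'=\sigma\cup\{X,Y\}$. For $(\sigma,\mathbf{W})$-structures $\mathcal{A},\mathcal{B}$ with $A\cap B=\emptyset$, the disjoint sum $\mathcal{A}\oplus\mathcal{B}$ is the $(\sigma',\mathbf{W})$-structure $\mathcal{C}$ with universe $A\cup B$, $X^{\mathcal{C}}=A$, $Y^{\mathcal{C}}=B$, $R^{\mathcal{C}}=R^{\mathcal{A}}\cup R^{\mathcal{B}}$ for $R\in\sigma$, and $\mathtt{w}^{\mathcal{C}}(\bar{c})=\mathtt{w}^{\mathcal{A}}(\bar{c})$ if $\bar{c}\in A^k$, $=\mathtt{w}^{\mathcal{B}}(\bar{c})$ if $\bar{c}\in B^k$, and $=0_{\mathrm{type}(\mathtt{w})}$ otherwise. For a set $\mathcal{L}$ of formulas and a formula $\varphi$ with $\mathrm{free}(\varphi)\subseteq\{x_1,\ldots,x_k,y_1,\ldots,y_\ell\}$, a Feferman-Vaught decomposition of $\varphi$ in $\mathcal{L}$ w.r.t. $(\bar{x};\bar{y})$ is a finite non-empty set $\Delta$ of pairs $(\alpha,\beta)$ with $\alpha,\beta\in\mathcal{L}$, $\mathrm{free}(\alpha)\subseteq\{x_1,\ldots,x_k\}$,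 $\mathrm{free}(\beta)\subseteq\{y_1,\ldots,y_\ell\}$, such that for all $(\sigma,\mathbf{W})$-structures $\mathcal{A},\mathcal{B}$ with $A\cap B=\emptyset$ and all $\bar{a}\in A^k$, $\bar{b}\in B^\ell$: $\mathcal{A}\oplus\mathcal{B}\models\varphi[\bar{a},\bar{b}]$ iff there is $(\alpha,\beta)\in\Delta$ with $\mathcal{A}\models\alpha[\bar{a}]$ and $\mathcal{B}\models\beta[\bar{b}]$.
   Formalization: Assumes L_φ contains some α with free(α) ⊆ x̄ and some β with free(β) ⊆ ȳ, without which no non-empty Δ exists (e.g. φ = (x₁=x₁), ℓ=0, no 0-ary symbols); universes are finite subsets of one arbitrary type, covering all finite structures up to isomorphism when it is infinite. *)

theory Defs
  imports "HOL-Algebra.Ring" "HOL-Library.Countable_Set"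
begin

section \<open>Rings, groups, weights and predicates\<close>

text \<open>
  The members of the collection of rings and abelian groups are referred to by names of type
  \<open>'s\<close>. All carriers live in one type \<open>'e\<close>; they may overlap, and every use of an element in
  the syntax is accompanied (explicitly or through the type of a weight symbol) by the name of the
  structure it is taken from. For a name outside \<open>ring_names\<close> the multiplicative part of the
  record is junk.
\<close>

record ('r, 'w, 'p, 's, 'e) wa_setting =
  rel_ar :: "'r \<Rightarrow> nat"
  alg_names :: "'s set"
  ring_names :: "'s set"
  alg :: "'s \<Rightarrow> 'e ring"
  weights :: "'w set"
  wt_ar :: "'w \<Rightarrow> nat"
  wt_type :: "'w \<Rightarrow> 's"
  pred_names :: "'p set"
  pred_ar :: "'p \<Rightarrow> nat"
  pred_type :: "'p \<Rightarrow> 's list"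
  pred_sem :: "'p \<Rightarrow> 'e list set"

definition wa_setting_ok :: "('r, 'w, 'p, 's, 'e) wa_setting \<Rightarrow> bool" where
  "wa_setting_ok V \<longleftrightarrow>
     (\<forall>S\<in>alg_names V. abelian_group (alg V S)) \<and>
     ring_names V \<subseteq> alg_names V \<and>
     (\<forall>S\<in>ring_names V. ring (alg V S)) \<and>
     finite (weights V) \<and>
     (\<forall>w\<in>weights V. wt_ar V w \<ge> 1 \<and> wt_type V w \<in> alg_names V) \<and>
     countable (pred_names V) \<and>
     (\<forall>P\<in>pred_names V.
        pred_ar V P \<ge> 1 \<and> length (pred_type V P) = pred_ar V P \<and>
        set (pred_type V P) \<subseteq> alg_names V \<and>
        pred_sem V P \<subseteq> {vs. list_all2 (\<lambda>v S. v \<in> carrier (alg V S)) vs (pred_type V P)})"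

definition tuples :: "'a set \<Rightarrow> nat \<Rightarrow> 'a list set" where
  "tuples A k = {as. length as = k \<and> set as \<subseteq> A}"

section \<open>Weighted structures\<close>

record ('a, 'r, 'w, 'e) wstruct =
  univ :: "'a set"
  rel :: "'r \<Rightarrow> 'a list set"
  wt :: "'w \<Rightarrow> 'a list \<Rightarrow> 'e"

definition is_wstruct ::
  "('r, 'w, 'p, 's, 'e) wa_setting \<Rightarrow> 'r set \<Rightarrow> ('a, 'r, 'w, 'e) wstruct \<Rightarrow> bool" where
  "is_wstruct V \<sigma> A \<longleftrightarrow>
     finite (univ A) \<and> univ A \<noteq> {} \<and>
     (\<forall>R\<in>\<sigma>. rel A R \<subseteq> tuples (univ A) (rel_ar V R)) \<and>
     (\<forall>w\<in>weights V. \<forall>as\<in>tuples (univ A) (wt_ar V w).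
        wt A w as \<in> carrier (alg V (wt_type V w)) \<and>
        (wt A w as \<noteq> \<zero>\<^bsub>alg V (wt_type V w)\<^esub> \<longrightarrow>
           wt_ar V w = 1 \<or>
           (\<forall>a\<in>set as. \<forall>b\<in>set as. a = b) \<or>
           (\<exists>R\<in>\<sigma>. \<exists>bs\<in>rel A R. set as \<subseteq> set bs)))"

definition disjoint_sum ::
  "('r, 'w, 'p, 's, 'e) wa_setting \<Rightarrow> 'r \<Rightarrow> 'r \<Rightarrow>
   ('a, 'r, 'w, 'e) wstruct \<Rightarrow> ('a, 'r, 'w, 'e) wstruct \<Rightarrow> ('a, 'r, 'w, 'e) wstruct" where
  "disjoint_sum V X Y A B =
     \<lparr> univ = univ A \<union> univ B,
       rel = (\<lambda>R. if R = X then {[a] | a. a \<in> univ A}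
                  else if R = Y then {[b] | b. b \<in> univ B}
                  else rel A R \<union> rel B R),
       wt = (\<lambda>w cs. if set cs \<subseteq> univ A then wt A w cs
                    else if set cs \<subseteq> univ B then wt B w cs
                    else \<zero>\<^bsub>alg V (wt_type V w)\<^esub>) \<rparr>"

section \<open>Weight aggregation logic: syntax\<close>

text \<open>
  Variables are natural numbers. A product is a non-empty list of factors. In \<open>Agg S p \<phi>\<close>
  (the term \<open>\<Sum>p.\<phi>\<close>) the name \<open>S\<close> is the type of \<open>p\<close>; it has to be recorded since \<open>p\<close> may consist
  of elements only.
\<close>

datatype ('w, 'e) factor = FElem 'e | FWt 'w "nat list"

datatype ('r, 'w, 'p, 's, 'e) fm =
    EqV nat nat
  | Rel 'r "nat list"
  | WtEq 'e 'w "nat list"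
  | Neg "('r, 'w, 'p, 's, 'e) fm"
  | Or "('r, 'w, 'p, 's, 'e) fm" "('r, 'w, 'p, 's, 'e) fm"
  | Ex nat "('r, 'w, 'p, 's, 'e) fm"
  | SumEq 'e 'w "nat list" "('r, 'w, 'p, 's, 'e) fm"
  | Pred 'p "('r, 'w, 'p, 's, 'e) tm list"
and ('r, 'w, 'p, 's, 'e) tm =
    Const 's 'e
  | Wt 'w "nat list"
  | Plus "('r, 'w, 'p, 's, 'e) tm" "('r, 'w, 'p, 's, 'e) tm"
  | Minus "('r, 'w, 'p, 's, 'e) tm" "('r, 'w, 'p, 's, 'e) tm"
  | Times "('r, 'w, 'p, 's, 'e) tm" "('r, 'w, 'p, 's, 'e) tm"
  | Agg 's "('w, 'e) factor list" "('r, 'w, 'p, 's, 'e) fm"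

fun factor_vars :: "('w, 'e) factor \<Rightarrow> nat set" where
  "factor_vars (FElem s) = {}"
| "factor_vars (FWt w ys) = set ys"

definition prod_vars :: "('w, 'e) factor list \<Rightarrow> nat set" where
  "prod_vars p = (\<Union>f\<in>set p. factor_vars f)"

fun factor_ok :: "('r, 'w, 'p, 's, 'e) wa_setting \<Rightarrow> 's \<Rightarrow> ('w, 'e) factor \<Rightarrow> bool" where
  "factor_ok V S (FElem s) \<longleftrightarrow> s \<in> carrier (alg V S)"
| "factor_ok V S (FWt w ys) \<longleftrightarrow>
     w \<in> weights V \<and> wt_type V w = S \<and> length ys = wt_ar V w \<and> distinct ys"

definition is_product ::
  "('r, 'w, 'p, 's, 'e) wa_setting \<Rightarrow> 's \<Rightarrow> ('w, 'e) factor list \<Rightarrow> bool" where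
  "is_product V S p \<longleftrightarrow>
     S \<in> alg_names V \<and> (\<forall>f\<in>set p. factor_ok V S f) \<and>
     (if S \<in> ring_names V then length p \<ge> 1 else length p = 1)"

fun tm_type :: "('r, 'w, 'p, 's, 'e) wa_setting \<Rightarrow> ('r, 'w, 'p, 's, 'e) tm \<Rightarrow> 's" where
  "tm_type V (Const S s) = S"
| "tm_type V (Wt w xs) = wt_type V w"
| "tm_type V (Plus t u) = tm_type V t"
| "tm_type V (Minus t u) = tm_type V t"
| "tm_type V (Times t u) = tm_type V t"
| "tm_type V (Agg S p \<phi>) = S"

fun wa_fm :: "('r, 'w, 'p, 's, 'e) wa_setting \<Rightarrow> 'r set \<Rightarrow> ('r, 'w, 'p, 's, 'e) fm \<Rightarrow> bool"
and wa_tm :: "('r, 'w, 'p, 's, 'e) wa_setting \<Rightarrow> 'r set \<Rightarrow> ('r, 'w, 'p, 's, 'e) tm \<Rightarrow> bool"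
where
  "wa_fm V \<sigma> (EqV x y) \<longleftrightarrow> True"
| "wa_fm V \<sigma> (Rel R xs) \<longleftrightarrow> R \<in> \<sigma> \<and> length xs = rel_ar V R"
| "wa_fm V \<sigma> (WtEq s w xs) \<longleftrightarrow>
     w \<in> weights V \<and> s \<in> carrier (alg V (wt_type V w)) \<and> length xs = wt_ar V w \<and> distinct xs"
| "wa_fm V \<sigma> (Neg \<phi>) \<longleftrightarrow> wa_fm V \<sigma> \<phi>"
| "wa_fm V \<sigma> (Or \<phi> \<psi>) \<longleftrightarrow> wa_fm V \<sigma> \<phi> \<and> wa_fm V \<sigma> \<psi>"
| "wa_fm V \<sigma> (Ex y \<phi>) \<longleftrightarrow> wa_fm V \<sigma> \<phi>"
| "wa_fm V \<sigma> (SumEq s w ys \<phi>) \<longleftrightarrow>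
     w \<in> weights V \<and> s \<in> carrier (alg V (wt_type V w)) \<and> length ys = wt_ar V w \<and> distinct ys \<and>
     wa_fm V \<sigma> \<phi>"
| "wa_fm V \<sigma> (Pred P ts) \<longleftrightarrow>
     P \<in> pred_names V \<and> length ts = pred_ar V P \<and> map (tm_type V) ts = pred_type V P \<and>
     (\<forall>t\<in>set ts. wa_tm V \<sigma> t)"
| "wa_tm V \<sigma> (Const S s) \<longleftrightarrow> S \<in> alg_names V \<and> s \<in> carrier (alg V S)"
| "wa_tm V \<sigma> (Wt w xs) \<longleftrightarrow> w \<in> weights V \<and> length xs = wt_ar V w \<and> distinct xs"
| "wa_tm V \<sigma> (Plus t u) \<longleftrightarrow> wa_tm V \<sigma> t \<and> wa_tm V \<sigma> u \<and> tm_type V t = tm_type V u"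
| "wa_tm V \<sigma> (Minus t u) \<longleftrightarrow> wa_tm V \<sigma> t \<and> wa_tm V \<sigma> u \<and> tm_type V t = tm_type V u"
| "wa_tm V \<sigma> (Times t u) \<longleftrightarrow>
     wa_tm V \<sigma> t \<and> wa_tm V \<sigma> u \<and> tm_type V t = tm_type V u \<and> tm_type V t \<in> ring_names V"
| "wa_tm V \<sigma> (Agg S p \<phi>) \<longleftrightarrow> is_product V S p \<and> wa_fm V \<sigma> \<phi>"

fun free :: "('r, 'w, 'p, 's, 'e) fm \<Rightarrow> nat set"
and free_tm :: "('r, 'w, 'p, 's, 'e) tm \<Rightarrow> nat set"
where
  "free (EqV x y) = {x, y}"
| "free (Rel R xs) = set xs"
| "free (WtEq s w xs) = set xs"
| "free (Neg \<phi>) = free \<phi>"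
| "free (Or \<phi> \<psi>) = free \<phi> \<union> free \<psi>"
| "free (Ex y \<phi>) = free \<phi> - {y}"
| "free (SumEq s w ys \<phi>) = free \<phi> - set ys"
| "free (Pred P ts) = (\<Union>t\<in>set ts. free_tm t)"
| "free_tm (Const S s) = {}"
| "free_tm (Wt w xs) = set xs"
| "free_tm (Plus t u) = free_tm t \<union> free_tm u"
| "free_tm (Minus t u) = free_tm t \<union> free_tm u"
| "free_tm (Times t u) = free_tm t \<union> free_tm u"
| "free_tm (Agg S p \<phi>) = free \<phi> - prod_vars p"

fun qr :: "('r, 'w, 'p, 's, 'e) fm \<Rightarrow> nat"
and qr_tm :: "('r, 'w, 'p, 's, 'e) tm \<Rightarrow> nat"
where
  "qr (EqV x y) = 0"
| "qr (Rel R xs) = 0"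
| "qr (WtEq s w xs) = 0"
| "qr (Neg \<phi>) = qr \<phi>"
| "qr (Or \<phi> \<psi>) = max (qr \<phi>) (qr \<psi>)"
| "qr (Ex y \<phi>) = Suc (qr \<phi>)"
| "qr (SumEq s w ys \<phi>) = Suc (qr \<phi>)"
| "qr (Pred P ts) = Max (insert 0 (set (map qr_tm ts)))"
| "qr_tm (Const S s) = 0"
| "qr_tm (Wt w xs) = 0"
| "qr_tm (Plus t u) = max (qr_tm t) (qr_tm u)"
| "qr_tm (Minus t u) = max (qr_tm t) (qr_tm u)"
| "qr_tm (Times t u) = max (qr_tm t) (qr_tm u)"
| "qr_tm (Agg S p \<phi>) = qr \<phi>"

text \<open>The restrictions on the rules for \<open>SumEq\<close> and \<open>Pred\<close> that define the fragment
  \<open>WA\<^sub>1\<close>, and the absence of the rule for \<open>Agg\<close> that defines \<open>FOW\<^sub>1\<close>.\<close>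

fun wa1_restr :: "('r, 'w, 'p, 's, 'e) wa_setting \<Rightarrow> ('r, 'w, 'p, 's, 'e) fm \<Rightarrow> bool"
and wa1_restr_tm :: "('r, 'w, 'p, 's, 'e) wa_setting \<Rightarrow> ('r, 'w, 'p, 's, 'e) tm \<Rightarrow> bool"
where
  "wa1_restr V (EqV x y) \<longleftrightarrow> True"
| "wa1_restr V (Rel R xs) \<longleftrightarrow> True"
| "wa1_restr V (WtEq s w xs) \<longleftrightarrow> True"
| "wa1_restr V (Neg \<phi>) \<longleftrightarrow> wa1_restr V \<phi>"
| "wa1_restr V (Or \<phi> \<psi>) \<longleftrightarrow> wa1_restr V \<phi> \<and> wa1_restr V \<psi>"
| "wa1_restr V (Ex y \<phi>) \<longleftrightarrow> wa1_restr V \<phi>"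
| "wa1_restr V (SumEq s w ys \<phi>) \<longleftrightarrow>
     finite (carrier (alg V (wt_type V w))) \<and> wa1_restr V \<phi>"
| "wa1_restr V (Pred P ts) \<longleftrightarrow>
     card (\<Union>t\<in>set ts. free_tm t) \<le> 1 \<and> (\<forall>t\<in>set ts. wa1_restr_tm V t)"
| "wa1_restr_tm V (Const S s) \<longleftrightarrow> True"
| "wa1_restr_tm V (Wt w xs) \<longleftrightarrow> True"
| "wa1_restr_tm V (Plus t u) \<longleftrightarrow> wa1_restr_tm V t \<and> wa1_restr_tm V u"
| "wa1_restr_tm V (Minus t u) \<longleftrightarrow> wa1_restr_tm V t \<and> wa1_restr_tm V u"
| "wa1_restr_tm V (Times t u) \<longleftrightarrow> wa1_restr_tm V t \<and> wa1_restr_tm V u"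
| "wa1_restr_tm V (Agg S p \<phi>) \<longleftrightarrow> wa1_restr V \<phi>"

fun no_agg :: "('r, 'w, 'p, 's, 'e) fm \<Rightarrow> bool"
and no_agg_tm :: "('r, 'w, 'p, 's, 'e) tm \<Rightarrow> bool"
where
  "no_agg (EqV x y) \<longleftrightarrow> True"
| "no_agg (Rel R xs) \<longleftrightarrow> True"
| "no_agg (WtEq s w xs) \<longleftrightarrow> True"
| "no_agg (Neg \<phi>) \<longleftrightarrow> no_agg \<phi>"
| "no_agg (Or \<phi> \<psi>) \<longleftrightarrow> no_agg \<phi> \<and> no_agg \<psi>"
| "no_agg (Ex y \<phi>) \<longleftrightarrow> no_agg \<phi>"
| "no_agg (SumEq s w ys \<phi>) \<longleftrightarrow> no_agg \<phi>"
| "no_agg (Pred P ts) \<longleftrightarrow> (\<forall>t\<in>set ts. no_agg_tm t)"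
| "no_agg_tm (Const S s) \<longleftrightarrow> True"
| "no_agg_tm (Wt w xs) \<longleftrightarrow> True"
| "no_agg_tm (Plus t u) \<longleftrightarrow> no_agg_tm t \<and> no_agg_tm u"
| "no_agg_tm (Minus t u) \<longleftrightarrow> no_agg_tm t \<and> no_agg_tm u"
| "no_agg_tm (Times t u) \<longleftrightarrow> no_agg_tm t \<and> no_agg_tm u"
| "no_agg_tm (Agg S p \<phi>) \<longleftrightarrow> False"

definition WA1 ::
  "('r, 'w, 'p, 's, 'e) wa_setting \<Rightarrow> 'r set \<Rightarrow> ('r, 'w, 'p, 's, 'e) fm set" where
  "WA1 V \<sigma> = {\<phi>. wa_fm V \<sigma> \<phi> \<and> wa1_restr V \<phi>}"

definition FOW1 ::
  "('r, 'w, 'p, 's, 'e) wa_setting \<Rightarrow> 'r set \<Rightarrow> ('r, 'w, 'p, 's, 'e) fm set" where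
  "FOW1 V \<sigma> = {\<phi> \<in> WA1 V \<sigma>. no_agg \<phi>}"

section \<open>Semantics\<close>

definition upd :: "(nat \<Rightarrow> 'a) \<Rightarrow> nat list \<Rightarrow> 'a list \<Rightarrow> nat \<Rightarrow> 'a" where
  "upd \<beta> ys as v = (case map_of (zip ys as) v of None \<Rightarrow> \<beta> v | Some a \<Rightarrow> a)"

fun factor_val :: "('a, 'r, 'w, 'e) wstruct \<Rightarrow> (nat \<Rightarrow> 'a) \<Rightarrow> ('w, 'e) factor \<Rightarrow> 'e" where
  "factor_val A \<beta> (FElem s) = s"
| "factor_val A \<beta> (FWt w ys) = wt A w (map \<beta> ys)"

text \<open>A one-element product must not involve the multiplication, since it may be taken in a
  group.\<close>

fun list_prod :: "'e ring \<Rightarrow> 'e list \<Rightarrow> 'e" where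
  "list_prod G [] = \<one>\<^bsub>G\<^esub>"
| "list_prod G [v] = v"
| "list_prod G (v # u # us) = v \<otimes>\<^bsub>G\<^esub> list_prod G (u # us)"

fun sat ::
  "('r, 'w, 'p, 's, 'e) wa_setting \<Rightarrow> ('a, 'r, 'w, 'e) wstruct \<Rightarrow>
   ('r, 'w, 'p, 's, 'e) fm \<Rightarrow> (nat \<Rightarrow> 'a) \<Rightarrow> bool"
and val ::
  "('r, 'w, 'p, 's, 'e) wa_setting \<Rightarrow> ('a, 'r, 'w, 'e) wstruct \<Rightarrow>
   ('r, 'w, 'p, 's, 'e) tm \<Rightarrow> (nat \<Rightarrow> 'a) \<Rightarrow> 'e"
where
  "sat V A (EqV x y) \<beta> \<longleftrightarrow> \<beta> x = \<beta> y"
| "sat V A (Rel R xs) \<beta> \<longleftrightarrow> map \<beta> xs \<in> rel A R"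
| "sat V A (WtEq s w xs) \<beta> \<longleftrightarrow> s = wt A w (map \<beta> xs)"
| "sat V A (Neg \<phi>) \<beta> \<longleftrightarrow> \<not> sat V A \<phi> \<beta>"
| "sat V A (Or \<phi> \<psi>) \<beta> \<longleftrightarrow> sat V A \<phi> \<beta> \<or> sat V A \<psi> \<beta>"
| "sat V A (Ex y \<phi>) \<beta> \<longleftrightarrow> (\<exists>a\<in>univ A. sat V A \<phi> (\<beta>(y := a)))"
| "sat V A (SumEq s w ys \<phi>) \<beta> \<longleftrightarrow>
     s = finsum (alg V (wt_type V w)) (wt A w)
           {as \<in> tuples (univ A) (wt_ar V w). sat V A \<phi> (upd \<beta> ys as)}"
| "sat V A (Pred P ts) \<beta> \<longleftrightarrow> map (\<lambda>t. val V A t \<beta>) ts \<in> pred_sem V P"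
| "val V A (Const S s) \<beta> = s"
| "val V A (Wt w xs) \<beta> = wt A w (map \<beta> xs)"
| "val V A (Plus t u) \<beta> = val V A t \<beta> \<oplus>\<^bsub>alg V (tm_type V t)\<^esub> val V A u \<beta>"
| "val V A (Minus t u) \<beta> = val V A t \<beta> \<ominus>\<^bsub>alg V (tm_type V t)\<^esub> val V A u \<beta>"
| "val V A (Times t u) \<beta> = val V A t \<beta> \<otimes>\<^bsub>alg V (tm_type V t)\<^esub> val V A u \<beta>"
| "val V A (Agg S p \<phi>) \<beta> =
     finsum (alg V S)
       (\<lambda>g. list_prod (alg V S) (map (factor_val A (override_on \<beta> g (prod_vars p))) p))
       {g \<in> prod_vars p \<rightarrow>\<^sub>E univ A. sat V A \<phi> (override_on \<beta> g (prod_vars p))}"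

text \<open>\<open>holds V A \<phi> xs as\<close> is \<open>A \<Turnstile> \<phi>[as]\<close>, where \<open>xs\<close> lists the variables that are assigned
  \<open>as\<close>. The remaining variables get an arbitrary element of the universe; in all uses they are not
  free in \<open>\<phi>\<close>.\<close>

definition holds ::
  "('r, 'w, 'p, 's, 'e) wa_setting \<Rightarrow> ('a, 'r, 'w, 'e) wstruct \<Rightarrow>
   ('r, 'w, 'p, 's, 'e) fm \<Rightarrow> nat list \<Rightarrow> 'a list \<Rightarrow> bool" where
  "holds V A \<phi> xs as \<longleftrightarrow> sat V A \<phi> (upd (\<lambda>_. SOME a. a \<in> univ A) xs as)"

section \<open>The class of formulas used in decompositions\<close>

fun preds_in :: "('r, 'w, 'p, 's, 'e) fm \<Rightarrow> 'p set"
and preds_in_tm :: "('r, 'w, 'p, 's, 'e) tm \<Rightarrow> 'p set"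
where
  "preds_in (EqV x y) = {}"
| "preds_in (Rel R xs) = {}"
| "preds_in (WtEq s w xs) = {}"
| "preds_in (Neg \<phi>) = preds_in \<phi>"
| "preds_in (Or \<phi> \<psi>) = preds_in \<phi> \<union> preds_in \<psi>"
| "preds_in (Ex y \<phi>) = preds_in \<phi>"
| "preds_in (SumEq s w ys \<phi>) = preds_in \<phi>"
| "preds_in (Pred P ts) = insert P (\<Union>t\<in>set ts. preds_in_tm t)"
| "preds_in_tm (Const S s) = {}"
| "preds_in_tm (Wt w xs) = {}"
| "preds_in_tm (Plus t u) = preds_in_tm t \<union> preds_in_tm u"
| "preds_in_tm (Minus t u) = preds_in_tm t \<union> preds_in_tm u"
| "preds_in_tm (Times t u) = preds_in_tm t \<union> preds_in_tm u"
| "preds_in_tm (Agg S p \<phi>) = preds_in \<phi>"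

text \<open>The terms occurring in a formula. The element and the weight expression that appear in
  \<open>WtEq s w xs\<close> and \<open>SumEq s w ys \<phi>\<close> (and the factors of a product) are themselves terms, so they
  count as occurring.\<close>

fun factor_tm :: "'s \<Rightarrow> ('w, 'e) factor \<Rightarrow> ('r, 'w, 'p, 's, 'e) tm" where
  "factor_tm S (FElem s) = Const S s"
| "factor_tm S (FWt w ys) = Wt w ys"

fun tms_in ::
  "('r, 'w, 'p, 's, 'e) wa_setting \<Rightarrow> ('r, 'w, 'p, 's, 'e) fm \<Rightarrow> ('r, 'w, 'p, 's, 'e) tm set"
and subtms ::
  "('r, 'w, 'p, 's, 'e) wa_setting \<Rightarrow> ('r, 'w, 'p, 's, 'e) tm \<Rightarrow> ('r, 'w, 'p, 's, 'e) tm set"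
where
  "tms_in V (EqV x y) = {}"
| "tms_in V (Rel R xs) = {}"
| "tms_in V (WtEq s w xs) = {Const (wt_type V w) s, Wt w xs}"
| "tms_in V (Neg \<phi>) = tms_in V \<phi>"
| "tms_in V (Or \<phi> \<psi>) = tms_in V \<phi> \<union> tms_in V \<psi>"
| "tms_in V (Ex y \<phi>) = tms_in V \<phi>"
| "tms_in V (SumEq s w ys \<phi>) = {Const (wt_type V w) s, Wt w ys} \<union> tms_in V \<phi>"
| "tms_in V (Pred P ts) = (\<Union>t\<in>set ts. subtms V t)"
| "subtms V (Const S s) = {Const S s}"
| "subtms V (Wt w xs) = {Wt w xs}"
| "subtms V (Plus t u) = insert (Plus t u) (subtms V t \<union> subtms V u)"
| "subtms V (Minus t u) = insert (Minus t u) (subtms V t \<union> subtms V u)"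
| "subtms V (Times t u) = insert (Times t u) (subtms V t \<union> subtms V u)"
| "subtms V (Agg S p \<phi>) = insert (Agg S p \<phi>) (factor_tm S ` set p \<union> tms_in V \<phi>)"

definition algs_in ::
  "('r, 'w, 'p, 's, 'e) wa_setting \<Rightarrow> ('r, 'w, 'p, 's, 'e) fm \<Rightarrow> 's set" where
  "algs_in V \<phi> = tm_type V ` tms_in V \<phi>"

definition fv_class ::
  "('r, 'w, 'p, 's, 'e) wa_setting \<Rightarrow> 'r set \<Rightarrow> ('r, 'w, 'p, 's, 'e) fm \<Rightarrow>
   ('r, 'w, 'p, 's, 'e) fm set" where
  "fv_class V \<sigma> \<phi> =
     {\<alpha> \<in> FOW1 V \<sigma>.
        qr \<alpha> \<le> qr \<phi> \<and>
        preds_in \<alpha> \<subseteq> preds_in \<phi> \<and>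
        algs_in V \<alpha> \<subseteq> algs_in V \<phi> \<and>
        tms_in V \<alpha> \<subseteq> tms_in V \<phi> \<union>
          {Const S s | S s. S \<in> algs_in V \<phi> \<and> finite (carrier (alg V S)) \<and> s \<in> carrier (alg V S)}}"

section \<open>Feferman-Vaught decompositions\<close>

text \<open>The first argument only serves to name the type over which the universes range.\<close>

definition fv_decomposition ::
  "'a itself \<Rightarrow> ('r, 'w, 'p, 's, 'e) wa_setting \<Rightarrow> 'r set \<Rightarrow> 'r \<Rightarrow> 'r \<Rightarrow>
   ('r, 'w, 'p, 's, 'e) fm set \<Rightarrow> ('r, 'w, 'p, 's, 'e) fm \<Rightarrow> nat list \<Rightarrow> nat list \<Rightarrow>
   (('r, 'w, 'p, 's, 'e) fm \<times> ('r, 'w, 'p, 's, 'e) fm) set \<Rightarrow> bool" where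
  "fv_decomposition _ V \<sigma> X Y L \<phi> xs ys \<Delta> \<longleftrightarrow>
     finite \<Delta> \<and> \<Delta> \<noteq> {} \<and>
     (\<forall>(\<alpha>, \<beta>)\<in>\<Delta>. \<alpha> \<in> L \<and> \<beta> \<in> L \<and> free \<alpha> \<subseteq> set xs \<and> free \<beta> \<subseteq> set ys) \<and>
     (\<forall>(A :: ('a, 'r, 'w, 'e) wstruct) B as bs.
        is_wstruct V \<sigma> A \<and> is_wstruct V \<sigma> B \<and> univ A \<inter> univ B = {} \<and>
        as \<in> tuples (univ A) (length xs) \<and> bs \<in> tuples (univ B) (length ys) \<longrightarrow>
        (holds V (disjoint_sum V X Y A B) \<phi> (xs @ ys) (as @ bs) \<longleftrightarrow>
         (\<exists>(\<alpha>, \<beta>)\<in>\<Delta>. holds V A \<alpha> xs as \<and> holds V B \<beta> ys bs)))"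

definition has_fv_candidates ::
  "('r, 'w, 'p, 's, 'e) fm set \<Rightarrow> nat list \<Rightarrow> nat list \<Rightarrow> bool" where
  "has_fv_candidates L xs ys \<longleftrightarrow>
     (\<exists>\<alpha>\<in>L. free \<alpha> \<subseteq> set xs) \<and> (\<exists>\<beta>\<in>L. free \<beta> \<subseteq> set ys)"

text \<open>
  Since a decomposition is non-empty, it can only exist if there are candidates for its components
  at all. As the logic has no Boolean constants, this is not automatic if one of the two tuples is
  empty and the quantifier rank is 0.
\<close>

lemma fv_decomposition_imp_candidates:
  assumes "fv_decomposition T V \<sigma> X Y L \<phi> xs ys \<Delta>"
  shows "has_fv_candidates L xs ys"
  using assms unfolding fv_decomposition_def has_fv_candidates_def by fast

lemma qr0_free_nonempty:
  assumes "wa_setting_ok V" "\<forall>R\<in>\<sigma>. rel_ar V R \<ge> 1"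
  shows "wa_fm V \<sigma> \<alpha> \<Longrightarrow> qr \<alpha> = 0 \<Longrightarrow> preds_in \<alpha> = {} \<Longrightarrow> free \<alpha> \<noteq> {}"
proof (induction "size \<alpha>" arbitrary: \<alpha> rule: less_induct)
  case less
  show ?case
  proof (cases \<alpha>)
    case (Rel R xs)
    then show ?thesis using less.prems assms(2) by (cases xs) auto
  next
    case (WtEq s w xs)
    then show ?thesis using less.prems assms(1) by (cases xs) (auto simp: wa_setting_ok_def)
  next
    case (Neg \<phi>)
    then show ?thesis using less.prems less.hyps[of \<phi>] by simp
  next
    case (Or \<phi> \<psi>)
    then show ?thesis using less.prems less.hyps[of \<phi>] by simp
  qed (use less.prems in simp_all)
qed

lemma no_candidates_EqV:
  assumes "wa_setting_ok V" "\<forall>R\<in>\<sigma>. rel_ar V R \<ge> 1"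
  shows "\<not> has_fv_candidates (fv_class V \<sigma> (EqV x x)) [x] []"
  using qr0_free_nonempty[OF assms]
  by (auto simp: has_fv_candidates_def fv_class_def FOW1_def WA1_def)

section \<open>Algorithms\<close>

text \<open>
  The computation model is a first-order functional language on S-expressions in the style of
  Jones' language F: a program is a single expression \<open>F\<close> that may call itself recursively. It is
  Turing complete (natural numbers are lists of \<open>SNil\<close>). The atoms stand for the relation, weight
  and predicate symbols, the names of rings and groups, and the elements of the latter; as the
  carriers may be uncountable, these are treated as indivisible data. A program can only test atoms
  for equality and mention finitely many of them as constants; it has no access to the operations
  of the rings and groups or to the semantics of the predicates. For countably many atoms, any
  injective coding of them by numbers turns such a program into an ordinary algorithm.
\<close>

datatype 'u sexp = SNil | SAtom 'u | SCons "'u sexp" "'u sexp"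

fun car :: "'u sexp \<Rightarrow> 'u sexp" where
  "car (SCons u v) = u"
| "car _ = SNil"

fun cdr :: "'u sexp \<Rightarrow> 'u sexp" where
  "cdr (SCons u v) = v"
| "cdr _ = SNil"

fun sbool :: "bool \<Rightarrow> 'u sexp" where
  "sbool True = SCons SNil SNil"
| "sbool False = SNil"

datatype 'u expr =
    Arg
  | Quote "'u sexp"
  | Pair "'u expr" "'u expr"
  | Car "'u expr"
  | Cdr "'u expr"
  | IsPair "'u expr"
  | Equal "'u expr" "'u expr"
  | Cond "'u expr" "'u expr" "'u expr"
  | Bind "'u expr" "'u expr"
  | Call "'u expr"

text \<open>\<open>eval F e x v\<close>: with program \<open>F\<close> and argument \<open>x\<close>, the expression \<open>e\<close> terminates with value
  \<open>v\<close>. \<open>Bind a b\<close> evaluates \<open>b\<close> with the value of \<open>a\<close> as argument.\<close>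

inductive eval :: "'u expr \<Rightarrow> 'u expr \<Rightarrow> 'u sexp \<Rightarrow> 'u sexp \<Rightarrow> bool" for F where
  Arg: "eval F Arg x x"
| Quote: "eval F (Quote c) x c"
| Pair: "eval F a x u \<Longrightarrow> eval F b x v \<Longrightarrow> eval F (Pair a b) x (SCons u v)"
| Car: "eval F a x u \<Longrightarrow> eval F (Car a) x (car u)"
| Cdr: "eval F a x u \<Longrightarrow> eval F (Cdr a) x (cdr u)"
| IsPair: "eval F a x u \<Longrightarrow> eval F (IsPair a) x (sbool (\<exists>v w. u = SCons v w))"
| Equal: "eval F a x u \<Longrightarrow> eval F b x v \<Longrightarrow> eval F (Equal a b) x (sbool (u = v))"
| CondT: "eval F c x u \<Longrightarrow> u \<noteq> SNil \<Longrightarrow> eval F a x v \<Longrightarrow> eval F (Cond c a b) x v"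
| CondF: "eval F c x SNil \<Longrightarrow> eval F b x v \<Longrightarrow> eval F (Cond c a b) x v"
| Bind: "eval F a x u \<Longrightarrow> eval F b u v \<Longrightarrow> eval F (Bind a b) x v"
| Call: "eval F a x u \<Longrightarrow> eval F F u v \<Longrightarrow> eval F (Call a) x v"

definition computes :: "'u expr \<Rightarrow> 'u sexp \<Rightarrow> 'u sexp \<Rightarrow> bool" where
  "computes F input output \<longleftrightarrow> eval F F input output"

inductive_cases eval_cases:
  "eval F Arg x v"
  "eval F (Quote c) x v"
  "eval F (Pair a b) x v"
  "eval F (Car a) x v"
  "eval F (Cdr a) x v"
  "eval F (IsPair a) x v"
  "eval F (Equal a b) x v"
  "eval F (Cond c a b) x v"
  "eval F (Bind a b) x v"
  "eval F (Call a) x v"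

lemma eval_deterministic: "eval F e x u \<Longrightarrow> eval F e x v \<Longrightarrow> u = v"
  by (induction arbitrary: v rule: eval.induct) (erule eval_cases; blast)+

datatype ('r, 'w, 'p, 's, 'e) atom =
    ARel 'r | AWt 'w | APred 'p | AAlg 's | AElem 'e

primrec snum :: "nat \<Rightarrow> 'u sexp" where
  "snum 0 = SNil"
| "snum (Suc n) = SCons SNil (snum n)"

primrec slist :: "'u sexp list \<Rightarrow> 'u sexp" where
  "slist [] = SNil"
| "slist (d # ds) = SCons d (slist ds)"

definition svars :: "nat list \<Rightarrow> 'u sexp" where
  "svars xs = slist (map snum xs)"

fun enc_factor :: "('w, 'e) factor \<Rightarrow> ('r, 'w, 'p, 's, 'e) atom sexp" where
  "enc_factor (FElem s) = slist [snum 0, SAtom (AElem s)]"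
| "enc_factor (FWt w ys) = slist [snum 1, SAtom (AWt w), svars ys]"

fun enc :: "('r, 'w, 'p, 's, 'e) fm \<Rightarrow> ('r, 'w, 'p, 's, 'e) atom sexp"
and enc_tm :: "('r, 'w, 'p, 's, 'e) tm \<Rightarrow> ('r, 'w, 'p, 's, 'e) atom sexp"
where
  "enc (EqV x y) = slist [snum 0, snum x, snum y]"
| "enc (Rel R xs) = slist [snum 1, SAtom (ARel R), svars xs]"
| "enc (WtEq s w xs) = slist [snum 2, SAtom (AElem s), SAtom (AWt w), svars xs]"
| "enc (Neg \<phi>) = slist [snum 3, enc \<phi>]"
| "enc (Or \<phi> \<psi>) = slist [snum 4, enc \<phi>, enc \<psi>]"
| "enc (Ex y \<phi>) = slist [snum 5, snum y, enc \<phi>]"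
| "enc (SumEq s w ys \<phi>) = slist [snum 6, SAtom (AElem s), SAtom (AWt w), svars ys, enc \<phi>]"
| "enc (Pred P ts) = slist [snum 7, SAtom (APred P), slist (map enc_tm ts)]"
| "enc_tm (Const S s) = slist [snum 0, SAtom (AAlg S), SAtom (AElem s)]"
| "enc_tm (Wt w xs) = slist [snum 1, SAtom (AWt w), svars xs]"
| "enc_tm (Plus t u) = slist [snum 2, enc_tm t, enc_tm u]"
| "enc_tm (Minus t u) = slist [snum 3, enc_tm t, enc_tm u]"
| "enc_tm (Times t u) = slist [snum 4, enc_tm t, enc_tm u]"
| "enc_tm (Agg S p \<phi>) = slist [snum 5, SAtom (AAlg S), slist (map enc_factor p), enc \<phi>]"

definition enc_input ::
  "('r, 'w, 'p, 's, 'e) fm \<Rightarrow> nat list \<Rightarrow> nat list \<Rightarrow> ('r, 'w, 'p, 's, 'e) atom sexp" where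
  "enc_input \<phi> xs ys = slist [enc \<phi>, svars xs, svars ys]"

definition enc_output ::
  "(('r, 'w, 'p, 's, 'e) fm \<times> ('r, 'w, 'p, 's, 'e) fm) list \<Rightarrow>
   ('r, 'w, 'p, 's, 'e) atom sexp" where
  "enc_output ps = slist (map (\<lambda>(\<alpha>, \<beta>). SCons (enc \<alpha>) (enc \<beta>)) ps)"

end

theory Submission
  imports Defs
begin

text \<open>
  Relative to an assignment of the free variables to the two summands, a formula is translated into a
  disjunction of rows \<open>(\<alpha>, \<beta>)\<close>. Atoms can be evaluated in one summand (or are false, or, for
  weights of mixed tuples, zero); negation is complementation of a disjunctive normal form; an
  existential quantifier chooses the summand of its witness. A sum over tuples of the disjoint sum is
  the sum over the left tuples plus the sum over the right ones: for a left tuple, the rows for the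
  body reduce to a disjunction of left components as soon as it is known which right components hold,
  and a finite type \<open>S\<close> leaves finitely many pairs \<open>s\<^sub>1 + s\<^sub>2 = s\<close> to consider.

  For the algorithm, computable functions on encodings are closed under
  composition, case distinction and recursion with two recursive calls. No explicit program is needed
  since programs can be merged by tagging their recursive calls.
\<close>

section \<open>Closure properties of computable functions\<close>

text \<open>The logic has no truth constants, and when a tuple of variables is empty the admissible
  class may contain no closed formula at all. Rows may therefore lack a component, and only at the
  end are the gaps filled with a tautology \<open>taut\<close> over some admissible formula. The
  hypothesis of the theorem only says that one exists, so a canonical one has to be found
  effectively. Ranks do not grow because finding out which components of the other side hold takes
  Boolean operations only, so a sum costs a single \<open>SumEq\<close>; its new constants are those
  that the class grants for finite types. A predicate atom is never split, as it has at most one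
  free variable. A program cannot add elements of a ring or group, but it only needs tables. The set
  of weight symbols is finite, so only finitely many finite types have to be summed over and only
  finitely many zeros are asked for. These tables, and a nullary relation symbol if there is one,
  are chosen once and become constants of the program.\<close>

primrec reloc :: "'u sexp \<Rightarrow> 'u expr \<Rightarrow> 'u expr" where
  "reloc t Arg = Arg"
| "reloc t (Quote c) = Quote c"
| "reloc t (Pair a b) = Pair (reloc t a) (reloc t b)"
| "reloc t (Car a) = Car (reloc t a)"
| "reloc t (Cdr a) = Cdr (reloc t a)"
| "reloc t (IsPair a) = IsPair (reloc t a)"
| "reloc t (Equal a b) = Equal (reloc t a) (reloc t b)"
| "reloc t (Cond c a b) = Cond (reloc t c) (reloc t a) (reloc t b)"
| "reloc t (Bind a b) = Bind (reloc t a) (reloc t b)"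
| "reloc t (Call a) = Call (Pair (Quote t) (reloc t a))"

text \<open>Only the \<open>Call\<close> case of the induction depends on the surrounding program.
  There the premise applies: \<open>G\<close>, called with tag \<open>t\<close>, behaves like the
  relocated body of \<open>F\<close>.\<close>

lemma eval_reloc:
  assumes "\<And>u v. eval G (reloc t F) u v \<Longrightarrow> eval G G (SCons t u) v"
  shows "eval F e x v \<Longrightarrow> eval G (reloc t e) x v"
  by (induction rule: eval.induct) (auto intro: eval.intros assms)

definition fork :: "'u expr \<Rightarrow> 'u expr \<Rightarrow> 'u expr" where
  "fork F G = Cond (Equal (Car Arg) (Quote SNil)) (Bind (Cdr Arg) F) (Bind (Cdr Arg) G)"

lemma eval_CarArg: "eval F (Car Arg) (SCons a b) a"
  using eval.Car[OF eval.Arg, of F "SCons a b"] by simp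

lemma eval_CdrArg: "eval F (Cdr Arg) (SCons a b) b"
  using eval.Cdr[OF eval.Arg, of F "SCons a b"] by simp

lemma eval_tag: "eval F (Equal (Car Arg) (Quote SNil)) (SCons t x) (sbool (t = SNil))"
  by (rule eval.Equal[OF eval_CarArg eval.Quote])

lemma eval_fork1: "eval H F x v \<Longrightarrow> eval H (fork F G) (SCons SNil x) v"
  unfolding fork_def
  using eval_tag[of H SNil x] eval.Bind[OF eval_CdrArg, of H F x v SNil] by (auto intro: eval.CondT)

lemma eval_fork2: "t \<noteq> SNil \<Longrightarrow> eval H G x v \<Longrightarrow> eval H (fork F G) (SCons t x) v"
  unfolding fork_def
  using eval_tag[of H t x] eval.Bind[OF eval_CdrArg, of H G x v t] by (auto intro: eval.CondF)

abbreviation unit1 :: "'u sexp" where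
  "unit1 \<equiv> SCons SNil SNil"

text \<open>The set \<open>D\<close> only indexes the inputs: on input of the values \<open>a x\<close> for \<open>a\<close> in \<open>as\<close>, the program
  returns \<open>f x\<close>. So \<open>as\<close> plays the role of an environment of available values.\<close>

definition computable :: "'x set \<Rightarrow> ('x \<Rightarrow> 'u sexp) list \<Rightarrow> ('x \<Rightarrow> 'u sexp) \<Rightarrow> bool" where
  "computable D as f \<longleftrightarrow> (\<exists>F e. \<forall>x\<in>D. eval F e (slist (map (\<lambda>a. a x) as)) (f x))"

text \<open>Each program calls itself under its own tag, and \<open>fork\<close> sends a tagged call
  back to the right body. Expressions written for different programs can thus be combined into
  one.\<close>

lemma common_program:
  "\<exists>H. (\<forall>e x v. eval F e x v \<longrightarrow> eval H (reloc SNil e) x v) \<and>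
       (\<forall>e x v. eval G e x v \<longrightarrow> eval H (reloc unit1 e) x v)"
proof (intro exI conjI allI impI)
  let ?H = "fork (reloc SNil F) (reloc unit1 G)"
  show "eval ?H (reloc SNil e) x v" if "eval F e x v" for e x v
    by (rule eval_reloc[OF eval_fork1 that])
  show "eval ?H (reloc unit1 e) x v" if "eval G e x v" for e x v
    by (rule eval_reloc[OF eval_fork2 that]) simp_all
qed

lemma computable2E:
  assumes "computable D as f" "computable E bs g"
  obtains F e e' where
    "\<And>x. x \<in> D \<Longrightarrow> eval F e (slist (map (\<lambda>a. a x) as)) (f x)"
    "\<And>x. x \<in> E \<Longrightarrow> eval F e' (slist (map (\<lambda>a. a x) bs)) (g x)"
proof -
  obtain F e where 1: "\<forall>x\<in>D. eval F e (slist (map (\<lambda>a. a x) as)) (f x)"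
    using assms(1) unfolding computable_def by blast
  obtain G e' where 2: "\<forall>x\<in>E. eval G e' (slist (map (\<lambda>a. a x) bs)) (g x)"
    using assms(2) unfolding computable_def by blast
  from common_program[of F G] 1 2 show thesis by (blast intro: that)
qed

lemma computableI:
  assumes "\<And>x. x \<in> D \<Longrightarrow> eval F e (slist (map (\<lambda>a. a x) as)) (f x)"
  shows "computable D as f"
  using assms unfolding computable_def by blast

lemma computable_cong:
  assumes "\<And>x. x \<in> D \<Longrightarrow> f x = g x" "computable D as g"
  shows "computable D as f"
  using assms unfolding computable_def by auto

text \<open>A program sees only the values of the environment, so the index may be changed as long
  as inputs and outputs agree.\<close>

lemma computable_reindex:
  assumes "computable E bs g"
    and "\<And>x. x \<in> D \<Longrightarrow> \<exists>y\<in>E. map (\<lambda>a. a x) as = map (\<lambda>b. b y) bs \<and> f x = g y"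
  shows "computable D as f"
  using assms unfolding computable_def by metis

lemma computable_mono: "computable E as f \<Longrightarrow> D \<subseteq> E \<Longrightarrow> computable D as f"
  unfolding computable_def by blast

lemma computable_const: "computable D as (\<lambda>x. c)"
  by (rule computableI, rule eval.Quote)

lemma computable_SCons:
  assumes "computable D as f" "computable D as g"
  shows "computable D as (\<lambda>x. SCons (f x) (g x))"
  using assms by (rule computable2E) (rule computableI, rule eval.Pair, blast+)

lemma computable_car: "computable D as f \<Longrightarrow> computable D as (\<lambda>x. car (f x))"
  unfolding computable_def by (blast intro: eval.Car)

lemma computable_cdr: "computable D as f \<Longrightarrow> computable D as (\<lambda>x. cdr (f x))"
  unfolding computable_def by (blast intro: eval.Cdr)

lemma computable_fst: "computable D as (\<lambda>x. SCons (f x) (g x)) \<Longrightarrow> computable D as f"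
  using computable_car[of D as "\<lambda>x. SCons (f x) (g x)"] by simp

lemma computable_snd: "computable D as (\<lambda>x. SCons (f x) (g x)) \<Longrightarrow> computable D as g"
  using computable_cdr[of D as "\<lambda>x. SCons (f x) (g x)"] by simp

lemma computable_is_pair:
  "computable D as f \<Longrightarrow> computable D as (\<lambda>x. sbool (\<exists>u v. f x = SCons u v))"
  unfolding computable_def by (blast intro: eval.IsPair)

lemma computable_eq:
  assumes "computable D as f" "computable D as g"
  shows "computable D as (\<lambda>x. sbool (f x = g x))"
  using assms by (rule computable2E) (rule computableI, rule eval.Equal, blast+)

lemma computable_slist:
  assumes "\<And>b. b \<in> set bs \<Longrightarrow> computable D as b"
  shows "computable D as (\<lambda>x. slist (map (\<lambda>b. b x) bs))"
  using assms by (induction bs) (auto intro: computable_const computable_SCons)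

text \<open>Composition: the values \<open>b x\<close> are collected into a list, which becomes the
  input of the program for \<open>f\<close>. Together with \<open>computable_var\<close> this allows
  environments to be weakened and permuted.\<close>

lemma computable_cut:
  assumes "computable D bs f" "\<And>b. b \<in> set bs \<Longrightarrow> computable D as b"
  shows "computable D as f"
proof -
  have "computable D as (\<lambda>x. slist (map (\<lambda>b. b x) bs))"
    using assms(2) by (rule computable_slist)
  from this assms(1) obtain F e e' where
    "\<And>x. x \<in> D \<Longrightarrow> eval F e (slist (map (\<lambda>a. a x) as)) (slist (map (\<lambda>b. b x) bs))"
    "\<And>x. x \<in> D \<Longrightarrow> eval F e' (slist (map (\<lambda>b. b x) bs)) (f x)"
    by (rule computable2E) blast
  then show ?thesis by (intro computableI[of _ F "Bind e e'"] eval.Bind)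
qed

lemma computable_var:
  assumes "f \<in> set as"
  shows "computable D as f"
proof -
  have "\<exists>e. \<forall>y. eval F e (slist (map (\<lambda>a. a y) as)) (f y)" for F
    using assms
  proof (induction as)
    case (Cons a as)
    show ?case
    proof (cases "f = a")
      case True
      show ?thesis unfolding True list.map slist.simps using eval_CarArg by blast
    next
      case False
      then obtain e where "\<forall>y. eval F e (slist (map (\<lambda>a. a y) as)) (f y)" using Cons by auto
      then have "eval F (Bind (Cdr Arg) e) (slist (map (\<lambda>a. a y) (a # as))) (f y)" for y
        unfolding list.map slist.simps by (intro eval.Bind[OF eval_CdrArg]) blast
      then show ?thesis by blast
    qed
  qed simp
  then show ?thesis unfolding computable_def by blast
qed

lemma computable_weaken: "computable D bs f \<Longrightarrow> set bs \<subseteq> set as \<Longrightarrow> computable D as f"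
  by (erule computable_cut) (blast intro: computable_var)

text \<open>Only the selected branch is evaluated, so each branch has to work only on the part of
  \<open>D\<close> where it is used and may rely on the outcome of the test.\<close>

lemma computable_cases:
  assumes "computable D as (\<lambda>x. sbool (P x))"
    and "computable {x \<in> D. P x} as f" "computable {x \<in> D. \<not> P x} as f"
  shows "computable D as f"
proof -
  obtain F e1 e2 where 12:
    "\<And>x. x \<in> {x \<in> D. P x} \<Longrightarrow> eval F e1 (slist (map (\<lambda>a. a x) as)) (f x)"
    "\<And>x. x \<in> {x \<in> D. \<not> P x} \<Longrightarrow> eval F e2 (slist (map (\<lambda>a. a x) as)) (f x)"
    by (rule computable2E[OF assms(2,3)]) blast
  obtain G e where 0: "\<And>x. x \<in> D \<Longrightarrow> eval G e (slist (map (\<lambda>a. a x) as)) (sbool (P x))"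
    using assms(1) unfolding computable_def by blast
  obtain H where H: "\<And>e x v. eval F e x v \<Longrightarrow> eval H (reloc SNil e) x v"
    "\<And>e x v. eval G e x v \<Longrightarrow> eval H (reloc unit1 e) x v"
    using common_program[of F G] by blast
  show ?thesis
  proof (rule computableI)
    fix x assume x: "x \<in> D"
    show "eval H (Cond (reloc unit1 e) (reloc SNil e1) (reloc SNil e2))
        (slist (map (\<lambda>a. a x) as)) (f x)"
    proof (cases "P x")
      case True
      then show ?thesis using H(2)[OF 0[OF x]] H(1)[OF 12(1)] x by (auto intro: eval.CondT)
    next
      case False
      then show ?thesis using H(2)[OF 0[OF x]] H(1)[OF 12(2)] x by (auto intro: eval.CondF)
    qed
  qed
qed

lemma computable_if:
  assumes "computable D as (\<lambda>x. sbool (P x))"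
    and "computable {x \<in> D. P x} as f" "computable {x \<in> D. \<not> P x} as g"
  shows "computable D as (\<lambda>x. if P x then f x else g x)"
  using assms(1)
proof (rule computable_cases)
  show "computable {x \<in> D. P x} as (\<lambda>x. if P x then f x else g x)"
    by (rule computable_cong[OF _ assms(2)]) simp
  show "computable {x \<in> D. \<not> P x} as (\<lambda>x. if P x then f x else g x)"
    by (rule computable_cong[OF _ assms(3)]) simp
qed

text \<open>Lookup in a finite table: \<open>f\<close> is arbitrary, and its finitely many values
  become constants of the program. This is how zeros and decompositions into summands, which no
  program could compute from the atoms, enter the algorithm.\<close>

lemma computable_finite_map:
  assumes "finite K" "computable D as k" "\<And>x. x \<in> D \<Longrightarrow> k x \<in> K"
  shows "computable D as (\<lambda>x. f (k x))"
  using assms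
proof (induction K arbitrary: D rule: finite_induct)
  case empty
  then show ?case by (auto simp: computable_def)
next
  case (insert c K)
  show ?case
  proof (rule computable_cases[where P = "\<lambda>x. k x = c"])
    show "computable D as (\<lambda>x. sbool (k x = c))"
      using insert.prems(1) by (intro computable_eq computable_const)
    show "computable {x \<in> D. k x = c} as (\<lambda>x. f (k x))"
      by (rule computable_cong[OF _ computable_const[of _ _ "f c"]]) simp
    show "computable {x \<in> D. k x \<noteq> c} as (\<lambda>x. f (k x))"
      using insert.prems by (intro insert.IH) (auto intro: computable_mono)
  qed
qed

lemma computable_sbool_not:
  fixes as :: "('x \<Rightarrow> 'u sexp) list"
  assumes "computable D as (\<lambda>x. sbool (P x))"
  shows "computable D as (\<lambda>x. sbool (\<not> P x))"
proof (rule computable_cong)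
  show "computable D as (\<lambda>x. sbool ((sbool (P x) :: 'u sexp) = SNil))"
    by (intro computable_eq computable_const assms)
qed (metis sbool.simps sexp.distinct(3))

lemma computable_sbool_conj:
  assumes "computable D as (\<lambda>x. sbool (P x))" "computable {x \<in> D. P x} as (\<lambda>x. sbool (Q x))"
  shows "computable D as (\<lambda>x. sbool (P x \<and> Q x))"
proof (rule computable_cong)
  show "computable D as (\<lambda>x. if P x then sbool (Q x) else SNil)"
    by (intro computable_if computable_const assms)
qed auto

text \<open>A program can call itself on the environments of \<open>k x\<close> and
  \<open>k' x\<close> once it can compute them, and the measure \<open>m\<close> makes the calls
  terminate. The results are put in front of the original environment for \<open>step\<close>.
  Recursion with a single call is the case \<open>k = k'\<close>.\<close>

lemma computable_rec:
  assumes test: "computable D as (\<lambda>x. sbool (c x))"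
    and base: "computable {x \<in> D. c x} as f"
    and desc: "\<And>x. x \<in> D \<Longrightarrow> \<not> c x \<Longrightarrow> k x \<in> D \<and> k' x \<in> D \<and> m (k x) < m x \<and> m (k' x) < (m x :: nat)"
    and arg: "\<And>a. a \<in> set as \<Longrightarrow> computable {x \<in> D. \<not> c x} as (\<lambda>x. a (k x))"
      "\<And>a. a \<in> set as \<Longrightarrow> computable {x \<in> D. \<not> c x} as (\<lambda>x. a (k' x))"
    and step: "computable {x \<in> D. \<not> c x} ((\<lambda>x. f (k x)) # (\<lambda>x. f (k' x)) # as) f"
  shows "computable D as f"
proof -
  define E where "E = {x \<in> D. \<not> c x}"
  define env where "env x = slist (map (\<lambda>a. a x) as)" for x
  have args: "computable E as (\<lambda>x. env (h x))"
    if "\<And>a. a \<in> set as \<Longrightarrow> computable E as (\<lambda>x. a (h x))" for h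
    unfolding env_def
    using computable_slist[of "map (\<lambda>a x. a (h x)) as" E as] that by (auto simp: comp_def)
  \<comment> \<open>The mark \<open>unit1\<close> announces a final result, \<open>SNil\<close> the
    environments of the two calls.\<close>
  define g where "g x = (if c x then SCons unit1 (f x) else SCons SNil (SCons (env (k x)) (env (k' x))))" for x
  have "computable E as (\<lambda>x. env (k x))" "computable E as (\<lambda>x. env (k' x))"
    using arg by (intro args; simp add: E_def)+
  then have "computable D as g"
    unfolding g_def using base
    by (intro computable_if test computable_SCons computable_const) (auto simp: E_def)
  from this step[folded E_def] obtain F e e' where
    *: "\<And>x. x \<in> D \<Longrightarrow> eval F e (slist (map (\<lambda>a. a x) as)) (g x)"
    "\<And>x. x \<in> E \<Longrightarrow> eval F e'
      (slist (map (\<lambda>a. a x) ((\<lambda>x. f (k x)) # (\<lambda>x. f (k' x)) # as))) (f x)"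
    by (rule computable2E) (rule that)
  have e: "eval F e (env x) (g x)" if "x \<in> D" for x
    using *(1)[OF that] by (simp add: env_def)
  have e': "eval F e' (SCons (f (k x)) (SCons (f (k' x)) (env x))) (f x)" if "x \<in> E" for x
    using *(2)[OF that] by (simp add: env_def)
  define call where "call b = Call (Pair (Quote unit1) b)" for b :: "'b expr"
  \<comment> \<open>The value of \<open>g\<close> is kept next to the original input. In the
    recursive case both results are consed onto that input, which is the format that
    \<open>e'\<close> expects.\<close>
  define body where "body = Bind (Pair (reloc SNil e) Arg) (Cond (Car (Car Arg)) (Cdr (Car Arg))
     (Bind (Pair (call (Car (Cdr (Car Arg)))) (Pair (call (Cdr (Cdr (Car Arg)))) (Cdr Arg))) (reloc SNil e')))"
  \<comment> \<open>Calls with tag \<open>SNil\<close> serve the subroutines, calls with tag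
    \<open>unit1\<close> the recursion itself.\<close>
  define H where "H = fork (reloc SNil F) body"
  have lib: "eval H (reloc SNil a) x v" if "eval F a x v" for a x v
    unfolding H_def by (rule eval_reloc[OF eval_fork1 that])
  have call: "eval H (call b) x v" if "eval H b x u" "eval H body u v" for b x u v
    unfolding call_def by (rule eval.Call[OF eval.Pair[OF eval.Quote that(1)]])
      (use that(2) in \<open>auto simp: H_def intro: eval_fork2\<close>)
  have "x \<in> D \<Longrightarrow> eval H body (env x) (f x)" for x
  proof (induction "m x" arbitrary: x rule: less_induct)
    case less
    let ?z = "SCons (g x) (env x)"
    have z: "eval H (Pair (reloc SNil e) Arg) (env x) ?z"
      using less.prems by (intro eval.Pair lib e eval.Arg)
    have gz: "eval H (Car Arg) ?z (g x)" by (rule eval_CarArg)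
    show ?case unfolding body_def
    proof (rule eval.Bind[OF z], cases "c x")
      case True
      have "eval H (Car (Car Arg)) ?z unit1" "eval H (Cdr (Car Arg)) ?z (f x)"
        using eval.Car[OF gz] eval.Cdr[OF gz] True by (simp_all add: g_def)
      then show "eval H (Cond (Car (Car Arg)) (Cdr (Car Arg))
     (Bind (Pair (call (Car (Cdr (Car Arg)))) (Pair (call (Cdr (Cdr (Car Arg)))) (Cdr Arg))) (reloc SNil e')))
        ?z (f x)" by (auto intro: eval.CondT)
    next
      case False
      have d: "k x \<in> D" "k' x \<in> D" "m (k x) < m x" "m (k' x) < m x"
        using desc less.prems False by blast+
      have "eval H (Car (Car Arg)) ?z SNil"
        using eval.Car[OF gz] False by (simp add: g_def)
      moreover have "eval H (call (Car (Cdr (Car Arg)))) ?z (f (k x))"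
        using eval.Car[OF eval.Cdr[OF gz]] less.hyps[OF d(3,1)] False
        by (intro call) (simp_all add: g_def)
      moreover have "eval H (call (Cdr (Cdr (Car Arg)))) ?z (f (k' x))"
        using eval.Cdr[OF eval.Cdr[OF gz]] less.hyps[OF d(4,2)] False
        by (intro call) (simp_all add: g_def)
      moreover have "eval H (reloc SNil e') (SCons (f (k x)) (SCons (f (k' x)) (env x))) (f x)"
        using less.prems False by (intro lib e') (simp add: E_def)
      ultimately show "eval H (Cond (Car (Car Arg)) (Cdr (Car Arg))
     (Bind (Pair (call (Car (Cdr (Car Arg)))) (Pair (call (Cdr (Cdr (Car Arg)))) (Cdr Arg))) (reloc SNil e')))
        ?z (f x)" 
        by - (rule eval.CondF, assumption, rule eval.Bind, (rule eval.Pair, assumption)+,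
            rule eval_CdrArg, assumption)
    qed
  qed
  then show ?thesis unfolding env_def by (blast intro: computableI call eval.Arg)
qed

text \<open>In \<open>computes\<close> the program is also the expression to be evaluated, so an
  actual input must be told from an internal call. Internal calls carry \<open>SNil\<close> in
  front; the first entry of an input is different from \<open>SNil\<close>.\<close>

lemma computes_computable:
  assumes "computable D as f" "as \<noteq> []" "\<And>x. x \<in> D \<Longrightarrow> hd as x \<noteq> SNil"
  shows "\<exists>F. \<forall>x\<in>D. computes F (slist (map (\<lambda>a. a x) as)) (f x)"
proof -
  obtain F e where e: "\<And>x. x \<in> D \<Longrightarrow> eval F e (slist (map (\<lambda>a. a x) as)) (f x)"
    using assms(1) unfolding computable_def by blast
  define H where "H = Cond (Equal (Car Arg) (Quote SNil)) (Bind (Cdr Arg) (reloc SNil F)) (reloc SNil e)"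
  have call: "eval H H (SCons SNil u) v" if "eval H (reloc SNil F) u v" for u v
    using eval_tag[of H SNil u] eval.Bind[OF eval_CdrArg that, of SNil]
    unfolding H_def by (auto intro: eval.CondT)
  have "computes H (slist (map (\<lambda>a. a x) as)) (f x)" if x: "x \<in> D" for x
  proof -
    obtain u v where uv: "slist (map (\<lambda>a. a x) as) = SCons u v" "u \<noteq> SNil"
      using assms(2,3) x by (cases as) force+
    have "eval H (Equal (Car Arg) (Quote SNil)) (SCons u v) SNil"
      using eval_tag[of H u v] uv(2) by simp
    then have "eval H H (SCons u v) (f x)"
      using eval_reloc[of H SNil F, OF call e[OF x]] uv unfolding H_def by (auto intro: eval.CondF)
    then show ?thesis by (simp add: computes_def uv)
  qed
  then show ?thesis by blast
qed

section \<open>Lists\<close>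

lemma sbool_is_pair_slist: "(\<exists>u v. slist xs = SCons u v) \<longleftrightarrow> xs \<noteq> []"
  by (cases xs) auto

text \<open>The index of the step consists of the original index, the current entry and the result
  for the rest. Entries are confined to \<open>set (l x)\<close> so that the step may use what is
  known about them.\<close>

lemma computable_foldr:
  assumes l: "computable D as (\<lambda>x. slist (map e (l x)))"
    and z: "computable D as (\<lambda>x. d (z x))"
    and step: "computable {y. fst y \<in> D \<and> fst (snd y) \<in> set (l (fst y))}
      ((\<lambda>y. e (fst (snd y))) # (\<lambda>y. d (snd (snd y))) # map (\<lambda>a y. a (fst y)) as)
      (\<lambda>y. d (h (fst y) (fst (snd y)) (snd (snd y))))"
  shows "computable D as (\<lambda>x. d (foldr (h x) (l x) (z x)))"
proof -
  define E where "E = {y. fst y \<in> D \<and> set (snd y) \<subseteq> set (l (fst y))}"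
  define L where "L = (\<lambda>y :: 'a \<times> 'c list. slist (map e (snd y)))"
  define bs where "bs = (\<lambda>y. d (z (fst y))) # map (\<lambda>a (y :: 'a \<times> 'c list). a (fst y)) as"
  have map_snd: "computable F (L # bs) L" for F by (rule computable_var) simp
  have "computable E (L # bs) (\<lambda>y. d (foldr (h (fst y)) (snd y) (z (fst y))))"
  proof (rule computable_rec[where c = "\<lambda>y. snd y = []" and k = "\<lambda>y. (fst y, tl (snd y))" and
        k' = "\<lambda>y. (fst y, tl (snd y))" and m = "\<lambda>y. length (snd y)"])
    have "computable E (L # bs) (\<lambda>y. sbool (\<not> (\<exists>u v. L y = SCons u v)))"
      by (intro computable_sbool_not computable_is_pair map_snd)
    then show "computable E (L # bs) (\<lambda>y. sbool (snd y = []))"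
      unfolding L_def sbool_is_pair_slist by simp
    show "computable {y \<in> E. snd y = []} (L # bs) (\<lambda>y. d (foldr (h (fst y)) (snd y) (z (fst y))))"
      by (rule computable_cong[where g = "\<lambda>y. d (z (fst y))"])
        (auto intro: computable_var simp: bs_def)
    show tl: "computable {y \<in> E. snd y \<noteq> []} (L # bs) (\<lambda>y. a (fst y, tl (snd y)))"
      if "a \<in> set (L # bs)" for a
    proof (cases "a = L")
      case True
      show ?thesis unfolding True
      proof (rule computable_cong[OF _ computable_cdr[OF map_snd]])
        fix y assume "y \<in> {y \<in> E. snd y \<noteq> []}"
        then show "L (fst y, tl (snd y)) = cdr (L y)" by (cases "snd y") (auto simp: L_def)
      qed
    next
      case False
      with that have "a \<in> set bs" by simp
      then have "(\<lambda>y. a (fst y, tl (snd y))) = a" by (auto simp: bs_def)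
      with that show ?thesis by (auto intro: computable_var)
    qed
    then show "computable {y \<in> E. snd y \<noteq> []} (L # bs) (\<lambda>y. a (fst y, tl (snd y)))"
      if "a \<in> set (L # bs)" for a using that by simp
    show "(fst y, tl (snd y)) \<in> E \<and> (fst y, tl (snd y)) \<in> E \<and>
      length (snd (fst y, tl (snd y))) < length (snd y) \<and>
      length (snd (fst y, tl (snd y))) < length (snd y)" if "y \<in> E" "snd y \<noteq> []" for y
      using that by (cases "snd y") (auto simp: E_def)
    let ?f = "\<lambda>y. d (foldr (h (fst y)) (snd y) (z (fst y)))"
    let ?k = "\<lambda>y. (fst y, tl (snd y)) :: 'a \<times> 'c list"
    let ?as = "(\<lambda>y. e (hd (snd y))) # (\<lambda>y. ?f (?k y)) # map (\<lambda>a y. a (fst y)) as"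
    have "computable {y \<in> E. snd y \<noteq> []} ?as ?f"
    proof (rule computable_reindex[OF step])
      fix y assume "y \<in> {y \<in> E. snd y \<noteq> []}"
      then obtain a r where y: "snd y = a # r" "fst y \<in> D" "a \<in> set (l (fst y))"
        by (cases "snd y") (auto simp: E_def)
      show "\<exists>z'\<in>{y. fst y \<in> D \<and> fst (snd y) \<in> set (l (fst y))}.
        map (\<lambda>a. a y) ?as = map (\<lambda>b. b z') ((\<lambda>y. e (fst (snd y))) # (\<lambda>y. d (snd (snd y))) #
           map (\<lambda>a y. a (fst y)) as) \<and>
        ?f y = d (h (fst z') (fst (snd z')) (snd (snd z')))"
        using y by (intro bexI[of _ "(fst y, a, foldr (h (fst y)) r (z (fst y)))"]) auto
    qed
    then show "computable {y \<in> E. snd y \<noteq> []}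
      ((\<lambda>y. ?f (?k y)) # (\<lambda>y. ?f (?k y)) # L # bs) ?f"
    proof (rule computable_cut)
      fix b assume "b \<in> set ?as"
      moreover have "computable {y \<in> E. snd y \<noteq> []} ((\<lambda>y. ?f (?k y)) # (\<lambda>y. ?f (?k y)) # L # bs)
          (\<lambda>y. e (hd (snd y)))"
      proof (rule computable_cong[OF _ computable_car[OF computable_var[of L]]])
        fix y assume "y \<in> {y \<in> E. snd y \<noteq> []}"
        then show "e (hd (snd y)) = car (L y)" by (cases "snd y") (auto simp: L_def)
      qed simp
      ultimately show "computable {y \<in> E. snd y \<noteq> []}
          ((\<lambda>y. ?f (?k y)) # (\<lambda>y. ?f (?k y)) # L # bs) b"
        by (auto intro: computable_var simp: bs_def)
    qed
  qed
  then have "computable D ((\<lambda>x. slist (map e (l x))) # (\<lambda>x. d (z x)) # as)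
      (\<lambda>x. d (foldr (h x) (l x) (z x)))"
  proof (rule computable_reindex)
    fix x assume "x \<in> D"
    then show "\<exists>y\<in>E. map (\<lambda>a. a x) ((\<lambda>x. slist (map e (l x))) # (\<lambda>x. d (z x)) # as) =
        map (\<lambda>b. b y) (L # bs) \<and> d (foldr (h x) (l x) (z x)) = d (foldr (h (fst y)) (snd y) (z (fst y)))"
      by (intro bexI[of _ "(x, l x)"]) (auto simp: E_def L_def bs_def)
  qed
  then show ?thesis by (rule computable_cut) (auto intro: l z computable_var)
qed

lemma computable_append:
  assumes "computable D as (\<lambda>x. slist (map e (u x)))" "computable D as (\<lambda>x. slist (map e (v x)))"
  shows "computable D as (\<lambda>x. slist (map e (u x @ v x)))"
proof -
  have "computable D as (\<lambda>x. slist (map e (foldr (#) (u x) (v x))))"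
    by (rule computable_foldr[where d = "\<lambda>l. slist (map e l)", OF assms], unfold list.map slist.simps)
      (intro computable_SCons computable_var; simp)
  moreover have "foldr (#) a b = a @ b" for a b :: "'c list" by (induction a) auto
  ultimately show ?thesis by simp
qed

lemma computable_concat_map:
  assumes "computable D as (\<lambda>x. slist (map e (l x)))"
    and step: "computable {y. fst y \<in> D \<and> snd y \<in> set (l (fst y))}
      ((\<lambda>y. e (snd y)) # map (\<lambda>a y. a (fst y)) as)
      (\<lambda>y. slist (map d (h (fst y) (snd y))))"
  shows "computable D as (\<lambda>x. slist (map d (concat (map (h x) (l x)))))"
proof -
  let ?E = "{y. fst y \<in> D \<and> fst (snd y) \<in> set (l (fst y))}"
  have "computable D as (\<lambda>x. slist (map d (foldr (\<lambda>a r. h x a @ r) (l x) [])))"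
  proof (rule computable_foldr[where d = "\<lambda>r. slist (map d r)", OF assms(1)])
    show "computable D as (\<lambda>x. slist (map d []))" by (rule computable_const)
    have "computable ?E ((\<lambda>y. e (fst (snd y))) # map (\<lambda>a y. a (fst y)) as)
      (\<lambda>y. slist (map d (h (fst y) (fst (snd y)))))"
      by (rule computable_reindex[OF step]) auto
    then show "computable ?E
      ((\<lambda>y. e (fst (snd y))) # (\<lambda>y. slist (map d (snd (snd y)))) # map (\<lambda>a y. a (fst y)) as)
      (\<lambda>y. slist (map d (h (fst y) (fst (snd y)) @ snd (snd y))))"
      by (intro computable_append) (rule computable_weaken, assumption, auto intro: computable_var)
  qed
  moreover have "foldr (\<lambda>a r. h x a @ r) as [] = concat (map (h x) as)" for x as
    by (induction as) auto
  ultimately show ?thesis by simp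
qed

lemma computable_map:
  assumes "computable D as (\<lambda>x. slist (map e (l x)))"
    and step: "computable {y. fst y \<in> D \<and> snd y \<in> set (l (fst y))}
      ((\<lambda>y. e (snd y)) # map (\<lambda>a y. a (fst y)) as)
      (\<lambda>y. d (h (fst y) (snd y)))"
  shows "computable D as (\<lambda>x. slist (map d (map (h x) (l x))))"
proof -
  have "computable D as (\<lambda>x. slist (map d (concat (map (\<lambda>a. [h x a]) (l x)))))"
    by (rule computable_concat_map[OF assms(1)])
      (use step in \<open>simp add: computable_SCons computable_const\<close>)
  then show ?thesis by simp
qed

lemma computable_filter:
  assumes "computable D as (\<lambda>x. slist (map e (l x)))"
    and step: "computable {y. fst y \<in> D \<and> snd y \<in> set (l (fst y))}
      ((\<lambda>y. e (snd y)) # map (\<lambda>a y. a (fst y)) as)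
      (\<lambda>y. sbool (P (fst y) (snd y)))"
  shows "computable D as (\<lambda>x. slist (map e (filter (P x) (l x))))"
proof -
  have *: "slist (map e (if p then [a] else [])) = (if p then SCons (e a) SNil else SNil)" for p a
    by simp
  have "computable D as (\<lambda>x. slist (map e (concat (map (\<lambda>a. if P x a then [a] else []) (l x)))))"
    by (rule computable_concat_map[OF assms(1)], unfold *)
      (intro computable_if step computable_SCons computable_const computable_var; simp)
  moreover have "concat (map (\<lambda>a. if P x a then [a] else []) as) = filter (P x) as" for x as
    by (induction as) auto
  ultimately show ?thesis by simp
qed

text \<open>Filtering for counterexamples must leave the empty list.\<close>

lemma computable_Ball:
  assumes "computable D as (\<lambda>x. slist (map e (l x)))"
    and step: "computable {y. fst y \<in> D \<and> snd y \<in> set (l (fst y))}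
      ((\<lambda>y. e (snd y)) # map (\<lambda>a y. a (fst y)) as)
      (\<lambda>y. sbool (P (fst y) (snd y)))"
  shows "computable D as (\<lambda>x. sbool (\<forall>a\<in>set (l x). P x a))"
proof -
  have "computable D as (\<lambda>x. sbool (slist (map e (filter (\<lambda>a. \<not> P x a) (l x))) = SNil))"
    by (intro computable_eq computable_const computable_filter computable_sbool_not assms)
  moreover have "slist ds = SNil \<longleftrightarrow> ds = []" for ds :: "'b sexp list" by (cases ds) auto
  ultimately show ?thesis by (simp add: filter_empty_conv)
qed

section \<open>Coincidence\<close>

lemma upd_notin: "length as = length ys \<Longrightarrow> v \<notin> set ys \<Longrightarrow> upd \<beta> ys as v = \<beta> v"
  by (auto simp: upd_def split: option.splits dest: map_of_SomeD set_zip_leftD)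

lemma upd_in: "length as = length ys \<Longrightarrow> v \<in> set ys \<Longrightarrow> upd \<beta> ys as v \<in> set as"
  using map_of_zip_is_None[of ys as v]
  by (auto simp: upd_def split: option.splits dest!: map_of_SomeD set_zip_rightD)

lemma upd_in_eq: "length as = length ys \<Longrightarrow> v \<in> set ys \<Longrightarrow> upd \<beta> ys as v = upd \<gamma> ys as v"
  using map_of_zip_is_None[of ys as v] by (auto simp: upd_def split: option.splits)

lemma finite_tuples: "finite A \<Longrightarrow> finite (tuples A k)"
  using finite_lists_length_eq[of A k] by (simp add: tuples_def conj_commute)

text \<open>For \<open>SumEq\<close>, a tuple of the right length overwrites the variables in
  \<open>ys\<close> in the same way whatever the assignment was before.\<close>

lemma sat_coincidence:
  "wa_fm V \<sigma> \<phi> \<Longrightarrow> no_agg \<phi> \<Longrightarrow> (\<And>v. v \<in> free \<phi> \<Longrightarrow> \<beta> v = \<gamma> v) \<Longrightarrow>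
     sat V A \<phi> \<beta> = sat V A \<phi> \<gamma>"
  "wa_tm V \<sigma> t \<Longrightarrow> no_agg_tm t \<Longrightarrow> (\<And>v. v \<in> free_tm t \<Longrightarrow> \<beta> v = \<gamma> v) \<Longrightarrow>
     val V A t \<beta> = val V A t \<gamma>"
proof (induction \<phi> and t arbitrary: \<beta> \<gamma> and \<beta> \<gamma>)
  case (Rel R xs)
  then have "map \<beta> xs = map \<gamma> xs" by simp
  then show ?case by (simp del: map_eq_conv)
next
  case (WtEq s w xs)
  then have "map \<beta> xs = map \<gamma> xs" by simp
  then show ?case by (simp del: map_eq_conv)
next
  case (Wt w xs)
  then have "map \<beta> xs = map \<gamma> xs" by simp
  then show ?case by (simp del: map_eq_conv)
next
  case (Neg \<phi>)
  have "sat V A \<phi> \<beta> = sat V A \<phi> \<gamma>" by (rule Neg.IH) (use Neg.prems in auto)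
  then show ?case by simp
next
  case (Or \<phi> \<psi>)
  have "sat V A \<phi> \<beta> = sat V A \<phi> \<gamma>" by (rule Or.IH(1)) (use Or.prems in auto)
  moreover have "sat V A \<psi> \<beta> = sat V A \<psi> \<gamma>" by (rule Or.IH(2)) (use Or.prems in auto)
  ultimately show ?case by simp
next
  case (Ex y \<phi>)
  have "sat V A \<phi> (\<beta>(y := a)) = sat V A \<phi> (\<gamma>(y := a))" for a
    using Ex.prems by (intro Ex.IH) auto
  then show ?case by simp
next
  case (SumEq s w ys \<phi>)
  have "sat V A \<phi> (upd \<beta> ys as) = sat V A \<phi> (upd \<gamma> ys as)" if "length as = length ys" for as
  proof (rule SumEq.IH)
    show "upd \<beta> ys as v = upd \<gamma> ys as v" if "v \<in> free \<phi>" for v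
      using SumEq.prems(3)[of v] that upd_notin[OF \<open>length as = length ys\<close>]
        upd_in_eq[OF \<open>length as = length ys\<close>] by (cases "v \<in> set ys") auto
  qed (use SumEq.prems in auto)
  then have "{as \<in> tuples (univ A) (wt_ar V w). sat V A \<phi> (upd \<beta> ys as)} =
      {as \<in> tuples (univ A) (wt_ar V w). sat V A \<phi> (upd \<gamma> ys as)}"
    using SumEq.prems(1) by (auto simp: tuples_def)
  then show ?case by simp
next
  case (Pred P ts)
  have "map (\<lambda>t. val V A t \<beta>) ts = map (\<lambda>t. val V A t \<gamma>) ts"
  proof (rule map_cong)
    show "val V A t \<beta> = val V A t \<gamma>" if "t \<in> set ts" for t
      by (rule Pred.IH[OF that]) (use Pred.prems that in auto)
  qed simp
  then show ?case by (simp del: map_eq_conv)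
next
  case (Plus t u)
  have "val V A t \<beta> = val V A t \<gamma>" by (rule Plus.IH(1)) (use Plus.prems in auto)
  moreover have "val V A u \<beta> = val V A u \<gamma>" by (rule Plus.IH(2)) (use Plus.prems in auto)
  ultimately show ?case by simp
next
  case (Minus t u)
  have "val V A t \<beta> = val V A t \<gamma>" by (rule Minus.IH(1)) (use Minus.prems in auto)
  moreover have "val V A u \<beta> = val V A u \<gamma>" by (rule Minus.IH(2)) (use Minus.prems in auto)
  ultimately show ?case by simp
next
  case (Times t u)
  have "val V A t \<beta> = val V A t \<gamma>" by (rule Times.IH(1)) (use Times.prems in auto)
  moreover have "val V A u \<beta> = val V A u \<gamma>" by (rule Times.IH(2)) (use Times.prems in auto)
  ultimately show ?case by simp
qed simp_all

lemma finite_free: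
  fixes \<phi> :: "('r, 'w, 'p, 's, 'e) fm" and t :: "('r, 'w, 'p, 's, 'e) tm"
  shows "finite (free \<phi>)" "finite (free_tm t)"
  by (induction \<phi> and t) auto

text \<open>Relation symbols can enter a term only through a formula under an aggregation.\<close>

lemma wa_tm_signature: "no_agg_tm t \<Longrightarrow> wa_tm V \<sigma> t \<Longrightarrow> wa_tm V \<tau> t" for t :: "('r, 'w, 'p, 's, 'e) tm"
proof -
  \<comment> \<open>The trivial statement about formulas is there because formulas and terms share
    one induction rule.\<close>
  have "\<phi> = \<phi>" and "no_agg_tm t \<Longrightarrow> wa_tm V \<sigma> t \<Longrightarrow> wa_tm V \<tau> t"
    for \<phi> :: "('r, 'w, 'p, 's, 'e) fm" and t :: "('r, 'w, 'p, 's, 'e) tm"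
    by (induction \<phi> and t) auto
  then show "no_agg_tm t \<Longrightarrow> wa_tm V \<sigma> t \<Longrightarrow> wa_tm V \<tau> t" by blast
qed

lemma qr_tm_no_agg: "no_agg_tm t \<Longrightarrow> qr_tm t = 0" for t :: "('r, 'w, 'p, 's, 'e) tm"
proof -
  have "\<phi> = \<phi>" and "no_agg_tm t \<Longrightarrow> qr_tm t = 0" for \<phi> :: "('r, 'w, 'p, 's, 'e) fm" and t :: "('r, 'w, 'p, 's, 'e) tm"
    by (induction \<phi> and t) auto
  then show "no_agg_tm t \<Longrightarrow> qr_tm t = 0" by blast
qed

lemma preds_in_tm_no_agg: "no_agg_tm t \<Longrightarrow> preds_in_tm t = {}" for t :: "('r, 'w, 'p, 's, 'e) tm"
proof -
  have "\<phi> = \<phi>" and "no_agg_tm t \<Longrightarrow> preds_in_tm t = {}" for \<phi> :: "('r, 'w, 'p, 's, 'e) fm" and t :: "('r, 'w, 'p, 's, 'e) tm"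
    by (induction \<phi> and t) auto
  then show "no_agg_tm t \<Longrightarrow> preds_in_tm t = {}" by blast
qed

section \<open>Disjunctions of rows\<close>

type_synonym ('r, 'w, 'p, 's, 'e) row =
  "('r, 'w, 'p, 's, 'e) fm option \<times> ('r, 'w, 'p, 's, 'e) fm option"

text \<open>As there need not be a closed formula of rank 0, truth is represented by \<open>None\<close>.\<close>

fun sat_opt where
  "sat_opt V A None \<beta> \<longleftrightarrow> True"
| "sat_opt V A (Some \<phi>) \<beta> \<longleftrightarrow> sat V A \<phi> \<beta>"

definition sat_rows where
  "sat_rows V A B rs \<beta> \<longleftrightarrow> (\<exists>r\<in>set rs. sat_opt V A (fst r) \<beta> \<and> sat_opt V B (snd r) \<beta>)"

fun conj_opt where
  "conj_opt None b = b"
| "conj_opt (Some \<phi>) None = Some \<phi>"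
| "conj_opt (Some \<phi>) (Some \<psi>) = Some (Neg (Or (Neg \<phi>) (Neg \<psi>)))"

text \<open>The result is a disjunction: the negation of truth is the empty one.\<close>

fun neg_opt where
  "neg_opt None = []"
| "neg_opt (Some \<phi>) = [Some (Neg \<phi>)]"

definition conj_rows :: "('r, 'w, 'p, 's, 'e) row list \<Rightarrow> ('r, 'w, 'p, 's, 'e) row list \<Rightarrow>
    ('r, 'w, 'p, 's, 'e) row list" where
  "conj_rows rs qs = concat (map (\<lambda>r. map (\<lambda>q. (conj_opt (fst r) (fst q), conj_opt (snd r) (snd q))) qs) rs)"

text \<open>By De Morgan each row becomes a disjunction of at most two rows, and the conjunction of
  these is multiplied out. The start value is the always true row, the negation of the empty
  disjunction.\<close>

definition neg_rows :: "('r, 'w, 'p, 's, 'e) row list \<Rightarrow> ('r, 'w, 'p, 's, 'e) row list" where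
  "neg_rows rs = foldr (\<lambda>r. conj_rows (map (\<lambda>a. (a, None)) (neg_opt (fst r)) @
      map (\<lambda>a. (None, a)) (neg_opt (snd r)))) rs [(None, None)]"

definition swap_rows :: "('r, 'w, 'p, 's, 'e) row list \<Rightarrow> ('r, 'w, 'p, 's, 'e) row list" where
  "swap_rows rs = map (\<lambda>r. (snd r, fst r)) rs"

text \<open>For a witness on the other side, rows are swapped before and after. A missing component
  stays missing, as universes are non-empty.\<close>

definition ex_rows :: "nat \<Rightarrow> ('r, 'w, 'p, 's, 'e) row list \<Rightarrow> ('r, 'w, 'p, 's, 'e) row list" where
  "ex_rows y rs = map (\<lambda>r. (map_option (Ex y) (fst r), snd r)) rs"

text \<open>Truth has to be spelled out inside \<open>Neg\<close> and \<open>SumEq\<close>. For a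
  variable \<open>y\<close> that the sum binds, \<open>EqV y y\<close> adds no free variable to the
  result.\<close>

fun plain :: "nat \<Rightarrow> ('r, 'w, 'p, 's, 'e) fm option \<Rightarrow> ('r, 'w, 'p, 's, 'e) fm" where
  "plain y None = EqV y y"
| "plain y (Some \<phi>) = \<phi>"

text \<open>For each set of rows whose first components are exactly those that hold, \<open>choices\<close> has one
  pair: the first component expresses this, the second one is the conjunction of the negated second
  components of these rows.\<close>

definition choices :: "nat \<Rightarrow> ('r, 'w, 'p, 's, 'e) row list \<Rightarrow> ('r, 'w, 'p, 's, 'e) row list" where
  "choices y rs = foldr (\<lambda>r. conj_rows ((fst r, Some (Neg (plain y (snd r)))) #
      map (\<lambda>a. (a, None)) (neg_opt (fst r)))) rs [(None, None)]"

text \<open>The sum is taken on the second side and guarded on the first. A pair of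
  \<open>choices\<close> holds the negation of the wanted body, hence the \<open>Neg\<close>. If no
  row has a true first component, the body is unsatisfiable and the sum is empty.\<close>

definition sum_rows :: "'e \<Rightarrow> 'w \<Rightarrow> nat list \<Rightarrow> ('r, 'w, 'p, 's, 'e) row list \<Rightarrow>
    ('r, 'w, 'p, 's, 'e) row list" where
  "sum_rows s w ys rs = map (\<lambda>r. (fst r, Some (SumEq s w ys (Neg (plain (hd ys) (snd r))))))
      (choices (hd ys) rs)"

lemma sat_conj_opt [simp]:
  "sat_opt V A (conj_opt a b) \<beta> \<longleftrightarrow> sat_opt V A a \<beta> \<and> sat_opt V A b \<beta>"
  by (cases a; cases b) auto

lemma sat_neg_opt [simp]:
  "(\<exists>b\<in>set (neg_opt a). sat_opt V A b \<beta>) \<longleftrightarrow> \<not> sat_opt V A a \<beta>"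
  by (cases a) auto

lemma sat_plain [simp]: "sat V A (plain y a) \<beta> \<longleftrightarrow> sat_opt V A a \<beta>"
  by (cases a) auto

lemma set_conj_rows:
  "set (conj_rows rs qs) =
     {(conj_opt (fst r) (fst q), conj_opt (snd r) (snd q)) | r q. r \<in> set rs \<and> q \<in> set qs}"
proof -
  have "set (concat (map (\<lambda>r. map (g r) qs) rs)) = {g r q | r q. r \<in> set rs \<and> q \<in> set qs}" for g
    by auto
  then show ?thesis unfolding conj_rows_def .
qed

lemma sat_rows_append [simp]:
  "sat_rows V A B (rs @ qs) \<beta> \<longleftrightarrow> sat_rows V A B rs \<beta> \<or> sat_rows V A B qs \<beta>"
  by (auto simp: sat_rows_def)

lemma sat_conj_rows [simp]:
  "sat_rows V A B (conj_rows rs qs) \<beta> \<longleftrightarrow> sat_rows V A B rs \<beta> \<and> sat_rows V A B qs \<beta>"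
  unfolding sat_rows_def set_conj_rows by force

lemma sat_swap_rows [simp]: "sat_rows V A B (swap_rows rs) \<beta> \<longleftrightarrow> sat_rows V B A rs \<beta>"
  by (auto simp: sat_rows_def swap_rows_def)

lemma sat_neg_rows [simp]: "sat_rows V A B (neg_rows rs) \<beta> \<longleftrightarrow> \<not> sat_rows V A B rs \<beta>"
proof (induction rs)
  case Nil
  then show ?case by (simp add: neg_rows_def sat_rows_def)
next
  case (Cons r rs)
  have "sat_rows V A B (map (\<lambda>a. (a, None)) (neg_opt (fst r)) @
      map (\<lambda>a. (None, a)) (neg_opt (snd r))) \<beta> \<longleftrightarrow>
      \<not> (sat_opt V A (fst r) \<beta> \<and> sat_opt V B (snd r) \<beta>)"
    using sat_neg_opt[of "fst r" V A \<beta>] sat_neg_opt[of "snd r" V B \<beta>]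
    unfolding sat_rows_append by (auto simp: sat_rows_def)
  with Cons show ?case by (auto simp: neg_rows_def sat_rows_def[of _ _ _ "_ # _"]
    sat_rows_def[of _ _ _ rs])
qed

text \<open>The quantifier commutes with the disjunction over the rows and skips the second
  components, in which \<open>y\<close> is not free.\<close>

lemma sat_ex_rows:
  assumes "univ A \<noteq> {}"
    and "\<And>r b. r \<in> set rs \<Longrightarrow> snd r = Some b \<Longrightarrow> wa_fm V \<sigma> b \<and> no_agg b \<and> y \<notin> free b"
  shows "sat_rows V A B (ex_rows y rs) \<beta> \<longleftrightarrow> (\<exists>a\<in>univ A. sat_rows V A B rs (\<beta>(y := a)))"
proof -
  have "sat_opt V B (snd r) (\<beta>(y := a)) = sat_opt V B (snd r) \<beta>" if "r \<in> set rs" for r a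
  proof (cases "snd r")
    case (Some b)
    have "sat V B b (\<beta>(y := a)) = sat V B b \<beta>"
      by (rule sat_coincidence(1)[of V \<sigma>]) (use assms(2)[OF that Some] in auto)
    then show ?thesis by (simp add: Some)
  qed simp
  moreover have "sat_opt V A (map_option (Ex y) c) \<beta> \<longleftrightarrow> (\<exists>a\<in>univ A. sat_opt V A c (\<beta>(y := a)))" for c
    using assms(1) by (cases c) auto
  ultimately show ?thesis
    by (simp add: sat_rows_def ex_rows_def cong: bex_cong) blast
qed

text \<open>The first components cover all possible truth patterns of those in \<open>rs\<close>, so
  one of them holds. In such a pair, precisely the rows that are active under \<beta> contributed
  their negated second component. A separate \<gamma> is needed as it will range over the tuples
  being summed.\<close>

lemma choices_spec:
  "\<exists>q\<in>set (choices y rs). sat_opt V A (fst q) \<beta>"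
  "q \<in> set (choices y rs) \<Longrightarrow> sat_opt V A (fst q) \<beta> \<Longrightarrow>
     sat_opt V B (snd q) \<gamma> \<longleftrightarrow> \<not> (\<exists>r\<in>set rs. sat_opt V A (fst r) \<beta> \<and> sat_opt V B (snd r) \<gamma>)"
proof (induction rs arbitrary: q)
  case Nil
  {
    case 1
    then show ?case by (simp add: choices_def)
  next
    case 2
    then show ?case by (simp add: choices_def)
  }
next
  case (Cons r rs)
  let ?hd = "(fst r, Some (Neg (plain y (snd r)))) # map (\<lambda>a. (a, None)) (neg_opt (fst r))"
  have eq: "choices y (r # rs) = conj_rows ?hd (choices y rs)" by (simp add: choices_def)
  {
    case 1
    obtain q where q: "q \<in> set (choices y rs)" "sat_opt V A (fst q) \<beta>" using Cons.IH(1) by blast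
    have "\<exists>p\<in>set ?hd. sat_opt V A (fst p) \<beta>"
      using sat_neg_opt[of "fst r" V A \<beta>] by auto
    then obtain p where "p \<in> set ?hd" "sat_opt V A (fst p) \<beta>" by blast
    with q show ?case unfolding eq set_conj_rows
      by (intro bexI[of _ "(conj_opt (fst p) (fst q), conj_opt (snd p) (snd q))"]) (simp, blast)
  next
    case 2
    then obtain p q' where p: "p \<in> set ?hd" "q' \<in> set (choices y rs)"
      "q = (conj_opt (fst p) (fst q'), conj_opt (snd p) (snd q'))"
      unfolding eq set_conj_rows by blast
    have "sat_opt V A (fst p) \<beta>" "sat_opt V A (fst q') \<beta>" using 2(2) p(3) by auto
    moreover have "sat_opt V B (snd p) \<gamma> \<longleftrightarrow> \<not> (sat_opt V A (fst r) \<beta> \<and> sat_opt V B (snd r) \<gamma>)"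
      using p(1) \<open>sat_opt V A (fst p) \<beta>\<close> by (cases "fst r") auto
    ultimately show ?case using Cons.IH(2)[OF p(2)] by (simp add: p(3))
  }
qed

text \<open>First components do not mention \<open>ys\<close>, so the active rows are the same for
  every tuple \<open>bs\<close>. All pairs of \<open>choices\<close> with a true first component
  therefore select the same set of tuples, and at least one such pair exists.\<close>

lemma sat_sum_rows:
  assumes "\<And>r a. r \<in> set rs \<Longrightarrow> fst r = Some a \<Longrightarrow> wa_fm V \<sigma> a \<and> no_agg a \<and> free a \<inter> set ys = {}"
    and "length ys = wt_ar V w"
  shows "sat_rows V A B (sum_rows s w ys rs) \<beta> \<longleftrightarrow>
    s = finsum (alg V (wt_type V w)) (wt B w)
      {bs \<in> tuples (univ B) (wt_ar V w). sat_rows V A B rs (upd \<beta> ys bs)}"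
proof -
  have fst_upd: "sat_opt V A (fst r) (upd \<beta> ys bs) = sat_opt V A (fst r) \<beta>"
    if "r \<in> set rs" "length bs = length ys" for r bs
  proof (cases "fst r")
    case (Some a)
    have "sat V A a (upd \<beta> ys bs) = sat V A a \<beta>"
    proof (rule sat_coincidence(1)[of V \<sigma>])
      show "upd \<beta> ys bs v = \<beta> v" if "v \<in> free a" for v
        using assms(1)[OF \<open>r \<in> set rs\<close> Some] that by (intro upd_notin[OF \<open>length bs = length ys\<close>]) auto
    qed (use assms(1)[OF that(1) Some] in auto)
    then show ?thesis by (simp add: Some)
  qed simp
  let ?S = "{bs \<in> tuples (univ B) (wt_ar V w). sat_rows V A B rs (upd \<beta> ys bs)}"
  have "{bs \<in> tuples (univ B) (wt_ar V w). \<not> sat_opt V B (snd q) (upd \<beta> ys bs)} = ?S"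
    if q: "q \<in> set (choices (hd ys) rs)" "sat_opt V A (fst q) \<beta>" for q
  proof (intro Collect_cong conj_cong refl)
    fix bs assume "bs \<in> tuples (univ B) (wt_ar V w)"
    then have "length bs = length ys" using assms(2) by (simp add: tuples_def)
    then show "(\<not> sat_opt V B (snd q) (upd \<beta> ys bs)) = sat_rows V A B rs (upd \<beta> ys bs)"
      using choices_spec(2)[OF q, of B "upd \<beta> ys bs"]
      by (simp add: sat_rows_def fst_upd cong: bex_cong)
  qed
  moreover have "sat_rows V A B (sum_rows s w ys rs) \<beta> \<longleftrightarrow>
    (\<exists>q\<in>set (choices (hd ys) rs). sat_opt V A (fst q) \<beta> \<and>
      s = finsum (alg V (wt_type V w)) (wt B w)
        {bs \<in> tuples (univ B) (wt_ar V w). \<not> sat_opt V B (snd q) (upd \<beta> ys bs)})"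
    by (simp add: sat_rows_def sum_rows_def)
  ultimately have "sat_rows V A B (sum_rows s w ys rs) \<beta> \<longleftrightarrow>
    (\<exists>q\<in>set (choices (hd ys) rs). sat_opt V A (fst q) \<beta> \<and>
      s = finsum (alg V (wt_type V w)) (wt B w) ?S)"
    by (metis (no_types, lifting))
  then show ?thesis using choices_spec(1)[of "hd ys" rs V A \<beta>] by blast
qed

section \<open>Closure of formula classes under the operations on rows\<close>

definition bool_closed :: "('r, 'w, 'p, 's, 'e) fm set \<Rightarrow> bool" where
  "bool_closed K \<longleftrightarrow> (\<forall>a\<in>K. Neg a \<in> K) \<and> (\<forall>a\<in>K. \<forall>b\<in>K. Or a b \<in> K)"

definition rows_in where
  "rows_in K M rs \<longleftrightarrow> (\<forall>r\<in>set rs. set_option (fst r) \<subseteq> K \<and> set_option (snd r) \<subseteq> M)"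

lemma rows_in_append [simp]: "rows_in K M (rs @ qs) \<longleftrightarrow> rows_in K M rs \<and> rows_in K M qs"
  by (auto simp: rows_in_def)

lemma rows_in_swap [simp]: "rows_in K M (swap_rows rs) \<longleftrightarrow> rows_in M K rs"
  by (auto simp: rows_in_def swap_rows_def)

lemma rows_in_mono: "rows_in K M rs \<Longrightarrow> K \<subseteq> K' \<Longrightarrow> M \<subseteq> M' \<Longrightarrow> rows_in K' M' rs"
  unfolding rows_in_def by blast

lemma conj_opt_in:
  "bool_closed K \<Longrightarrow> set_option a \<subseteq> K \<Longrightarrow> set_option b \<subseteq> K \<Longrightarrow> set_option (conj_opt a b) \<subseteq> K"
  by (cases a; cases b) (auto simp: bool_closed_def)

lemma rows_in_conj:
  assumes "bool_closed K" "bool_closed M" "rows_in K M rs" "rows_in K M qs"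
  shows "rows_in K M (conj_rows rs qs)"
proof -
  have "set_option (fst p) \<subseteq> K \<and> set_option (snd p) \<subseteq> M" if p: "p \<in> set (conj_rows rs qs)" for p
  proof -
    obtain r q where "r \<in> set rs" "q \<in> set qs"
      "p = (conj_opt (fst r) (fst q), conj_opt (snd r) (snd q))"
      using p unfolding set_conj_rows by blast
    then show ?thesis using assms(3,4) conj_opt_in[OF assms(1)] conj_opt_in[OF assms(2)]
      by (simp add: rows_in_def)
  qed
  then show ?thesis unfolding rows_in_def by blast
qed

lemma rows_in_neg:
  assumes "bool_closed K" "bool_closed M" "rows_in K M rs"
  shows "rows_in K M (neg_rows rs)"
  using assms(3)
proof (induction rs)
  case Nil
  then show ?case by (simp add: neg_rows_def rows_in_def)
next
  case (Cons r rs)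
  have "b \<in> K" if "Some b \<in> set (neg_opt (fst r))" for b
    using Cons.prems that assms(1) by (cases "fst r") (auto simp: rows_in_def bool_closed_def)
  moreover have "b \<in> M" if "Some b \<in> set (neg_opt (snd r))" for b
    using Cons.prems that assms(2) by (cases "snd r") (auto simp: rows_in_def bool_closed_def)
  ultimately have "rows_in K M (map (\<lambda>a. (a, None)) (neg_opt (fst r)) @
      map (\<lambda>a. (None, a)) (neg_opt (snd r)))"
    by (auto simp: rows_in_def)
  moreover have "rows_in K M (neg_rows rs)"
    by (rule Cons.IH) (use Cons.prems in \<open>simp add: rows_in_def\<close>)
  ultimately have "rows_in K M (conj_rows (map (\<lambda>a. (a, None)) (neg_opt (fst r)) @
      map (\<lambda>a. (None, a)) (neg_opt (snd r))) (neg_rows rs))"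
    by (rule rows_in_conj[OF assms(1,2)])
  then show ?case unfolding neg_rows_def foldr.simps comp_apply .
qed

lemma rows_in_choices:
  assumes "bool_closed K" "bool_closed M" "EqV y y \<in> M" "rows_in K M rs"
  shows "rows_in K M (choices y rs)"
  using assms(4)
proof (induction rs)
  case Nil
  then show ?case by (simp add: choices_def rows_in_def)
next
  case (Cons r rs)
  have "b \<in> K" if "Some b \<in> set (neg_opt (fst r))" for b
    using Cons.prems that assms(1) by (cases "fst r") (auto simp: rows_in_def bool_closed_def)
  moreover have "plain y (snd r) \<in> M"
    using Cons.prems assms(3) by (cases "snd r") (auto simp: rows_in_def)
  ultimately have "rows_in K M ((fst r, Some (Neg (plain y (snd r)))) #
      map (\<lambda>a. (a, None)) (neg_opt (fst r)))"
    using Cons.prems assms(2) by (auto simp: rows_in_def bool_closed_def)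
  moreover have "rows_in K M (choices y rs)"
    by (rule Cons.IH) (use Cons.prems in \<open>simp add: rows_in_def\<close>)
  ultimately have "rows_in K M (conj_rows ((fst r, Some (Neg (plain y (snd r)))) #
      map (\<lambda>a. (a, None)) (neg_opt (fst r))) (choices y rs))"
    by (rule rows_in_conj[OF assms(1,2)])
  then show ?case unfolding choices_def foldr.simps comp_apply .
qed

lemma rows_in_sum:
  assumes "bool_closed K" "bool_closed M" "EqV (hd ys) (hd ys) \<in> M" "rows_in K M rs"
    and "\<And>a. a \<in> M \<Longrightarrow> SumEq s w ys a \<in> M'"
  shows "rows_in K M' (sum_rows s w ys rs)"
proof -
  have "Neg (plain (hd ys) a) \<in> M" if "set_option a \<subseteq> M" for a
    using assms(2,3) that by (cases a) (auto simp: bool_closed_def)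
  then show ?thesis
    using rows_in_choices[OF assms(1-4)] assms(5) by (auto simp: rows_in_def sum_rows_def)
qed

section \<open>The decomposition\<close>

definition sided :: "('r, 'w, 'p, 's, 'e) fm \<Rightarrow> bool \<Rightarrow> bool \<Rightarrow> ('r, 'w, 'p, 's, 'e) row list" where
  "sided \<phi> l r = (if l then [(Some \<phi>, None)] else []) @ (if r then [(None, Some \<phi>)] else [])"

text \<open>Any enumeration will do, since the program only looks it up. It is needed for weights of
  finite type alone: \<open>FOW1\<close> bars the others from \<open>SumEq\<close>.\<close>

definition addends :: "('r, 'w, 'p, 's, 'e) wa_setting \<Rightarrow> 'w \<Rightarrow> 'e \<Rightarrow> ('e \<times> 'e) list" where
  "addends V w s = (SOME ps. set ps =
     {p \<in> carrier (alg V (wt_type V w)) \<times> carrier (alg V (wt_type V w)).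
        fst p \<oplus>\<^bsub>alg V (wt_type V w)\<^esub> snd p = s})"

lemma set_addends:
  assumes "finite (carrier (alg V (wt_type V w)))"
  shows "set (addends V w s) =
     {p \<in> carrier (alg V (wt_type V w)) \<times> carrier (alg V (wt_type V w)).
        fst p \<oplus>\<^bsub>alg V (wt_type V w)\<^esub> snd p = s}"
  unfolding addends_def by (rule someI_ex, rule finite_list) (simp add: assms)

text \<open>The first factor is the sum over left tuples. Its guards come from the right summand, so
  rows are swapped on the way in and out.\<close>

definition split_sum :: "('e \<times> 'e) list \<Rightarrow> 'w \<Rightarrow> nat list \<Rightarrow> ('r, 'w, 'p, 's, 'e) row list \<Rightarrow>
    ('r, 'w, 'p, 's, 'e) row list \<Rightarrow> ('r, 'w, 'p, 's, 'e) row list" where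
  "split_sum ps w ys rs qs = concat (map (\<lambda>p. conj_rows
       (swap_rows (sum_rows (fst p) w ys (swap_rows rs))) (sum_rows (snd p) w ys qs)) ps)"

text \<open>The variables in \<open>L\<close> refer to the left summand, all others to the right one.\<close>

fun dec :: "('r, 'w, 'p, 's, 'e) wa_setting \<Rightarrow> 'r \<Rightarrow> 'r \<Rightarrow> ('r, 'w, 'p, 's, 'e) fm \<Rightarrow> nat list \<Rightarrow>
    ('r, 'w, 'p, 's, 'e) row list" where
  "dec V X Y (EqV x y) L =
     sided (EqV x y) (\<forall>v\<in>set [x, y]. v \<in> set L) (\<forall>v\<in>set [x, y]. v \<notin> set L)"
| "dec V X Y (Rel R xs) L =
     (if R = X then if \<forall>v\<in>set xs. v \<in> set L then [(None, None)] else []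
      else if R = Y then if \<forall>v\<in>set xs. v \<notin> set L then [(None, None)] else []
      else sided (Rel R xs) (\<forall>v\<in>set xs. v \<in> set L) (\<forall>v\<in>set xs. v \<notin> set L))"
| "dec V X Y (WtEq s w xs) L =
     (if \<forall>v\<in>set xs. v \<in> set L then [(Some (WtEq s w xs), None)]
      else if \<forall>v\<in>set xs. v \<notin> set L then [(None, Some (WtEq s w xs))]
      else if s = \<zero>\<^bsub>alg V (wt_type V w)\<^esub> then [(None, None)] else [])"
| "dec V X Y (Neg \<phi>) L = neg_rows (dec V X Y \<phi> L)"
| "dec V X Y (Or \<phi> \<psi>) L = dec V X Y \<phi> L @ dec V X Y \<psi> L"
| "dec V X Y (Ex y \<phi>) L =
     ex_rows y (dec V X Y \<phi> (y # L)) @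
     swap_rows (ex_rows y (swap_rows (dec V X Y \<phi> (filter (\<lambda>v. v \<notin> set [y]) L))))"
| "dec V X Y (SumEq s w ys \<phi>) L =
     split_sum (addends V w s) w ys (dec V X Y \<phi> (ys @ L))
       (dec V X Y \<phi> (filter (\<lambda>v. v \<notin> set ys) L))"
| "dec V X Y (Pred P ts) L =
     sided (Pred P ts) (\<forall>t\<in>set ts. free_tm t \<subseteq> set L) (\<not> (\<forall>t\<in>set ts. free_tm t \<subseteq> set L))"

definition side_class ::
  "('r, 'w, 'p, 's, 'e) wa_setting \<Rightarrow> 'r set \<Rightarrow> ('r, 'w, 'p, 's, 'e) fm \<Rightarrow> nat set \<Rightarrow>
   ('r, 'w, 'p, 's, 'e) fm set" where
  "side_class V \<sigma> \<phi> U = {\<alpha> \<in> fv_class V \<sigma> \<phi>. free \<alpha> \<subseteq> U}"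

lemma bool_closed_side_class: "bool_closed (side_class V \<sigma> \<phi> U)"
  by (auto simp: bool_closed_def side_class_def fv_class_def FOW1_def WA1_def algs_in_def)

lemma EqV_side_class: "y \<in> U \<Longrightarrow> EqV y y \<in> side_class V \<sigma> \<phi> U"
  by (auto simp: side_class_def fv_class_def FOW1_def WA1_def algs_in_def)

lemma side_class_sub:
  "U \<subseteq> U' \<Longrightarrow> side_class V \<sigma> \<phi> U \<subseteq> side_class V \<sigma> (Neg \<phi>) U'"
  "U \<subseteq> U' \<Longrightarrow> side_class V \<sigma> \<phi> U \<subseteq> side_class V \<sigma> (Or \<phi> \<psi>) U'"
  "U \<subseteq> U' \<Longrightarrow> side_class V \<sigma> \<psi> U \<subseteq> side_class V \<sigma> (Or \<phi> \<psi>) U'"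
  "U \<subseteq> U' \<Longrightarrow> side_class V \<sigma> \<phi> U \<subseteq> side_class V \<sigma> (Ex y \<phi>) U'"
  "U \<subseteq> U' \<Longrightarrow> side_class V \<sigma> \<phi> U \<subseteq> side_class V \<sigma> (SumEq s w ys \<phi>) U'"
  by (auto simp: side_class_def fv_class_def algs_in_def image_Un)

lemma Ex_side_class:
  "\<alpha> \<in> side_class V \<sigma> \<phi> U \<Longrightarrow> U - {y} \<subseteq> U' \<Longrightarrow> Ex y \<alpha> \<in> side_class V \<sigma> (Ex y \<phi>) U'"
  by (auto simp: side_class_def fv_class_def FOW1_def WA1_def algs_in_def)

lemma SumEq_side_class:
  assumes "\<alpha> \<in> side_class V \<sigma> \<phi> U" "U - set ys \<subseteq> U'" "w \<in> weights V" "length ys = wt_ar V w"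
    "distinct ys" "finite (carrier (alg V (wt_type V w)))" "s' \<in> carrier (alg V (wt_type V w))"
  shows "SumEq s' w ys \<alpha> \<in> side_class V \<sigma> (SumEq s w ys \<phi>) U'"
  using assms by (auto simp: side_class_def fv_class_def FOW1_def WA1_def algs_in_def)

lemma side_class_self:
  "\<phi> \<in> FOW1 V \<sigma> \<Longrightarrow> free \<phi> \<subseteq> U \<Longrightarrow> \<phi> \<in> side_class V \<sigma> \<phi> U"
  by (auto simp: side_class_def fv_class_def)

lemma rows_in_ex:
  assumes "rows_in (side_class V \<sigma> \<phi> U) (side_class V \<sigma> \<phi> W) rs" "U - {y} \<subseteq> U'" "W \<subseteq> W'"
  shows "rows_in (side_class V \<sigma> (Ex y \<phi>) U') (side_class V \<sigma> (Ex y \<phi>) W') (ex_rows y rs)"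
proof -
  have "set_option (map_option (Ex y) a) \<subseteq> side_class V \<sigma> (Ex y \<phi>) U'"
    if "set_option a \<subseteq> side_class V \<sigma> \<phi> U" for a
    using that Ex_side_class[OF _ assms(2)] by (cases a) simp_all
  moreover have "a \<subseteq> side_class V \<sigma> (Ex y \<phi>) W'" if "a \<subseteq> side_class V \<sigma> \<phi> W" for a
    using that side_class_sub(4)[OF assms(3)] by (rule subset_trans)
  ultimately show ?thesis using assms(1) unfolding rows_in_def ex_rows_def by simp
qed

text \<open>There is at most one free variable, and it lies outside \<open>U\<close>. Hence a
  predicate atom can be evaluated within one summand.\<close>

lemma free_args_one_side:
  assumes "wa1_restr V (Pred P ts)" "\<not> (\<Union>t\<in>set ts. free_tm t) \<subseteq> U"
  shows "(\<Union>t\<in>set ts. free_tm t) \<inter> U = {}"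
proof -
  let ?F = "\<Union>t\<in>set ts. free_tm t"
  have "card ?F \<le> Suc 0" "finite ?F" using assms(1) by (simp_all add: finite_free)
  then have "x = y" if "x \<in> ?F" "y \<in> ?F" for x y
    using that by (meson card_le_Suc0_iff_eq)
  then show ?thesis using assms(2) by blast
qed

text \<open>Besides membership in the class, the variables of each side are tracked: the cases of
  \<open>Ex\<close> and \<open>SumEq\<close> in \<open>sat_dec\<close> rely on the bound variables
  not being free in the components of the other side.\<close>

lemma dec_in:
  fixes V :: "('r, 'w, 'p, 's, 'e) wa_setting"
  shows "wa_setting_ok V \<Longrightarrow> \<phi> \<in> FOW1 V (\<sigma> \<union> {X, Y}) \<Longrightarrow>
    rows_in (side_class V \<sigma> \<phi> (free \<phi> \<inter> set L)) (side_class V \<sigma> \<phi> (free \<phi> - set L)) (dec V X Y \<phi> L)"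
proof (induction V X Y \<phi> L rule: dec.induct)
  case (4 V X Y \<phi> L)
  then have "rows_in (side_class V \<sigma> \<phi> (free \<phi> \<inter> set L)) (side_class V \<sigma> \<phi> (free \<phi> - set L)) (dec V X Y \<phi> L)"
    by (auto simp: FOW1_def WA1_def)
  from rows_in_neg[OF bool_closed_side_class bool_closed_side_class this] show ?case
    unfolding dec.simps free.simps
    by (rule rows_in_mono; intro side_class_sub subset_refl)
next
  case (5 V X Y \<phi> \<psi> L)
  have "rows_in (side_class V \<sigma> \<phi> (free \<phi> \<inter> set L)) (side_class V \<sigma> \<phi> (free \<phi> - set L)) (dec V X Y \<phi> L)"
     "rows_in (side_class V \<sigma> \<psi> (free \<psi> \<inter> set L)) (side_class V \<sigma> \<psi> (free \<psi> - set L)) (dec V X Y \<psi> L)"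
    using 5(3,4) by (auto intro!: 5(1,2) simp: FOW1_def WA1_def)
  then show ?case unfolding dec.simps rows_in_append
    by (intro conjI; elim rows_in_mono; intro side_class_sub; auto)
next
  case (6 V X Y y \<phi> L)
  let ?L = "filter (\<lambda>v. v \<notin> set [y]) L"
  have l: "rows_in (side_class V \<sigma> \<phi> (free \<phi> \<inter> set (y # L))) (side_class V \<sigma> \<phi> (free \<phi> - set (y # L)))
        (dec V X Y \<phi> (y # L))"
    by (rule 6(1)) (use 6(3,4) in \<open>auto simp: FOW1_def WA1_def\<close>)
  have r: "rows_in (side_class V \<sigma> \<phi> (free \<phi> - set ?L)) (side_class V \<sigma> \<phi> (free \<phi> \<inter> set ?L))
        (swap_rows (dec V X Y \<phi> ?L))"
    unfolding rows_in_swap by (rule 6(2)) (use 6(3,4) in \<open>auto simp: FOW1_def WA1_def\<close>)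
  show ?case
    unfolding dec.simps rows_in_append rows_in_swap
    by (intro conjI rows_in_ex[OF l] rows_in_ex[OF r]) auto
next
  case (7 V X Y s w ys \<phi> L)
  let ?L = "filter (\<lambda>v. v \<notin> set ys) L"
  let ?\<phi> = "SumEq s w ys \<phi>"
  let ?K = "side_class V \<sigma> ?\<phi> (free ?\<phi> \<inter> set L)"
  let ?M = "side_class V \<sigma> ?\<phi> (free ?\<phi> - set L)"
  \<comment> \<open>The variable \<open>hd ys\<close> need not be free in \<phi> but occurs where
    \<open>plain\<close> spells out truth. So \<open>set ys\<close> is added to the variables; the
    sum binds them again.\<close>
  let ?Kl = "side_class V \<sigma> \<phi> ((free \<phi> \<union> set ys) \<inter> set (ys @ L))"
  let ?Ml = "side_class V \<sigma> \<phi> (free \<phi> - set (ys @ L))"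
  let ?Kr = "side_class V \<sigma> \<phi> (free \<phi> \<inter> set ?L)"
  let ?Mr = "side_class V \<sigma> \<phi> ((free \<phi> \<union> set ys) - set ?L)"
  have fin: "finite (carrier (alg V (wt_type V w)))" and w: "w \<in> weights V" "length ys = wt_ar V w" "distinct ys"
    using 7(4) by (auto simp: FOW1_def WA1_def)
  have ys: "ys \<noteq> []" using w 7(3) by (auto simp: wa_setting_ok_def)
  have \<phi>: "\<phi> \<in> FOW1 V (\<sigma> \<union> {X, Y})" using 7(4) by (auto simp: FOW1_def WA1_def)
  have hd: "hd ys \<in> (free \<phi> \<union> set ys) \<inter> set (ys @ L)" "hd ys \<in> (free \<phi> \<union> set ys) - set ?L"
    using ys by auto
  have "rows_in ?Ml ?Kl (swap_rows (dec V X Y \<phi> (ys @ L)))"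
    unfolding rows_in_swap by (rule rows_in_mono[OF 7(1)[OF 7(3) \<phi>]]) (auto simp: side_class_def)
  then have l: "rows_in ?Ml ?K (sum_rows s' w ys (swap_rows (dec V X Y \<phi> (ys @ L))))"
    if "s' \<in> carrier (alg V (wt_type V w))" for s'
    by (rule rows_in_sum[OF bool_closed_side_class bool_closed_side_class EqV_side_class[OF hd(1)]])
      (rule SumEq_side_class[OF _ _ w fin that], assumption, auto)
  have "rows_in ?Kr ?Mr (dec V X Y \<phi> ?L)"
    by (rule rows_in_mono[OF 7(2)[OF 7(3) \<phi>]]) (auto simp: side_class_def)
  then have r: "rows_in ?Kr ?M (sum_rows s' w ys (dec V X Y \<phi> ?L))"
    if "s' \<in> carrier (alg V (wt_type V w))" for s'
    by (rule rows_in_sum[OF bool_closed_side_class bool_closed_side_class EqV_side_class[OF hd(2)]])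
      (rule SumEq_side_class[OF _ _ w fin that], assumption, auto)
  have M: "?Ml \<subseteq> ?M" and K: "?Kr \<subseteq> ?K" by (rule side_class_sub(5), force)+
  have "rows_in ?K ?M (conj_rows
       (swap_rows (sum_rows (fst p) w ys (swap_rows (dec V X Y \<phi> (ys @ L)))))
       (sum_rows (snd p) w ys (dec V X Y \<phi> ?L)))" if "p \<in> set (addends V w s)" for p
    using that l[of "fst p"] r[of "snd p"] K M unfolding set_addends[OF fin]
    by (intro rows_in_conj bool_closed_side_class) (auto elim: rows_in_mono)
  then show ?case unfolding dec.simps split_sum_def rows_in_def by auto
next
  case (8 V X Y P ts L)
  \<comment> \<open>The arguments do not mention \<open>X\<close> and \<open>Y\<close>, so the atom
    can be reused over the smaller signature.\<close>
  have t: "wa_tm V \<sigma> t" if "t \<in> set ts" for t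
    using 8 that wa_tm_signature[of t V "\<sigma> \<union> {X, Y}" \<sigma>] by (auto simp: FOW1_def WA1_def)
  then have P: "Pred P ts \<in> FOW1 V \<sigma>" using 8 by (auto simp: FOW1_def WA1_def)
  let ?U = "\<Union>t\<in>set ts. free_tm t"
  have eq: "(\<forall>t\<in>set ts. free_tm t \<subseteq> set L) \<longleftrightarrow> ?U \<subseteq> set L" by blast
  show ?case
  proof (cases "?U \<subseteq> set L")
    case True
    then have "Pred P ts \<in> side_class V \<sigma> (Pred P ts) (free (Pred P ts) \<inter> set L)"
      using P by (intro side_class_self) auto
    then show ?thesis unfolding dec.simps eq using True by (simp add: rows_in_def sided_def)
  next
    case False
    then have "?U \<inter> set L = {}"
      using P by (intro free_args_one_side[of V P]) (auto simp: FOW1_def WA1_def)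
    then have "Pred P ts \<in> side_class V \<sigma> (Pred P ts) (free (Pred P ts) - set L)"
      using P by (intro side_class_self) auto
    then show ?thesis unfolding dec.simps eq using False by (simp add: rows_in_def sided_def)
  qed
qed (auto simp: rows_in_def sided_def FOW1_def WA1_def intro!: side_class_self)


section \<open>Semantic correctness of the rows\<close>

lemma univ_disjoint_sum [simp]:
  "univ (disjoint_sum V X Y A B) = univ A \<union> univ B"
  by (simp add: disjoint_sum_def)

text \<open>The empty tuple counts as a left one, hence the condition \<open>cs \<noteq> []\<close>.
  It does no harm because weights have positive arity.\<close>

lemma wt_disjoint_sum:
  "set cs \<subseteq> univ A \<Longrightarrow> wt (disjoint_sum V X Y A B) w cs = wt A w cs"
  "set cs \<subseteq> univ B \<Longrightarrow> cs \<noteq> [] \<Longrightarrow> univ A \<inter> univ B = {} \<Longrightarrow>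
     wt (disjoint_sum V X Y A B) w cs = wt B w cs"
  "\<not> set cs \<subseteq> univ A \<Longrightarrow> \<not> set cs \<subseteq> univ B \<Longrightarrow>
     wt (disjoint_sum V X Y A B) w cs = \<zero>\<^bsub>alg V (wt_type V w)\<^esub>"
proof -
  show "wt (disjoint_sum V X Y A B) w cs = wt B w cs"
    if "set cs \<subseteq> univ B" "cs \<noteq> []" "univ A \<inter> univ B = {}"
  proof -
    have "\<not> set cs \<subseteq> univ A" using that by (cases cs) auto
    with that show ?thesis by (simp add: disjoint_sum_def)
  qed
qed (simp_all add: disjoint_sum_def)

text \<open>Without aggregation a term reads a structure only through the weights of non-empty
  tuples of values of its free variables.\<close>

lemma val_cong_wt:
  fixes t :: "('r, 'w, 'p, 's, 'e) tm"
  assumes "wa_setting_ok V" "\<And>w cs. cs \<noteq> [] \<Longrightarrow> set cs \<subseteq> U \<Longrightarrow> wt C w cs = wt D w cs"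
  shows "wa_tm V \<sigma> t \<Longrightarrow> no_agg_tm t \<Longrightarrow> \<beta> ` free_tm t \<subseteq> U \<Longrightarrow> val V C t \<beta> = val V D t \<beta>"
proof -
  have "\<phi> = \<phi>" and "wa_tm V \<sigma> t \<Longrightarrow> no_agg_tm t \<Longrightarrow> \<beta> ` free_tm t \<subseteq> U \<Longrightarrow> val V C t \<beta> = val V D t \<beta>"
    for \<phi> :: "('r, 'w, 'p, 's, 'e) fm" and t :: "('r, 'w, 'p, 's, 'e) tm"
  proof (induction \<phi> and t)
    case (Wt w xs)
    then have "xs \<noteq> []" using assms(1) by (auto simp: wa_setting_ok_def)
    then show ?case using Wt assms(2)[of "map \<beta> xs" w] by auto
  qed (auto simp: image_Un)
  then show "wa_tm V \<sigma> t \<Longrightarrow> no_agg_tm t \<Longrightarrow> \<beta> ` free_tm t \<subseteq> U \<Longrightarrow> val V C t \<beta> = val V D t \<beta>"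
    by blast
qed

text \<open>Mixed tuples have weight zero, and a non-empty tuple cannot lie on both sides. The
  property \<open>P\<close> is left abstract since it will refer to the disjoint sum itself.\<close>

lemma finsum_disjoint_sum:
  assumes "wa_setting_ok V" "is_wstruct V \<sigma> A" "is_wstruct V \<sigma> B" "univ A \<inter> univ B = {}"
    and w: "w \<in> weights V" "k = wt_ar V w"
  shows "finsum (alg V (wt_type V w)) (wt (disjoint_sum V X Y A B) w) {cs \<in> tuples (univ A \<union> univ B) k. P cs} =
     finsum (alg V (wt_type V w)) (wt A w) {as \<in> tuples (univ A) k. P as}
     \<oplus>\<^bsub>alg V (wt_type V w)\<^esub> finsum (alg V (wt_type V w)) (wt B w) {bs \<in> tuples (univ B) k. P bs}"
proof -
  let ?G = "alg V (wt_type V w)"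
  let ?C = "disjoint_sum V X Y A B"
  let ?S = "\<lambda>U. {cs \<in> tuples U k. P cs}"
  interpret abelian_group ?G using assms(1) w by (auto simp: wa_setting_ok_def)
  have k: "k \<noteq> 0" using assms(1) w by (auto simp: wa_setting_ok_def)
  have fin: "finite (?S U)" if "finite U" for U using finite_tuples[OF that, of k] by simp
  have finAB: "finite (univ A)" "finite (univ B)" using assms(2,3) by (auto simp: is_wstruct_def)
  have wA: "wt A w as \<in> carrier ?G" if "as \<in> tuples (univ A) k" for as
    using assms(2) w that by (auto simp: is_wstruct_def)
  have wB: "wt B w as \<in> carrier ?G" if "as \<in> tuples (univ B) k" for as
    using assms(3) w that by (auto simp: is_wstruct_def)
  have CA: "wt ?C w as = wt A w as" if "as \<in> tuples (univ A) k" for as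
    using that by (intro wt_disjoint_sum) (auto simp: tuples_def)
  have CB: "wt ?C w as = wt B w as" if "as \<in> tuples (univ B) k" for as
    using that k assms(4) by (intro wt_disjoint_sum) (auto simp: tuples_def)
  have C: "wt ?C w \<in> tuples (univ A \<union> univ B) k \<rightarrow> carrier ?G"
  proof
    fix cs assume cs: "cs \<in> tuples (univ A \<union> univ B) k"
    show "wt ?C w cs \<in> carrier ?G"
    proof (cases "set cs \<subseteq> univ A \<or> set cs \<subseteq> univ B")
      case True
      then show ?thesis using cs wA wB CA CB by (auto simp: tuples_def)
    next
      case False
      then show ?thesis by (simp add: wt_disjoint_sum(3))
    qed
  qed
  have "finsum ?G (wt ?C w) (?S (univ A \<union> univ B)) = finsum ?G (wt ?C w) (?S (univ A) \<union> ?S (univ B))"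
  proof (rule add.finprod_mono_neutral_cong_right)
    show "finite (?S (univ A \<union> univ B))" using finAB by (intro fin) simp
    show "?S (univ A) \<union> ?S (univ B) \<subseteq> ?S (univ A \<union> univ B)" by (auto simp: tuples_def)
    show "wt ?C w cs = \<zero>\<^bsub>?G\<^esub>" if "cs \<in> ?S (univ A \<union> univ B) - (?S (univ A) \<union> ?S (univ B))" for cs
      using that by (intro wt_disjoint_sum(3)) (auto simp: tuples_def)
    show "wt ?C w \<in> ?S (univ A \<union> univ B) \<rightarrow> carrier ?G" using C by auto
  qed simp
  also have "\<dots> = finsum ?G (wt ?C w) (?S (univ A)) \<oplus>\<^bsub>?G\<^esub> finsum ?G (wt ?C w) (?S (univ B))"
  proof (rule finsum_Un_disjoint)
    have "cs = []" if "set cs \<subseteq> univ A" "set cs \<subseteq> univ B" for cs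
      using that assms(4) by (cases cs) auto
    then show "?S (univ A) \<inter> ?S (univ B) = {}" using k by (auto simp: tuples_def)
  qed (use finAB fin wA wB CA CB in auto)
  also have "finsum ?G (wt ?C w) (?S (univ A)) = finsum ?G (wt A w) (?S (univ A))"
    by (rule finsum_cong') (use CA wA in auto)
  also have "finsum ?G (wt ?C w) (?S (univ B)) = finsum ?G (wt B w) (?S (univ B))"
    by (rule finsum_cong') (use CB wB in auto)
  finally show ?thesis .
qed

text \<open>This places the two partial sums among the \<open>addends\<close>, which range over the
  carrier.\<close>

lemma finsum_wt_closed:
  assumes "wa_setting_ok V" "is_wstruct V \<sigma> A" "w \<in> weights V"
  shows "finsum (alg V (wt_type V w)) (wt A w) {as \<in> tuples (univ A) (wt_ar V w). P as} \<in>
    carrier (alg V (wt_type V w))"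
proof -
  interpret abelian_group "alg V (wt_type V w)" using assms by (auto simp: wa_setting_ok_def)
  show ?thesis using assms(2,3) by (intro finsum_closed) (auto simp: is_wstruct_def)
qed

lemma side_class_mem:
  "a \<in> side_class V \<sigma> \<phi> U \<Longrightarrow> wa_fm V \<sigma> a \<and> no_agg a \<and> free a \<subseteq> U"
  by (auto simp: side_class_def fv_class_def FOW1_def WA1_def)

lemma sat_rows_sided [simp]:
  "sat_rows V A B (sided \<phi> l r) \<beta> \<longleftrightarrow> l \<and> sat V A \<phi> \<beta> \<or> r \<and> sat V B \<phi> \<beta>"
  by (auto simp: sided_def sat_rows_def)

lemma sat_rows_simps [simp]:
  "\<not> sat_rows V A B [] \<beta>"
  "sat_rows V A B (r # rs) \<beta> \<longleftrightarrow>
     sat_opt V A (fst r) \<beta> \<and> sat_opt V B (snd r) \<beta> \<or> sat_rows V A B rs \<beta>"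
  by (auto simp: sat_rows_def)

lemma sat_rows_concat [simp]:
  "sat_rows V A B (concat rss) \<beta> \<longleftrightarrow> (\<exists>rs\<in>set rss. sat_rows V A B rs \<beta>)"
  by (auto simp: sat_rows_def)

lemma sat_split_sum [simp]:
  "sat_rows V A B (split_sum ps w ys rs qs) \<beta> \<longleftrightarrow>
     (\<exists>p\<in>set ps. sat_rows V B A (sum_rows (fst p) w ys (swap_rows rs)) \<beta> \<and>
        sat_rows V A B (sum_rows (snd p) w ys qs) \<beta>)"
  by (simp add: split_sum_def)

text \<open>Only free variables are constrained by \<open>L\<close>, so under a binder
  \<open>L\<close> can be adjusted to the side of the chosen value. One assignment serves both
  summands, as each component reads only the variables of its own side.\<close>

theorem sat_dec:
  fixes A B :: "('a, 'r, 'w, 'e) wstruct"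
  assumes AB: "is_wstruct V \<sigma> A" "is_wstruct V \<sigma> B" "univ A \<inter> univ B = {}"
    and XY: "X \<notin> \<sigma>" "Y \<notin> \<sigma>" "X \<noteq> Y" "rel_ar V X = 1" "rel_ar V Y = 1"
    and V: "wa_setting_ok V"
  shows "\<phi> \<in> FOW1 V (\<sigma> \<union> {X, Y}) \<Longrightarrow>
    (\<And>v. v \<in> free \<phi> \<Longrightarrow> \<beta> v \<in> (if v \<in> set L then univ A else univ B)) \<Longrightarrow>
    sat V (disjoint_sum V X Y A B) \<phi> \<beta> \<longleftrightarrow> sat_rows V A B (dec V X Y \<phi> L) \<beta>"
proof (induction "size \<phi>" arbitrary: \<phi> L \<beta> rule: less_induct)
  case less
  let ?C = "disjoint_sum V X Y A B"
  have in_univ: "\<beta> v \<in> univ A \<longleftrightarrow> v \<in> set L" "\<beta> v \<in> univ B \<longleftrightarrow> v \<notin> set L" if "v \<in> free \<phi>" for v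
    using less.prems(2)[OF that] AB(3) by (auto split: if_splits)
  have img: "\<beta> ` U \<subseteq> univ A \<longleftrightarrow> (\<forall>v\<in>U. v \<in> set L)" "\<beta> ` U \<subseteq> univ B \<longleftrightarrow> (\<forall>v\<in>U. v \<notin> set L)"
    if "U \<subseteq> free \<phi>" for U
    using in_univ that by (auto simp: subset_iff)
  show ?case
  proof (cases \<phi>)
    case (EqV x y)
    then show ?thesis using less.prems(2)[of x] less.prems(2)[of y] AB(3) by (auto split: if_splits)
  next
    case (Rel R xs)
    have R: "R \<in> \<sigma> \<union> {X, Y}" "length xs = rel_ar V R"
      using less.prems(1) by (auto simp: Rel FOW1_def WA1_def)
    show ?thesis
    proof (cases "R \<in> \<sigma>")
      case True
      \<comment> \<open>Tuples of a relation stay inside one summand, so mixed arguments satisfy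
        neither side. For a nullary \<open>R\<close> both rows are present, which matches the union
        of the two relations.\<close>
      then have rel: "rel A R \<subseteq> tuples (univ A) (rel_ar V R)" "rel B R \<subseteq> tuples (univ B) (rel_ar V R)"
        using AB by (auto simp: is_wstruct_def)
      have "\<beta> ` set xs \<subseteq> univ A" if "map \<beta> xs \<in> rel A R"
        using subsetD[OF rel(1) that] by (simp add: tuples_def)
      moreover have "\<beta> ` set xs \<subseteq> univ B" if "map \<beta> xs \<in> rel B R"
        using subsetD[OF rel(2) that] by (simp add: tuples_def)
      ultimately have "map \<beta> xs \<in> rel A R \<Longrightarrow> \<forall>v\<in>set xs. v \<in> set L" "map \<beta> xs \<in> rel B R \<Longrightarrow> \<forall>v\<in>set xs. v \<notin> set L"
        using img[of "set xs"] by (simp_all add: Rel)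
      then show ?thesis using True XY by (auto simp: Rel disjoint_sum_def)
    next
      case False
      then have "rel_ar V R = 1" using R XY by auto
      then obtain x where "xs = [x]" using R(2) by (cases xs) auto
      then show ?thesis using False R XY in_univ[of x] by (auto simp: Rel disjoint_sum_def)
    qed
  next
    case (WtEq s w xs)
    have "xs \<noteq> []" using less.prems(1) V by (auto simp: WtEq FOW1_def WA1_def wa_setting_ok_def)
    then show ?thesis
      using img[of "set xs"] AB(3) by (simp add: WtEq wt_disjoint_sum)
  next
    case (Neg \<psi>)
    have "sat V ?C \<psi> \<beta> \<longleftrightarrow> sat_rows V A B (dec V X Y \<psi> L) \<beta>"
      using less.prems by (intro less.hyps) (auto simp: Neg FOW1_def WA1_def)
    then show ?thesis by (simp add: Neg)
  next
    case (Or \<psi> \<chi>)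
    have "sat V ?C \<psi> \<beta> \<longleftrightarrow> sat_rows V A B (dec V X Y \<psi> L) \<beta>"
      using less.prems by (intro less.hyps) (auto simp: Or FOW1_def WA1_def)
    moreover have "sat V ?C \<chi> \<beta> \<longleftrightarrow> sat_rows V A B (dec V X Y \<chi> L) \<beta>"
      using less.prems by (intro less.hyps) (auto simp: Or FOW1_def WA1_def)
    ultimately show ?thesis by (simp add: Or)
  next
    case (Ex y \<psi>)
    let ?L = "filter (\<lambda>v. v \<notin> set [y]) L"
    have \<psi>: "\<psi> \<in> FOW1 V (\<sigma> \<union> {X, Y})" using less.prems(1) by (auto simp: Ex FOW1_def WA1_def)
    have l: "sat V ?C \<psi> (\<beta>(y := a)) \<longleftrightarrow> sat_rows V A B (dec V X Y \<psi> (y # L)) (\<beta>(y := a))"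
      if "a \<in> univ A" for a
      using in_univ that by (intro less.hyps \<psi>) (auto simp: Ex)
    have r: "sat V ?C \<psi> (\<beta>(y := a)) \<longleftrightarrow> sat_rows V A B (dec V X Y \<psi> ?L) (\<beta>(y := a))"
      if "a \<in> univ B" for a
      using in_univ that by (intro less.hyps \<psi>) (auto simp: Ex)
    have "wa_fm V \<sigma> b \<and> no_agg b \<and> y \<notin> free b"
      if "p \<in> set (dec V X Y \<psi> (y # L))" "snd p = Some b" for p b
      using dec_in[OF V \<psi>, of "y # L"] that side_class_mem[of b] by (fastforce simp: rows_in_def)
    then have "sat_rows V A B (ex_rows y (dec V X Y \<psi> (y # L))) \<beta> \<longleftrightarrow> (\<exists>a\<in>univ A. sat V ?C \<psi> (\<beta>(y := a)))"
      using AB(1) by (subst sat_ex_rows[of A _ V \<sigma>]) (auto simp: l is_wstruct_def)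
    moreover have "wa_fm V \<sigma> b \<and> no_agg b \<and> y \<notin> free b"
      if "p \<in> set (swap_rows (dec V X Y \<psi> ?L))" "snd p = Some b" for p b
      using dec_in[OF V \<psi>, of ?L] that side_class_mem[of b] by (fastforce simp: rows_in_def swap_rows_def)
    then have "sat_rows V B A (ex_rows y (swap_rows (dec V X Y \<psi> ?L))) \<beta> \<longleftrightarrow> (\<exists>b\<in>univ B. sat V ?C \<psi> (\<beta>(y := b)))"
      using AB(2) by (subst sat_ex_rows[of B _ V \<sigma>]) (auto simp: r is_wstruct_def)
    ultimately show ?thesis by (auto simp: Ex)
  next
    case (SumEq s w ys \<psi>)
    let ?L = "filter (\<lambda>v. v \<notin> set ys) L"
    let ?G = "alg V (wt_type V w)"
    let ?sum = "\<lambda>D. finsum ?G (wt D w) {cs \<in> tuples (univ D) (wt_ar V w). sat V ?C \<psi> (upd \<beta> ys cs)}"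
    have \<psi>: "\<psi> \<in> FOW1 V (\<sigma> \<union> {X, Y})" using less.prems(1) by (auto simp: SumEq FOW1_def WA1_def)
    have w: "w \<in> weights V" "length ys = wt_ar V w" "finite (carrier ?G)"
      using less.prems(1) by (auto simp: SumEq FOW1_def WA1_def)
    have l: "sat V ?C \<psi> (upd \<beta> ys cs) \<longleftrightarrow> sat_rows V A B (dec V X Y \<psi> (ys @ L)) (upd \<beta> ys cs)"
      if "cs \<in> tuples (univ A) (wt_ar V w)" for cs
    proof (intro less.hyps \<psi>)
      show "upd \<beta> ys cs v \<in> (if v \<in> set (ys @ L) then univ A else univ B)" if "v \<in> free \<psi>" for v
        using \<open>cs \<in> _\<close> that w(2) in_univ[of v] upd_in[of cs ys v \<beta>] upd_notin[of cs ys v \<beta>]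
        by (cases "v \<in> set ys") (auto simp: tuples_def SumEq)
    qed (simp add: SumEq)
    have r: "sat V ?C \<psi> (upd \<beta> ys cs) \<longleftrightarrow> sat_rows V A B (dec V X Y \<psi> ?L) (upd \<beta> ys cs)"
      if "cs \<in> tuples (univ B) (wt_ar V w)" for cs
    proof (intro less.hyps \<psi>)
      show "upd \<beta> ys cs v \<in> (if v \<in> set ?L then univ A else univ B)" if "v \<in> free \<psi>" for v
        using \<open>cs \<in> _\<close> that w(2) in_univ[of v] upd_in[of cs ys v \<beta>] upd_notin[of cs ys v \<beta>]
        by (cases "v \<in> set ys") (auto simp: tuples_def SumEq)
    qed (simp add: SumEq)
    have "wa_fm V \<sigma> b \<and> no_agg b \<and> free b \<inter> set ys = {}"
      if "p \<in> set (swap_rows (dec V X Y \<psi> (ys @ L)))" "fst p = Some b" for p b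
      using dec_in[OF V \<psi>, of "ys @ L"] that side_class_mem[of b] by (fastforce simp: rows_in_def swap_rows_def)
    note sumA = sat_sum_rows[OF this w(2)]
    have "wa_fm V \<sigma> b \<and> no_agg b \<and> free b \<inter> set ys = {}"
      if "p \<in> set (dec V X Y \<psi> ?L)" "fst p = Some b" for p b
      using dec_in[OF V \<psi>, of ?L] that side_class_mem[of b] by (fastforce simp: rows_in_def)
    note sumB = sat_sum_rows[OF this w(2)]
    \<comment> \<open>Here the roles of the structures are exchanged: summation in \<open>A\<close>,
      guards in \<open>B\<close>.\<close>
    have "sat_rows V B A (sum_rows s' w ys (swap_rows (dec V X Y \<psi> (ys @ L)))) \<beta> \<longleftrightarrow> s' = ?sum A" for s'
      using sumA[where A = B and B = A and s = s' and \<beta> = \<beta>] l by (simp cong: conj_cong)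
    moreover have "sat_rows V A B (sum_rows s' w ys (dec V X Y \<psi> ?L)) \<beta> \<longleftrightarrow> s' = ?sum B" for s'
      using sumB[where A = A and B = B and s = s' and \<beta> = \<beta>] r by (simp cong: conj_cong)
    moreover have "sat V ?C \<phi> \<beta> \<longleftrightarrow> s = ?sum A \<oplus>\<^bsub>?G\<^esub> ?sum B"
      using finsum_disjoint_sum[OF V AB w(1) refl, where P = "\<lambda>cs. sat V ?C \<psi> (upd \<beta> ys cs)"]
      by (simp add: SumEq)
    ultimately show ?thesis
      using finsum_wt_closed[OF V AB(1) w(1)] finsum_wt_closed[OF V AB(2) w(1)]
      by (auto simp: SumEq set_addends[OF w(3)])
  next
    case (Pred P ts)
    have t: "wa_tm V (\<sigma> \<union> {X, Y}) t" "no_agg_tm t" if "t \<in> set ts" for t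
      using less.prems(1) that by (auto simp: Pred FOW1_def WA1_def)
    let ?U = "\<Union>t\<in>set ts. free_tm t"
    show ?thesis
    proof (cases "?U \<subseteq> set L")
      case True
      have "val V ?C t \<beta> = val V A t \<beta>" if "t \<in> set ts" for t
        using True that img(1)[of "free_tm t"]
        by (intro val_cong_wt[OF V _ t[OF that], of "univ A"] wt_disjoint_sum) (auto simp: Pred)
      then have "map (\<lambda>t. val V ?C t \<beta>) ts = map (\<lambda>t. val V A t \<beta>) ts" by simp
      then show ?thesis using True by (auto simp: Pred simp del: map_eq_conv)
    next
      case False
      have disj: "?U \<inter> set L = {}"
        using less.prems(1) False
        by (intro free_args_one_side[of V P]) (auto simp: Pred FOW1_def WA1_def)
      have "val V ?C t \<beta> = val V B t \<beta>" if "t \<in> set ts" for t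
        using disj that img(2)[of "free_tm t"] AB(3)
        by (intro val_cong_wt[OF V _ t[OF that], of "univ B"] wt_disjoint_sum) (auto simp: Pred)
      then have "map (\<lambda>t. val V ?C t \<beta>) ts = map (\<lambda>t. val V B t \<beta>) ts" by simp
      then show ?thesis using False by (auto simp: Pred simp del: map_eq_conv)
    qed
  qed
qed

section \<open>Tautologies of the admissible class\<close>

text \<open>In an encoded formula, an element of \<open>S\<close> either follows the atom \<open>AAlg S\<close> (in a constant term) or
  precedes a weight symbol of type \<open>S\<close> (in an equation). In the second case the element is recognised
  as being no pair, since a program cannot tell the kinds of atoms apart.\<close>

definition names_weight :: "('r, 'w, 'p, 's, 'e) wa_setting \<Rightarrow> 's \<Rightarrow> ('r, 'w, 'p, 's, 'e) atom sexp \<Rightarrow> bool" where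
  "names_weight V S d \<longleftrightarrow> (\<exists>w\<in>weights V. wt_type V w = S \<and> d = SAtom (AWt w))"

fun find_elem :: "('r, 'w, 'p, 's, 'e) wa_setting \<Rightarrow> 's \<Rightarrow> ('r, 'w, 'p, 's, 'e) atom sexp \<Rightarrow>
    ('r, 'w, 'p, 's, 'e) atom sexp" where
  "find_elem V S (SCons a b) =
     (if a = SAtom (AAlg S) then car b
      else if names_weight V S (car b) \<and> \<not> (\<exists>u v. a = SCons u v) then a
      else if find_elem V S a \<noteq> SNil then find_elem V S a else find_elem V S b)"
| "find_elem V S d = SNil"

text \<open>Everything that the search might return. The search stops at the first hit and reports
  failure by \<open>SNil\<close>, so it is correct once this set is known and does not contain
  \<open>SNil\<close>.\<close>

fun elems :: "('r, 'w, 'p, 's, 'e) wa_setting \<Rightarrow> 's \<Rightarrow> ('r, 'w, 'p, 's, 'e) atom sexp \<Rightarrow>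
    ('r, 'w, 'p, 's, 'e) atom sexp set" where
  "elems V S (SCons a b) =
     (if a = SAtom (AAlg S) then {car b} else {}) \<union>
     (if names_weight V S (car b) \<and> \<not> (\<exists>u v. a = SCons u v) then {a} else {}) \<union>
     elems V S a \<union> elems V S b"
| "elems V S d = {}"

lemma find_elem_elems:
  "SNil \<notin> elems V S d \<Longrightarrow> find_elem V S d = SNil \<and> elems V S d = {} \<or> find_elem V S d \<in> elems V S d"
  by (induction d) (auto split: if_splits)

lemma names_weight_simps [simp]:
  "\<not> names_weight V S SNil" "\<not> names_weight V S (SCons a b)"
  "\<not> names_weight V S (SAtom (AElem s))" "\<not> names_weight V S (SAtom (AAlg T))"
  "\<not> names_weight V S (SAtom (ARel R))" "\<not> names_weight V S (SAtom (APred P))"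
  "\<not> names_weight V S (snum n)"
  "names_weight V S (SAtom (AWt w)) \<longleftrightarrow> w \<in> weights V \<and> wt_type V w = S"
  by (cases n; auto simp: names_weight_def)+

lemma enc_SCons: "\<exists>a b. enc \<phi> = SCons a b" "\<exists>a b. enc_tm t = SCons a b"
  by (cases \<phi>; simp) (cases t; simp)

lemma not_names_weight_enc [simp]:
  "\<not> names_weight V S (enc \<phi>)" "\<not> names_weight V S (enc_tm t)"
  "\<not> names_weight V S (slist ds)" "\<not> names_weight V S (svars xs)"
  unfolding svars_def using enc_SCons(1)[of \<phi>] enc_SCons(2)[of t] by (auto, cases ds, auto, cases xs, auto)

lemma snum_not_SAtom [simp]: "snum n \<noteq> SAtom a"
  by (cases n) auto

lemma slist_not_SAtom [simp]: "slist ds \<noteq> SAtom a" "svars xs \<noteq> SAtom a"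
proof -
  show *: "slist ds \<noteq> SAtom a" for ds :: "'a sexp list" by (cases ds) auto
  show "svars xs \<noteq> SAtom a" unfolding svars_def by (rule *)
qed

lemma enc_not_SAtom [simp]: "enc \<phi> \<noteq> SAtom a" "enc_tm t \<noteq> SAtom a"
  using enc_SCons(1)[of \<phi>] enc_SCons(2)[of t] by auto

lemma not_names_weight_car_slist:
  "(\<And>d. d \<in> set ds \<Longrightarrow> \<not> names_weight V S d) \<Longrightarrow> \<not> names_weight V S (car (slist ds))"
  by (cases ds) auto

lemma elems_snum [simp]: "elems V S (snum n) = {}"
proof (induction n)
  case (Suc n)
  then show ?case by (cases n) auto
qed simp

text \<open>No entry is an atom or names a weight, so the cells of the list itself trigger neither
  rule.\<close>

lemma elems_slist:
  "(\<And>d. d \<in> set ds \<Longrightarrow> \<not> names_weight V S d \<and> (\<forall>a. d \<noteq> SAtom a)) \<Longrightarrow>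
     elems V S (slist ds) = (\<Union>d\<in>set ds. elems V S d)"
proof (induction ds)
  case (Cons d ds)
  have "\<not> names_weight V S (car (slist ds))"
    by (rule not_names_weight_car_slist) (use Cons.prems in auto)
  with Cons show ?case by auto
qed simp

lemma elems_svars [simp]: "elems V S (svars xs) = {}"
  unfolding svars_def by (subst elems_slist) auto

lemma names_weight_svars [simp]: "\<not> names_weight V S (car (svars xs))"
  unfolding svars_def by (rule not_names_weight_car_slist) auto

text \<open>A hit in front of a weight symbol is genuine: the tag of a weight term also precedes
  such a symbol, but it is \<open>snum 1\<close>, a pair, and is rejected by the test.\<close>

lemma elems_enc:
  fixes \<phi> :: "('r, 'w, 'p, 's, 'e) fm" and t :: "('r, 'w, 'p, 's, 'e) tm"
  shows "wa_fm V \<sigma> \<phi> \<Longrightarrow> no_agg \<phi> \<Longrightarrow>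
      elems V S (enc \<phi>) = (\<lambda>s. SAtom (AElem s)) ` {s. Const S s \<in> tms_in V \<phi>}"
    and "wa_tm V \<sigma> t \<Longrightarrow> no_agg_tm t \<Longrightarrow>
      elems V S (enc_tm t) = (\<lambda>s. SAtom (AElem s)) ` {s. Const S s \<in> subtms V t}"
proof (induction \<phi> and t)
  case (Pred P ts)
  have "elems V S (slist (map enc_tm ts)) = (\<Union>t\<in>set ts. elems V S (enc_tm t))"
    by (subst elems_slist) auto
  also have "\<dots> = (\<Union>t\<in>set ts. (\<lambda>s. SAtom (AElem s)) ` {s. Const S s \<in> subtms V t})"
    using Pred by auto
  finally show ?case by (auto simp: eval_nat_numeral)
qed (auto simp: eval_nat_numeral)

lemma self_subtms: "t \<in> subtms V t"
  by (cases t) auto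

text \<open>Arithmetic preserves types, so the type of a term is the type of a leaf, which is a
  constant or a weight. A type that occurs in \<phi> without a constant is thus one of the finitely
  many types of weights, whose zeros can be tabulated.\<close>

lemma tms_in_types:
  fixes \<phi> :: "('r, 'w, 'p, 's, 'e) fm" and t :: "('r, 'w, 'p, 's, 'e) tm"
  shows "wa_fm V \<sigma> \<phi> \<Longrightarrow> no_agg \<phi> \<Longrightarrow> u \<in> tms_in V \<phi> \<Longrightarrow>
      (\<exists>s. Const (tm_type V u) s \<in> tms_in V \<phi>) \<or> tm_type V u \<in> wt_type V ` weights V"
    and "wa_tm V \<sigma> t \<Longrightarrow> no_agg_tm t \<Longrightarrow> u \<in> subtms V t \<Longrightarrow>
      (\<exists>s. Const (tm_type V u) s \<in> subtms V t) \<or> tm_type V u \<in> wt_type V ` weights V"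
proof (induction \<phi> and t arbitrary: u and u)
  case (Plus t1 t2)
  then consider "u = Plus t1 t2" | "u \<in> subtms V t1" | "u \<in> subtms V t2" by auto
  then show ?case
  proof cases
    case 1
    with Plus.IH(1)[OF _ _ self_subtms] Plus.prems show ?thesis by auto
  next
    case 2
    with Plus.IH(1)[OF _ _ 2] Plus.prems show ?thesis by auto
  next
    case 3
    with Plus.IH(2)[OF _ _ 3] Plus.prems show ?thesis by auto
  qed
next
  case (Minus t1 t2)
  then consider "u = Minus t1 t2" | "u \<in> subtms V t1" | "u \<in> subtms V t2" by auto
  then show ?case
  proof cases
    case 1
    with Minus.IH(1)[OF _ _ self_subtms] Minus.prems show ?thesis by auto
  next
    case 2
    with Minus.IH(1)[OF _ _ 2] Minus.prems show ?thesis by auto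
  next
    case 3
    with Minus.IH(2)[OF _ _ 3] Minus.prems show ?thesis by auto
  qed
next
  case (Times t1 t2)
  then consider "u = Times t1 t2" | "u \<in> subtms V t1" | "u \<in> subtms V t2" by auto
  then show ?case
  proof cases
    case 1
    with Times.IH(1)[OF _ _ self_subtms] Times.prems show ?thesis by auto
  next
    case 2
    with Times.IH(1)[OF _ _ 2] Times.prems show ?thesis by auto
  next
    case 3
    with Times.IH(2)[OF _ _ 3] Times.prems show ?thesis by auto
  qed
next
  case (Pred P ts)
  then obtain t where t: "t \<in> set ts" "u \<in> subtms V t" by auto
  from Pred.IH[OF t(1) _ _ t(2)] Pred.prems t(1) show ?case by auto
next
  case (Or \<phi> \<psi>)
  then consider "u \<in> tms_in V \<phi>" | "u \<in> tms_in V \<psi>" by auto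
  then show ?case
  proof cases
    case 1
    with Or.IH(1)[OF _ _ 1] Or.prems show ?thesis by auto
  next
    case 2
    with Or.IH(2)[OF _ _ 2] Or.prems show ?thesis by auto
  qed
next
  case (SumEq s w ys \<phi>)
  then consider "u = Const (wt_type V w) s" | "u = Wt w ys" | "u \<in> tms_in V \<phi>" by auto
  then show ?case
  proof cases
    case 3
    with SumEq.IH[OF _ _ 3] SumEq.prems show ?thesis by auto
  qed (use SumEq.prems in auto)
qed auto

lemma const_carrier:
  fixes \<phi> :: "('r, 'w, 'p, 's, 'e) fm" and t :: "('r, 'w, 'p, 's, 'e) tm"
  assumes "wa_setting_ok V"
  shows "wa_fm V \<sigma> \<phi> \<Longrightarrow> no_agg \<phi> \<Longrightarrow> Const S s \<in> tms_in V \<phi> \<Longrightarrow>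
      S \<in> alg_names V \<and> s \<in> carrier (alg V S)"
    and "wa_tm V \<sigma> t \<Longrightarrow> no_agg_tm t \<Longrightarrow> Const S s \<in> subtms V t \<Longrightarrow>
      S \<in> alg_names V \<and> s \<in> carrier (alg V S)"
  using assms by (induction \<phi> and t) (auto simp: wa_setting_ok_def)

text \<open>\<open>SNil\<close> means that no element of \<open>S\<close> may be used as a constant.\<close>

definition const_of :: "('r, 'w, 'p, 's, 'e) wa_setting \<Rightarrow> ('r, 'w, 'p, 's, 'e) fm \<Rightarrow> 's \<Rightarrow>
    ('r, 'w, 'p, 's, 'e) atom sexp" where
  "const_of V \<phi> S =
     (if find_elem V S (enc \<phi>) \<noteq> SNil then find_elem V S (enc \<phi>)
      else if S \<in> wt_type V ` weights V \<and> finite (carrier (alg V S)) then SAtom (AElem \<zero>\<^bsub>alg V S\<^esub>)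
      else SNil)"

fun the_elem_atom where
  "the_elem_atom (SAtom (AElem s)) = s"

text \<open>A search for a closed admissible formula. Any quantifier or sum leaves rank 1 available,
  enough for \<open>Ex 0 (EqV 0 0)\<close>. At rank 0 and without nullary relations, what remains is
  a predicate whose arguments are replaced by constants of the same types.\<close>

fun closed_atom :: "('r, 'w, 'p, 's, 'e) wa_setting \<Rightarrow> ('s \<Rightarrow> ('r, 'w, 'p, 's, 'e) atom sexp) \<Rightarrow>
    ('r, 'w, 'p, 's, 'e) fm \<Rightarrow> ('r, 'w, 'p, 's, 'e) fm option" where
  "closed_atom V c (Neg \<phi>) = closed_atom V c \<phi>"
| "closed_atom V c (Or \<phi> \<psi>) =
     (if closed_atom V c \<phi> \<noteq> None then closed_atom V c \<phi> else closed_atom V c \<psi>)"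
| "closed_atom V c (Ex y \<phi>) = Some (Ex 0 (EqV 0 0))"
| "closed_atom V c (SumEq s w ys \<phi>) = Some (Ex 0 (EqV 0 0))"
| "closed_atom V c (Pred P ts) =
     (if \<forall>t\<in>set ts. c (tm_type V t) \<noteq> SNil
      then Some (Pred P (map (\<lambda>t. Const (tm_type V t) (the_elem_atom (c (tm_type V t)))) ts)) else None)"
| "closed_atom V c \<phi> = None"

lemma const_of_cases:
  assumes "wa_setting_ok V" "wa_fm V \<sigma> \<phi>" "no_agg \<phi>"
  shows "const_of V \<phi> S = SNil \<and> (\<forall>s. Const S s \<notin> tms_in V \<phi>) \<and>
      \<not> (S \<in> wt_type V ` weights V \<and> finite (carrier (alg V S))) \<or>
    (\<exists>s. const_of V \<phi> S = SAtom (AElem s) \<and> S \<in> alg_names V \<and> s \<in> carrier (alg V S) \<and>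
      (Const S s \<in> tms_in V \<phi> \<or> finite (carrier (alg V S))))"
proof -
  note E = elems_enc(1)[OF assms(2,3), of S]
  have "SNil \<notin> elems V S (enc \<phi>)" unfolding E by blast
  from find_elem_elems[OF this] consider
    "find_elem V S (enc \<phi>) = SNil" "\<forall>s. Const S s \<notin> tms_in V \<phi>"
    | s where "find_elem V S (enc \<phi>) = SAtom (AElem s)" "Const S s \<in> tms_in V \<phi>"
    unfolding E by blast
  then show ?thesis
  proof cases
    case 1
    show ?thesis
    proof (cases "S \<in> wt_type V ` weights V \<and> finite (carrier (alg V S))")
      case True
      then have S: "S \<in> alg_names V" using assms(1) by (auto simp: wa_setting_ok_def)
      then interpret abelian_group "alg V S" using assms(1) by (auto simp: wa_setting_ok_def)
      have "const_of V \<phi> S = SAtom (AElem \<zero>\<^bsub>alg V S\<^esub>)" using True 1 by (simp add: const_of_def)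
      then show ?thesis using True S zero_closed by blast
    next
      case False
      then have "const_of V \<phi> S = SNil" using 1 by (simp add: const_of_def)
      then show ?thesis using False 1 by blast
    qed
  next
    case 2
    then have "const_of V \<phi> S = SAtom (AElem s)" by (simp add: const_of_def)
    then show ?thesis using 2 const_carrier(1)[OF assms 2(2)] by blast
  qed
qed

lemma qr_Pred: "no_agg (Pred P ts) \<Longrightarrow> qr (Pred P ts) = 0"
proof -
  assume "no_agg (Pred P ts)"
  then have "insert 0 (set (map qr_tm ts)) = {0}" by (auto simp: qr_tm_no_agg)
  then show ?thesis by (simp only: qr.simps Max_singleton)
qed

text \<open>The formula \<phi>, which bounds the class and supplies constants, stays fixed while the
  search descends to \<psi>.\<close>

lemma closed_atom_sound:
  assumes "wa_setting_ok V" "\<phi> \<in> FOW1 V \<tau>"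
  shows "\<psi> \<in> FOW1 V \<tau> \<Longrightarrow> preds_in \<psi> \<subseteq> preds_in \<phi> \<Longrightarrow> tms_in V \<psi> \<subseteq> tms_in V \<phi> \<Longrightarrow> qr \<psi> \<le> qr \<phi> \<Longrightarrow>
    closed_atom V (const_of V \<phi>) \<psi> = Some \<alpha> \<Longrightarrow> \<alpha> \<in> fv_class V \<sigma> \<phi> \<and> free \<alpha> = {}"
proof (induction "size \<psi>" arbitrary: \<psi> rule: less_induct)
  case less
  show ?case
  proof (cases \<psi>)
    case (Neg \<chi>)
    then show ?thesis using less.prems by (intro less.hyps[of \<chi>]) (auto simp: FOW1_def WA1_def)
  next
    case (Or \<chi> \<omega>)
    show ?thesis
    proof (cases "closed_atom V (const_of V \<phi>) \<chi> = None")
      case True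
      then show ?thesis using less.prems Or by (intro less.hyps[of \<omega>]) (auto simp: FOW1_def WA1_def)
    next
      case False
      then show ?thesis using less.prems Or by (intro less.hyps[of \<chi>]) (auto simp: FOW1_def WA1_def)
    qed
  next
    case (Pred P ts)
    let ?S = "tm_type V"
    let ?e = "\<lambda>t. the_elem_atom (const_of V \<phi> (?S t))"
    have \<phi>: "wa_fm V \<tau> \<phi>" "no_agg \<phi>" using assms(2) by (auto simp: FOW1_def WA1_def)
    have nonnil: "const_of V \<phi> (?S t) \<noteq> SNil" if "t \<in> set ts" for t
      using less.prems(5) that by (auto simp: Pred split: if_splits)
    have \<alpha>: "\<alpha> = Pred P (map (\<lambda>t. Const (?S t) (?e t)) ts)"
      using less.prems(5) by (auto simp: Pred split: if_splits)
    have algs: "?S t \<in> algs_in V \<phi>" if "t \<in> set ts" for t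
      using less.prems(3) that self_subtms[of t V] by (auto simp: algs_in_def Pred)
    have "?S t \<in> alg_names V \<and> ?e t \<in> carrier (alg V (?S t)) \<and>
        (Const (?S t) (?e t) \<in> tms_in V \<phi> \<or> finite (carrier (alg V (?S t))))" if "t \<in> set ts" for t
      using const_of_cases[OF assms(1) \<phi>, of "?S t"] nonnil[OF that] by auto
    then have "\<forall>t\<in>set ts. ?S t \<in> alg_names V \<and> ?e t \<in> carrier (alg V (?S t)) \<and>
        (Const (?S t) (?e t) \<notin> tms_in V \<phi> \<longrightarrow> finite (carrier (alg V (?S t))))" by blast
    moreover have "qr \<alpha> = 0" unfolding \<alpha> by (rule qr_Pred) simp
    ultimately show ?thesis using less.prems(1,2) algs
      by (auto simp: \<alpha> Pred fv_class_def FOW1_def WA1_def algs_in_def comp_def)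
  qed (use less.prems in \<open>auto simp: fv_class_def FOW1_def WA1_def algs_in_def\<close>)
qed

lemma closed_atom_None:
  assumes "wa_fm V \<tau> \<psi>" "no_agg \<psi>" "closed_atom V c \<psi> = None"
  shows "qr \<psi> = 0 \<and> (\<forall>P\<in>preds_in \<psi>. \<exists>S\<in>set (pred_type V P). c S = SNil)"
  using assms
proof (induction V c \<psi> rule: closed_atom.induct)
  case (5 V c P ts)
  then have "\<forall>t\<in>set ts. preds_in_tm t = {}" by (simp add: preds_in_tm_no_agg)
  moreover have "pred_type V P = map (tm_type V) ts" using 5 by simp
  moreover have "\<exists>t\<in>set ts. c (tm_type V t) = SNil" using 5(3) by (auto split: if_splits)
  ultimately show ?case using qr_Pred[OF 5(2)] by (auto simp del: qr.simps)
qed (auto split: if_splits)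

text \<open>Weights have positive arity, so all leaves of a closed term are constants, and the
  leftmost one has its type.\<close>

lemma closed_tm_const:
  fixes t :: "('r, 'w, 'p, 's, 'e) tm"
  assumes "wa_setting_ok V"
  shows "wa_tm V \<sigma> t \<Longrightarrow> no_agg_tm t \<Longrightarrow> free_tm t = {} \<Longrightarrow> \<exists>s. Const (tm_type V t) s \<in> subtms V t"
proof -
  have "\<phi> = \<phi>" and "wa_tm V \<sigma> t \<Longrightarrow> no_agg_tm t \<Longrightarrow> free_tm t = {} \<Longrightarrow> \<exists>s. Const (tm_type V t) s \<in> subtms V t"
    for \<phi> :: "('r, 'w, 'p, 's, 'e) fm" and t :: "('r, 'w, 'p, 's, 'e) tm"
    using assms by (induction \<phi> and t) (auto simp: wa_setting_ok_def)
  then show "wa_tm V \<sigma> t \<Longrightarrow> no_agg_tm t \<Longrightarrow> free_tm t = {} \<Longrightarrow> \<exists>s. Const (tm_type V t) s \<in> subtms V t"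
    by blast
qed

text \<open>Equations, weight equations and, by assumption, relation atoms all have variables. So a
  closed formula of rank 0 contains a predicate, and its closed arguments supply constants of all
  required types. This shows that \<open>closed_atom\<close> misses nothing.\<close>

lemma closed_qr0:
  assumes "wa_setting_ok V" "\<forall>R\<in>\<sigma>. rel_ar V R \<noteq> 0"
  shows "wa_fm V \<sigma> \<alpha> \<Longrightarrow> no_agg \<alpha> \<Longrightarrow> qr \<alpha> = 0 \<Longrightarrow> free \<alpha> = {} \<Longrightarrow>
    \<exists>P\<in>preds_in \<alpha>. \<forall>S\<in>set (pred_type V P). \<exists>s. Const S s \<in> tms_in V \<alpha>"
proof (induction "size \<alpha>" arbitrary: \<alpha> rule: less_induct)
  case less
  show ?case
  proof (cases \<alpha>)
    case (Neg \<beta>)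
    then show ?thesis using less.hyps[of \<beta>] less.prems by simp
  next
    case (Or \<beta> \<gamma>)
    then show ?thesis using less.hyps[of \<beta>] less.prems by (simp add: bex_Un) blast
  next
    case (Pred P ts)
    have "\<exists>s. Const (tm_type V t) s \<in> subtms V t" if "t \<in> set ts" for t
      using less.prems that by (intro closed_tm_const[OF assms(1), of \<sigma>]) (auto simp: Pred)
    moreover have "pred_type V P = map (tm_type V) ts" using less.prems(1) by (simp add: Pred)
    ultimately have "\<forall>S\<in>set (pred_type V P). \<exists>s. Const S s \<in> tms_in V \<alpha>"
      unfolding Pred by fastforce
    then show ?thesis by (rule bexI[of _ P]) (simp add: Pred)
  qed (use less.prems assms in \<open>auto simp: wa_setting_ok_def\<close>)
qed

section \<open>A canonical admissible formula and the completed decomposition\<close>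

text \<open>The argument \<open>N\<close> is a nullary relation symbol of the signature, if there is
  one. The \<open>0\<close> given to \<open>plain\<close> is a dummy: \<open>closed_atom\<close>
  succeeds whenever some closed formula is admissible and neither of the other sources
  applies.\<close>

definition candidate :: "('r, 'w, 'p, 's, 'e) wa_setting \<Rightarrow> 'r option \<Rightarrow> ('r, 'w, 'p, 's, 'e) fm \<Rightarrow>
    nat list \<Rightarrow> ('r, 'w, 'p, 's, 'e) fm" where
  "candidate V N \<phi> xs = (if xs \<noteq> [] then EqV (hd xs) (hd xs)
     else case N of Some R \<Rightarrow> Rel R [] | None \<Rightarrow> plain 0 (closed_atom V (const_of V \<phi>) \<phi>))"

definition taut :: "('r, 'w, 'p, 's, 'e) fm \<Rightarrow> ('r, 'w, 'p, 's, 'e) fm" where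
  "taut \<alpha> = Or \<alpha> (Neg \<alpha>)"

fun fill where
  "fill \<alpha> None = taut \<alpha>"
| "fill \<alpha> (Some \<phi>) = \<phi>"

text \<open>Having no rows means falsity. As a decomposition must not be empty, a pair of
  contradictions takes their place.\<close>

definition decomposition :: "('r, 'w, 'p, 's, 'e) wa_setting \<Rightarrow> 'r option \<Rightarrow> 'r \<Rightarrow> 'r \<Rightarrow>
    ('r, 'w, 'p, 's, 'e) fm \<Rightarrow> nat list \<Rightarrow> nat list \<Rightarrow>
    (('r, 'w, 'p, 's, 'e) fm \<times> ('r, 'w, 'p, 's, 'e) fm) list" where
  "decomposition V N X Y \<phi> xs ys =
     (if dec V X Y \<phi> xs = [] then [(Neg (taut (candidate V N \<phi> xs)), Neg (taut (candidate V N \<phi> ys)))]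
      else map (\<lambda>r. (fill (candidate V N \<phi> xs) (fst r), fill (candidate V N \<phi> ys) (snd r)))
        (dec V X Y \<phi> xs))"

text \<open>Suppose the search is needed and fails. Then \<phi> has rank 0 and each of its
  predicates has an argument type for which \<open>const_of\<close> found nothing. But the closed
  formula \<alpha> uses one of these predicates and has constants of all its types. The missing type
  must then be finite and occur in \<phi>, hence belong to a weight by \<open>tms_in_types\<close>,
  and \<open>const_of\<close> would have returned its zero.\<close>

lemma candidate_in:
  assumes "wa_setting_ok V" "\<phi> \<in> FOW1 V \<tau>"
    and N: "\<And>R. N = Some R \<Longrightarrow> R \<in> \<sigma> \<and> rel_ar V R = 0" "N = None \<Longrightarrow> \<forall>R\<in>\<sigma>. rel_ar V R \<noteq> 0"
    and \<alpha>: "\<alpha> \<in> fv_class V \<sigma> \<phi>" "free \<alpha> \<subseteq> set xs"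
  shows "candidate V N \<phi> xs \<in> side_class V \<sigma> \<phi> (set xs)"
proof (cases "xs = [] \<and> N = None")
  case False
  then consider "xs \<noteq> []" | R where "xs = []" "N = Some R" by auto
  then show ?thesis
  proof cases
    case 1
    then show ?thesis by (simp add: candidate_def EqV_side_class)
  next
    case 2
    then show ?thesis using N(1)
      by (auto simp: candidate_def side_class_def fv_class_def FOW1_def WA1_def algs_in_def)
  qed
next
  case True
  let ?c = "const_of V \<phi>"
  have \<phi>: "wa_fm V \<tau> \<phi>" "no_agg \<phi>" using assms(2) by (auto simp: FOW1_def WA1_def)
  show ?thesis
  proof (cases "closed_atom V ?c \<phi>")
    case (Some \<gamma>)
    then show ?thesis
      using closed_atom_sound[OF assms(1,2,2) _ _ _ Some] True by (simp add: candidate_def side_class_def)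
  next
    case None
    note none = closed_atom_None[OF \<phi> None]
    have a: "wa_fm V \<sigma> \<alpha>" "no_agg \<alpha>" "qr \<alpha> = 0" "free \<alpha> = {}" "preds_in \<alpha> \<subseteq> preds_in \<phi>"
      "tms_in V \<alpha> \<subseteq> tms_in V \<phi> \<union>
          {Const S s | S s. S \<in> algs_in V \<phi> \<and> finite (carrier (alg V S)) \<and> s \<in> carrier (alg V S)}"
      using \<alpha> none True by (auto simp: fv_class_def FOW1_def WA1_def)
    obtain P where P: "P \<in> preds_in \<alpha>" "\<forall>S\<in>set (pred_type V P). \<exists>s. Const S s \<in> tms_in V \<alpha>"
      using closed_qr0[OF assms(1) N(2) a(1-4)] True by auto
    with none a(5) obtain S where S: "S \<in> set (pred_type V P)" "?c S = SNil" by blast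
    then have no: "\<forall>s. Const S s \<notin> tms_in V \<phi>" "\<not> (S \<in> wt_type V ` weights V \<and> finite (carrier (alg V S)))"
      using const_of_cases[OF assms(1) \<phi>, of S] by auto
    with P S(1) a(6) have "S \<in> algs_in V \<phi>" "finite (carrier (alg V S))" by blast+
    then obtain u where "u \<in> tms_in V \<phi>" "tm_type V u = S" by (auto simp: algs_in_def)
    with tms_in_types(1)[OF \<phi>, of u] no \<open>finite _\<close> show ?thesis by auto
  qed
qed

lemma sat_taut [simp]: "sat V A (taut \<alpha>) \<beta>"
  by (simp add: taut_def)

lemma sat_fill [simp]: "sat V A (fill \<alpha> a) \<beta> \<longleftrightarrow> sat_opt V A a \<beta>"
  by (cases a) auto

text \<open>The three uses of \<open>holds\<close> involve different assignments with different
  default elements. They agree on the variables that matter, since \<open>xs\<close> and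
  \<open>ys\<close> have no variable in common.\<close>

theorem fv_decomposition_decomposition:
  fixes V :: "('r, 'w, 'p, 's, 'e) wa_setting"
  assumes V: "wa_setting_ok V"
    and XY: "X \<notin> \<sigma>" "Y \<notin> \<sigma>" "X \<noteq> Y" "rel_ar V X = 1" "rel_ar V Y = 1"
    and N: "\<And>R. N = Some R \<Longrightarrow> R \<in> \<sigma> \<and> rel_ar V R = 0" "N = None \<Longrightarrow> \<forall>R\<in>\<sigma>. rel_ar V R \<noteq> 0"
    and \<phi>: "distinct (xs @ ys)" "\<phi> \<in> FOW1 V (\<sigma> \<union> {X, Y})" "free \<phi> \<subseteq> set xs \<union> set ys"
    and cand: "has_fv_candidates (fv_class V \<sigma> \<phi>) xs ys"
  shows "fv_decomposition TYPE('a) V \<sigma> X Y (fv_class V \<sigma> \<phi>) \<phi> xs ys (set (decomposition V N X Y \<phi> xs ys))"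
proof -
  let ?D = "set (decomposition V N X Y \<phi> xs ys)"
  let ?cx = "candidate V N \<phi> xs" and ?cy = "candidate V N \<phi> ys"
  let ?Kx = "side_class V \<sigma> \<phi> (set xs)" and ?Ky = "side_class V \<sigma> \<phi> (set ys)"
  have cx: "?cx \<in> ?Kx" and cy: "?cy \<in> ?Ky"
    using cand candidate_in[OF V \<phi>(2) N] by (auto simp: has_fv_candidates_def)
  have taut: "taut \<alpha> \<in> side_class V \<sigma> \<phi> U" "Neg (taut \<alpha>) \<in> side_class V \<sigma> \<phi> U"
    if "\<alpha> \<in> side_class V \<sigma> \<phi> U" for \<alpha> U
    using that bool_closed_side_class[of V \<sigma> \<phi> U] by (auto simp: taut_def bool_closed_def)
  have fill: "fill \<alpha> a \<in> side_class V \<sigma> \<phi> U" if "\<alpha> \<in> side_class V \<sigma> \<phi> U" "set_option a \<subseteq> side_class V \<sigma> \<phi> U" for \<alpha> a U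
    using that taut by (cases a) auto
  have "rows_in ?Kx ?Ky (dec V X Y \<phi> xs)"
    by (rule rows_in_mono[OF dec_in[OF V \<phi>(2)]]) (use \<phi>(3) in \<open>auto simp: side_class_def\<close>)
  then have in_class: "\<alpha> \<in> ?Kx \<and> \<beta> \<in> ?Ky" if "(\<alpha>, \<beta>) \<in> ?D" for \<alpha> \<beta>
    using that fill[OF cx] fill[OF cy] taut[OF cx] taut[OF cy]
    by (auto simp: decomposition_def rows_in_def split: if_splits)
  have "holds V (disjoint_sum V X Y A B) \<phi> (xs @ ys) (as @ bs) \<longleftrightarrow>
      (\<exists>(\<alpha>, \<beta>)\<in>?D. holds V A \<alpha> xs as \<and> holds V B \<beta> ys bs)"
    if AB: "is_wstruct V \<sigma> A" "is_wstruct V \<sigma> B" "univ A \<inter> univ B = {}"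
      and as: "as \<in> tuples (univ A) (length xs)" and bs: "bs \<in> tuples (univ B) (length ys)"
    for A B :: "('a, 'r, 'w, 'e) wstruct" and as bs
  proof -
    let ?C = "disjoint_sum V X Y A B"
    let ?upd = "\<lambda>D. upd (\<lambda>_. SOME a. a \<in> univ D)"
    let ?\<beta> = "?upd ?C (xs @ ys) (as @ bs)"
    have len: "length as = length xs" "length bs = length ys" using as bs by (auto simp: tuples_def)
    have zip: "zip (xs @ ys) (as @ bs) = zip xs as @ zip ys bs" using len by simp
    have bx: "?\<beta> v = ?upd A xs as v" if "v \<in> set xs" for v
    proof -
      have "v \<notin> set ys" using that \<phi>(1) by auto
      then have "map_of (zip ys bs) v = None" using len by (simp add: map_of_zip_is_None)
      moreover have "map_of (zip xs as) v \<noteq> None" using len that by (simp add: map_of_zip_is_None)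
      ultimately show ?thesis unfolding upd_def zip map_of_append
        by (auto simp: map_add_def split: option.splits)
    qed
    have by': "?\<beta> v = ?upd B ys bs v" if "v \<in> set ys" for v
    proof -
      have "map_of (zip ys bs) v \<noteq> None" using len that by (simp add: map_of_zip_is_None)
      moreover have "map_of (zip xs as) v = None" using len that \<phi>(1) by (auto simp: map_of_zip_is_None)
      ultimately show ?thesis unfolding upd_def zip map_of_append
        by (auto simp: map_add_def split: option.splits)
    qed
    have hA: "holds V A \<alpha> xs as \<longleftrightarrow> sat V A \<alpha> ?\<beta>" if "\<alpha> \<in> ?Kx" for \<alpha>
      unfolding holds_def using side_class_mem[OF that] bx
      by (intro sat_coincidence(1)[of V \<sigma>]) auto
    have hB: "holds V B \<alpha> ys bs \<longleftrightarrow> sat V B \<alpha> ?\<beta>" if "\<alpha> \<in> ?Ky" for \<alpha>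
      unfolding holds_def using side_class_mem[OF that] by'
      by (intro sat_coincidence(1)[of V \<sigma>]) auto
    have "?\<beta> v \<in> (if v \<in> set xs then univ A else univ B)" if "v \<in> free \<phi>" for v
    proof (cases "v \<in> set xs")
      case True
      then show ?thesis using bx[OF True] upd_in[OF len(1) True] as by (auto simp: tuples_def)
    next
      case False
      then have "v \<in> set ys" using that \<phi>(3) by auto
      then show ?thesis using False by'[of v] upd_in[OF len(2), of v] bs by (auto simp: tuples_def)
    qed
    then have "holds V ?C \<phi> (xs @ ys) (as @ bs) \<longleftrightarrow> sat_rows V A B (dec V X Y \<phi> xs) ?\<beta>"
      unfolding holds_def by (rule sat_dec[OF AB XY V \<phi>(2)])
    also have "\<dots> \<longleftrightarrow> (\<exists>(\<alpha>, \<beta>)\<in>?D. sat V A \<alpha> ?\<beta> \<and> sat V B \<beta> ?\<beta>)"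
      by (auto simp: decomposition_def sat_rows_def)
    also have "\<dots> \<longleftrightarrow> (\<exists>(\<alpha>, \<beta>)\<in>?D. holds V A \<alpha> xs as \<and> holds V B \<beta> ys bs)"
      using in_class hA hB by (intro bex_cong refl) auto
    finally show ?thesis .
  qed
  moreover have "?D \<noteq> {}" by (auto simp: decomposition_def)
  moreover have "\<forall>(\<alpha>, \<beta>)\<in>?D. \<alpha> \<in> fv_class V \<sigma> \<phi> \<and> \<beta> \<in> fv_class V \<sigma> \<phi> \<and> free \<alpha> \<subseteq> set xs \<and> free \<beta> \<subseteq> set ys"
  proof clarify
    fix \<alpha> \<beta> assume "(\<alpha>, \<beta>) \<in> ?D"
    from in_class[OF this]
    show "\<alpha> \<in> fv_class V \<sigma> \<phi> \<and> \<beta> \<in> fv_class V \<sigma> \<phi> \<and> free \<alpha> \<subseteq> set xs \<and> free \<beta> \<subseteq> set ys"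
      by (simp add: side_class_def)
  qed
  ultimately show ?thesis
    unfolding fv_decomposition_def by blast
qed

section \<open>Further closure rules: parameters of loops, finite sets\<close>

lemma computable_restrict: "computable D as f \<Longrightarrow> computable {x \<in> D. P x} as f"
  by (rule computable_mono) auto

lemma computable_if':
  assumes "computable D as (\<lambda>x. sbool (P x))" "computable D as f" "computable D as g"
  shows "computable D as (\<lambda>x. if P x then f x else g x)"
  by (intro computable_if computable_restrict assms)

text \<open>Makes values computed outside a loop available in its body, where the index is extended.
  The first form fits \<open>computable_map\<close> and its relatives, the second one
  \<open>computable_foldr\<close>.\<close>

lemma computable_lift:
  assumes "computable D as f"
  shows "computable {y. fst y \<in> D \<and> Q y} (h # map (\<lambda>a y. a (fst y)) as) (\<lambda>y. f (fst y))"
    and "computable {y. fst y \<in> D \<and> Q y} (h # h' # map (\<lambda>a y. a (fst y)) as) (\<lambda>y. f (fst y))"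
proof -
  have "computable {y. fst y \<in> D \<and> Q y} (map (\<lambda>a y. a (fst y)) as) (\<lambda>y. f (fst y))"
    by (rule computable_reindex[OF assms]) auto
  then show "computable {y. fst y \<in> D \<and> Q y} (h # map (\<lambda>a y. a (fst y)) as) (\<lambda>y. f (fst y))"
    and "computable {y. fst y \<in> D \<and> Q y} (h # h' # map (\<lambda>a y. a (fst y)) as) (\<lambda>y. f (fst y))"
    by (rule computable_weaken; auto)+
qed

lemma computable_var1: "computable D (f # as) f"
  by (rule computable_var) simp

lemma computable_var2: "computable D (h # f # as) f"
  by (rule computable_var) simp

lemma computable_member_finite:
  assumes "finite K" "computable D as k"
  shows "computable D as (\<lambda>x. sbool (k x \<in> K))"
  using assms(1)
proof (induction K rule: finite_induct)
  case empty
  then show ?case by (simp add: computable_const)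
next
  case (insert c K)
  have "computable D as (\<lambda>x. if k x = c then sbool True else sbool (k x \<in> K))"
    by (intro computable_if' computable_eq computable_const assms(2) insert.IH)
  then show ?case by (rule computable_cong[rotated]) auto
qed

section \<open>Computing with variables and rows\<close>

lemma snum_eq_iff [simp]: "snum m = snum n \<longleftrightarrow> m = n"
proof (induction m arbitrary: n)
  case 0
  then show ?case by (cases n) auto
next
  case (Suc m)
  then show ?case by (cases n) auto
qed

lemma computable_snum_eq:
  fixes as :: "('x \<Rightarrow> 'u sexp) list"
  assumes "computable D as (\<lambda>x. snum (m x))" "computable D as (\<lambda>x. snum (n x))"
  shows "computable D as (\<lambda>x. sbool (m x = n x))"
  using computable_eq[OF assms] by simp

lemma computable_mem:
  assumes "computable D as (\<lambda>x. snum (v x))" "computable D as (\<lambda>x. svars (L x))"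
  shows "computable D as (\<lambda>x. sbool (v x \<in> set (L x)))"
proof -
  have "computable D as (\<lambda>x. sbool (\<not> (\<forall>u\<in>set (L x). u \<noteq> v x)))"
    using assms(2) unfolding svars_def
    by (intro computable_sbool_not computable_Ball[where e = snum] computable_snum_eq
        computable_var1 computable_lift(1)[OF assms(1)])
  moreover have "(\<not> (\<forall>u\<in>U. u \<noteq> w)) \<longleftrightarrow> w \<in> U" for U and w :: nat by blast
  ultimately show ?thesis by simp
qed

lemma computable_all_mem:
  assumes "computable D as (\<lambda>x. svars (xs x))" "computable D as (\<lambda>x. svars (L x))"
  shows "computable D as (\<lambda>x. sbool (\<forall>v\<in>set (xs x). v \<in> set (L x)))"
    and "computable D as (\<lambda>x. sbool (\<forall>v\<in>set (xs x). v \<notin> set (L x)))"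
  using assms(1) unfolding svars_def
  by (intro computable_Ball[where e = snum] computable_sbool_not computable_mem computable_var1
      computable_lift(1)[OF assms(2)]; assumption)+

lemma computable_filter_vars:
  assumes "computable D as (\<lambda>x. svars (xs x))" "computable D as (\<lambda>x. svars (L x))"
  shows "computable D as (\<lambda>x. svars (filter (\<lambda>v. v \<notin> set (xs x)) (L x)))"
  using assms(2) unfolding svars_def
  by (intro computable_filter[where e = snum] computable_sbool_not computable_mem computable_var1
      computable_lift(1)[OF assms(1)]; assumption)

lemma computable_append_vars:
  "computable D as (\<lambda>x. svars (xs x)) \<Longrightarrow> computable D as (\<lambda>x. svars (L x)) \<Longrightarrow>
    computable D as (\<lambda>x. svars (xs x @ L x))"
  unfolding svars_def by (rule computable_append)

lemma computable_vars_nonempty: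
  fixes as :: "('x \<Rightarrow> 'u sexp) list"
  assumes "computable D as (\<lambda>x. svars (xs x))"
  shows "computable D as (\<lambda>x. sbool (xs x \<noteq> []))"
proof -
  have "computable D as (\<lambda>x. sbool ((svars (xs x) :: 'u sexp) \<noteq> SNil))"
    by (intro computable_sbool_not computable_eq computable_const assms)
  moreover have "(svars ys :: 'u sexp) = SNil \<longleftrightarrow> ys = []" for ys by (cases ys) (auto simp: svars_def)
  ultimately show ?thesis by simp
qed

lemma computable_hd:
  assumes "computable D as (\<lambda>x. svars (xs x))" "\<And>x. x \<in> D \<Longrightarrow> xs x \<noteq> []"
  shows "computable D as (\<lambda>x. snum (hd (xs x)))"
proof (rule computable_cong[OF _ computable_car[OF assms(1)]])
  fix x assume "x \<in> D"
  then show "snum (hd (xs x)) = car (svars (xs x))"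
    using assms(2) by (cases "xs x") (auto simp: svars_def)
qed

text \<open>Encoded formulas are pairs, so \<open>SNil\<close> is free to stand for
  \<open>None\<close>.\<close>

fun enc_opt :: "('r, 'w, 'p, 's, 'e) fm option \<Rightarrow> ('r, 'w, 'p, 's, 'e) atom sexp" where
  "enc_opt None = SNil"
| "enc_opt (Some \<phi>) = enc \<phi>"

definition enc_row :: "('r, 'w, 'p, 's, 'e) row \<Rightarrow> ('r, 'w, 'p, 's, 'e) atom sexp" where
  "enc_row r = SCons (enc_opt (fst r)) (enc_opt (snd r))"

abbreviation enc_rows :: "('r, 'w, 'p, 's, 'e) row list \<Rightarrow> ('r, 'w, 'p, 's, 'e) atom sexp" where
  "enc_rows rs \<equiv> slist (map enc_row rs)"

lemma enc_not_SNil [simp]: "enc \<phi> \<noteq> SNil"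
  using enc_SCons(1)[of \<phi>] by auto

lemma enc_opt_SNil [simp]: "enc_opt a = SNil \<longleftrightarrow> a = None"
  by (cases a) auto

lemma computable_is_None:
  "computable D as (\<lambda>x. enc_opt (a x)) \<Longrightarrow> computable D as (\<lambda>x. sbool (a x = None))"
  using computable_eq[OF _ computable_const[of D as SNil], of "\<lambda>x. enc_opt (a x)"] by simp

lemma computable_EqV:
  "computable D as (\<lambda>x. snum (m x)) \<Longrightarrow> computable D as (\<lambda>x. snum (n x)) \<Longrightarrow>
    computable D as (\<lambda>x. enc (EqV (m x) (n x)))"
  unfolding enc.simps slist.simps by (intro computable_SCons computable_const)

lemma computable_Neg:
  "computable D as (\<lambda>x. enc (\<phi> x)) \<Longrightarrow> computable D as (\<lambda>x. enc (Neg (\<phi> x)))"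
  unfolding enc.simps slist.simps by (intro computable_SCons computable_const)

lemma computable_Or:
  "computable D as (\<lambda>x. enc (\<phi> x)) \<Longrightarrow> computable D as (\<lambda>x. enc (\<psi> x)) \<Longrightarrow>
    computable D as (\<lambda>x. enc (Or (\<phi> x) (\<psi> x)))"
  unfolding enc.simps slist.simps by (intro computable_SCons computable_const)

lemma computable_SumEq:
  "computable D as (\<lambda>x. SAtom (AElem (s x))) \<Longrightarrow> computable D as (\<lambda>x. SAtom (AWt (w x))) \<Longrightarrow>
    computable D as (\<lambda>x. svars (ys x)) \<Longrightarrow> computable D as (\<lambda>x. enc (\<phi> x)) \<Longrightarrow>
    computable D as (\<lambda>x. enc (SumEq (s x) (w x) (ys x) (\<phi> x)))"
  unfolding enc.simps slist.simps by (intro computable_SCons computable_const)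

lemma computable_row:
  "computable D as (\<lambda>x. enc_opt (a x)) \<Longrightarrow> computable D as (\<lambda>x. enc_opt (b x)) \<Longrightarrow>
    computable D as (\<lambda>x. enc_row (a x, b x))"
  unfolding enc_row_def fst_conv snd_conv by (rule computable_SCons)

lemma computable_row_fst: "computable D as (\<lambda>x. enc_row (r x)) \<Longrightarrow> computable D as (\<lambda>x. enc_opt (fst (r x)))"
  unfolding enc_row_def by (rule computable_fst)

lemma computable_row_snd: "computable D as (\<lambda>x. enc_row (r x)) \<Longrightarrow> computable D as (\<lambda>x. enc_opt (snd (r x)))"
  unfolding enc_row_def by (rule computable_snd)

lemma computable_None: "computable D as (\<lambda>x. enc_opt None)"
  by (rule computable_const)

lemma computable_Some: "computable D as (\<lambda>x. enc (\<phi> x)) \<Longrightarrow> computable D as (\<lambda>x. enc_opt (Some (\<phi> x)))"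
  by simp

lemma computable_rows_Cons:
  "computable D as (\<lambda>x. enc_row (r x)) \<Longrightarrow> computable D as (\<lambda>x. enc_rows (rs x)) \<Longrightarrow>
    computable D as (\<lambda>x. enc_rows (r x # rs x))"
  unfolding list.map slist.simps by (rule computable_SCons)

lemma computable_rows_Nil: "computable D as (\<lambda>x. enc_rows [])"
  by (rule computable_const)

lemma computable_conj_opt:
  fixes a b :: "'x \<Rightarrow> ('r, 'w, 'p, 's, 'e) fm option"
  assumes "computable D as (\<lambda>x. enc_opt (a x))" "computable D as (\<lambda>x. enc_opt (b x))"
  shows "computable D as (\<lambda>x. enc_opt (conj_opt (a x) (b x)))"
proof -
  let ?neg = "\<lambda>d :: ('r, 'w, 'p, 's, 'e) atom sexp. SCons (snum 3) (SCons d SNil)"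
  have "computable D as (\<lambda>x. if a x = None then enc_opt (b x) else if b x = None then enc_opt (a x)
      else ?neg (SCons (snum 4) (SCons (?neg (enc_opt (a x))) (SCons (?neg (enc_opt (b x))) SNil))))"
    by (intro computable_if' computable_is_None computable_SCons computable_const assms)
  moreover have "enc_opt (conj_opt a b) = (if a = None then enc_opt b else if b = None then enc_opt a
      else ?neg (SCons (snum 4) (SCons (?neg (enc_opt a)) (SCons (?neg (enc_opt b)) SNil))))"
    for a b :: "('r, 'w, 'p, 's, 'e) fm option"
    by (cases a; cases b) simp_all
  ultimately show ?thesis by simp
qed

lemma computable_neg_opt:
  fixes a :: "'x \<Rightarrow> ('r, 'w, 'p, 's, 'e) fm option"
  assumes "computable D as (\<lambda>x. enc_opt (a x))"
  shows "computable D as (\<lambda>x. enc_rows (map (\<lambda>a. (a, None)) (neg_opt (a x))))"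
    and "computable D as (\<lambda>x. enc_rows (map (\<lambda>a. (None, a)) (neg_opt (a x))))"
proof -
  let ?neg = "\<lambda>d :: ('r, 'w, 'p, 's, 'e) atom sexp. SCons (snum 3) (SCons d SNil)"
  have "computable D as (\<lambda>x. if a x = None then SNil else SCons (SCons (?neg (enc_opt (a x))) SNil) SNil)"
    by (intro computable_if' computable_is_None computable_SCons computable_const assms)
  moreover have "enc_rows (map (\<lambda>a. (a, None)) (neg_opt a)) =
      (if a = None then SNil else SCons (SCons (?neg (enc_opt a)) SNil) SNil)"
    for a :: "('r, 'w, 'p, 's, 'e) fm option"
    by (cases a) (simp_all add: enc_row_def)
  ultimately show "computable D as (\<lambda>x. enc_rows (map (\<lambda>a. (a, None)) (neg_opt (a x))))" by simp
  have "computable D as (\<lambda>x. if a x = None then SNil else SCons (SCons SNil (?neg (enc_opt (a x)))) SNil)"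
    by (intro computable_if' computable_is_None computable_SCons computable_const assms)
  moreover have "enc_rows (map (\<lambda>a. (None, a)) (neg_opt a)) =
      (if a = None then SNil else SCons (SCons SNil (?neg (enc_opt a))) SNil)"
    for a :: "('r, 'w, 'p, 's, 'e) fm option"
    by (cases a) (simp_all add: enc_row_def)
  ultimately show "computable D as (\<lambda>x. enc_rows (map (\<lambda>a. (None, a)) (neg_opt (a x))))" by simp
qed

lemma computable_conj_rows:
  assumes "computable D as (\<lambda>x. enc_rows (rs x))" "computable D as (\<lambda>x. enc_rows (qs x))"
  shows "computable D as (\<lambda>x. enc_rows (conj_rows (rs x) (qs x)))"
  unfolding conj_rows_def
  by (intro computable_concat_map[where e = enc_row, OF assms(1)]
      computable_map[where e = enc_row, OF computable_lift(1)[OF assms(2)]] computable_row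
      computable_conj_opt computable_row_fst computable_row_snd)
    (rule computable_var, simp)+

lemma computable_neg_rows:
  assumes "computable D as (\<lambda>x. enc_rows (rs x))"
  shows "computable D as (\<lambda>x. enc_rows (neg_rows (rs x)))"
  unfolding neg_rows_def
  by (intro computable_foldr[where e = enc_row and d = "\<lambda>rs. enc_rows rs", OF assms] computable_const
      computable_conj_rows computable_append[where e = enc_row] computable_neg_opt
      computable_row_fst computable_row_snd computable_var1 computable_var2)

lemma computable_swap_rows:
  assumes "computable D as (\<lambda>x. enc_rows (rs x))"
  shows "computable D as (\<lambda>x. enc_rows (swap_rows (rs x)))"
  unfolding swap_rows_def
  by (intro computable_map[where e = enc_row, OF assms] computable_row computable_row_fst
      computable_row_snd computable_var1)

lemma computable_ex_rows:
  fixes rs :: "'x \<Rightarrow> ('r, 'w, 'p, 's, 'e) row list"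
  assumes "computable D as (\<lambda>x. snum (y x))" "computable D as (\<lambda>x. enc_rows (rs x))"
  shows "computable D as (\<lambda>x. enc_rows (ex_rows (y x) (rs x)))"
proof -
  have *: "enc_opt (map_option (Ex y) a) =
      (if a = None then SNil else SCons (snum 5) (SCons (snum y) (SCons (enc_opt a) SNil)))"
    for a :: "('r, 'w, 'p, 's, 'e) fm option" and y
    by (cases a) simp_all
  show ?thesis
    unfolding ex_rows_def
    by (intro computable_map[where e = enc_row, OF assms(2)] computable_row, unfold *)
      (intro computable_if' computable_is_None computable_SCons computable_const computable_row_fst
        computable_row_snd computable_var1 computable_lift(1)[OF assms(1)])+
qed

lemma computable_plain:
  fixes a :: "'x \<Rightarrow> ('r, 'w, 'p, 's, 'e) fm option"
  assumes "computable D as (\<lambda>x. snum (y x))" "computable D as (\<lambda>x. enc_opt (a x))"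
  shows "computable D as (\<lambda>x. enc (plain (y x) (a x)))"
proof -
  have "computable D as (\<lambda>x. if a x = None then enc (EqV (y x) (y x)) else enc_opt (a x))"
    by (intro computable_if' computable_is_None computable_EqV assms)
  moreover have "enc (plain y a) = (if a = None then enc (EqV y y) else enc_opt a)"
    for a :: "('r, 'w, 'p, 's, 'e) fm option" and y
    by (cases a) simp_all
  ultimately show ?thesis by simp
qed

lemma computable_choices:
  assumes "computable D as (\<lambda>x. snum (y x))" "computable D as (\<lambda>x. enc_rows (rs x))"
  shows "computable D as (\<lambda>x. enc_rows (choices (y x) (rs x)))"
  unfolding choices_def
  by (intro computable_foldr[where e = enc_row and d = "\<lambda>rs. enc_rows rs", OF assms(2)] computable_const
      computable_conj_rows computable_rows_Cons computable_row computable_neg_opt computable_Some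
      computable_Neg computable_plain computable_lift(2)[OF assms(1)]
      computable_row_fst computable_row_snd computable_var1 computable_var2)

lemma computable_sum_rows:
  assumes "computable D as (\<lambda>x. SAtom (AElem (s x)))" "computable D as (\<lambda>x. SAtom (AWt (w x)))"
    "computable D as (\<lambda>x. svars (ys x))" "computable D as (\<lambda>x. enc_rows (rs x))"
    and "\<And>x. x \<in> D \<Longrightarrow> ys x \<noteq> []"
  shows "computable D as (\<lambda>x. enc_rows (sum_rows (s x) (w x) (ys x) (rs x)))"
proof -
  have hd: "computable D as (\<lambda>x. snum (hd (ys x)))"
    by (rule computable_hd[OF assms(3,5)])
  show ?thesis unfolding sum_rows_def
    by (intro computable_map[where e = enc_row, OF computable_choices[OF hd assms(4)]] computable_row
        computable_Some computable_SumEq computable_Neg computable_plain computable_lift(1)[OF hd]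
        assms(1-3)[THEN computable_lift(1)] computable_row_fst computable_row_snd computable_var1)
qed

definition enc_pair :: "'e \<times> 'e \<Rightarrow> ('r, 'w, 'p, 's, 'e) atom sexp" where
  "enc_pair p = SCons (SAtom (AElem (fst p))) (SAtom (AElem (snd p)))"

lemma computable_pair_fst:
  "computable D as (\<lambda>x. enc_pair (p x)) \<Longrightarrow> computable D as (\<lambda>x. SAtom (AElem (fst (p x))))"
  unfolding enc_pair_def by (rule computable_fst)

lemma computable_pair_snd:
  "computable D as (\<lambda>x. enc_pair (p x)) \<Longrightarrow> computable D as (\<lambda>x. SAtom (AElem (snd (p x))))"
  unfolding enc_pair_def by (rule computable_snd)

lemma computable_split_sum:
  assumes "computable D as (\<lambda>x. slist (map enc_pair (ps x)))" "computable D as (\<lambda>x. SAtom (AWt (w x)))"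
    "computable D as (\<lambda>x. svars (ys x))" "computable D as (\<lambda>x. enc_rows (rs x))"
    "computable D as (\<lambda>x. enc_rows (qs x))"
    and "\<And>x. x \<in> D \<Longrightarrow> ys x \<noteq> []"
  shows "computable D as (\<lambda>x. enc_rows (split_sum (ps x) (w x) (ys x) (rs x) (qs x)))"
  unfolding split_sum_def
  by (intro computable_concat_map[where e = enc_pair, OF assms(1)] computable_conj_rows
      computable_swap_rows computable_sum_rows computable_pair_fst computable_pair_snd
      assms(2-5)[THEN computable_lift(1)] computable_var1)
    (simp_all add: assms(6))

lemma computable_sided:
  assumes "computable D as (\<lambda>x. enc (\<phi> x))" "computable D as (\<lambda>x. sbool (l x))" "computable D as (\<lambda>x. sbool (r x))"
  shows "computable D as (\<lambda>x. enc_rows (sided (\<phi> x) (l x) (r x)))"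
proof -
  have *: "enc_rows (if p then [q] else []) = (if p then enc_rows [q] else enc_rows [])" for p q
    by simp
  show ?thesis unfolding sided_def
    by (intro computable_append[where e = enc_row]; unfold *)
     (intro computable_if' computable_rows_Cons computable_rows_Nil computable_row computable_Some
      computable_None assms)+
qed

text \<open>A program obtained by recursion over its own index set is thereby made usable at
  computed arguments.\<close>

lemma computable_call:
  assumes "computable E bs g" "\<And>x. x \<in> D \<Longrightarrow> k x \<in> E"
    and "\<And>b. b \<in> set bs \<Longrightarrow> computable D as (\<lambda>x. b (k x))"
  shows "computable D as (\<lambda>x. g (k x))"
proof -
  have "computable D (map (\<lambda>b x. b (k x)) bs) (\<lambda>x. g (k x))"
    by (rule computable_reindex[OF assms(1)]) (use assms(2) in auto)
  then show ?thesis by (rule computable_cut) (use assms(3) in auto)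
qed

primrec sarg :: "nat \<Rightarrow> 'u sexp \<Rightarrow> 'u sexp" where
  "sarg 0 d = car d"
| "sarg (Suc n) d = sarg n (cdr d)"

lemma computable_sarg: "computable D as f \<Longrightarrow> computable D as (\<lambda>x. sarg n (f x))"
  by (induction n arbitrary: f) (auto intro: computable_car computable_cdr)

section \<open>Computing with terms and formulas\<close>

fun tm_tag :: "('r, 'w, 'p, 's, 'e) tm \<Rightarrow> nat" where
  "tm_tag (Const S s) = 0"
| "tm_tag (Wt w xs) = 1"
| "tm_tag (Plus t u) = 2"
| "tm_tag (Minus t u) = 3"
| "tm_tag (Times t u) = 4"
| "tm_tag (Agg S p \<phi>) = 5"

fun tm_left where
  "tm_left (Plus t u) = t"
| "tm_left (Minus t u) = t"
| "tm_left (Times t u) = t"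
| "tm_left t = t"

fun tm_right where
  "tm_right (Plus t u) = u"
| "tm_right (Minus t u) = u"
| "tm_right (Times t u) = u"
| "tm_right t = t"

fun tm_vars where
  "tm_vars (Wt w xs) = xs"
| "tm_vars t = []"

lemma computable_tm_tag:
  fixes t :: "'x \<Rightarrow> ('r, 'w, 'p, 's, 'e) tm"
  assumes "computable D as (\<lambda>x. enc_tm (t x))"
  shows "computable D as (\<lambda>x. sbool (tm_tag (t x) = n))"
proof -
  have "computable D as (\<lambda>x. sbool (sarg 0 (enc_tm (t x)) = snum n))"
    by (intro computable_eq computable_sarg computable_const assms)
  moreover have "sarg 0 (enc_tm u) = snum (tm_tag u)" for u :: "('r, 'w, 'p, 's, 'e) tm"
    by (cases u) auto
  ultimately show ?thesis by simp
qed

lemma computable_tm_parts: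
  fixes t :: "'x \<Rightarrow> ('r, 'w, 'p, 's, 'e) tm"
  assumes "computable D as (\<lambda>x. enc_tm (t x))" "\<And>x. x \<in> D \<Longrightarrow> no_agg_tm (t x)"
  shows "computable {x \<in> D. \<not> (tm_tag (t x) = 0 \<or> tm_tag (t x) = 1)} as (\<lambda>x. enc_tm (tm_left (t x)))"
    and "computable {x \<in> D. \<not> (tm_tag (t x) = 0 \<or> tm_tag (t x) = 1)} as (\<lambda>x. enc_tm (tm_right (t x)))"
    and "computable D as (\<lambda>x. svars (tm_vars (t x)))"
proof -
  have sarg: "computable D as (\<lambda>x. sarg n (enc_tm (t x)))" for n
    by (intro computable_sarg assms)
  have *: "enc_tm (tm_left u) = sarg 1 (enc_tm u) \<and> enc_tm (tm_right u) = sarg 2 (enc_tm u)"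
    if "no_agg_tm u" "\<not> (tm_tag u = 0 \<or> tm_tag u = 1)" for u :: "('r, 'w, 'p, 's, 'e) tm"
    using that by (cases u) (auto simp: eval_nat_numeral)
  show "computable {x \<in> D. \<not> (tm_tag (t x) = 0 \<or> tm_tag (t x) = 1)} as (\<lambda>x. enc_tm (tm_left (t x)))"
    by (rule computable_cong[OF _ computable_restrict[OF sarg[of 1]]]) (use * assms(2) in auto)
  show "computable {x \<in> D. \<not> (tm_tag (t x) = 0 \<or> tm_tag (t x) = 1)} as (\<lambda>x. enc_tm (tm_right (t x)))"
    by (rule computable_cong[OF _ computable_restrict[OF sarg[of 2]]]) (use * assms(2) in auto)
  have "computable D as (\<lambda>x. if tm_tag (t x) = 1 then sarg 2 (enc_tm (t x)) else SNil)"
    by (intro computable_if' computable_tm_tag computable_const sarg assms(1))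
  moreover have "svars (tm_vars u) = (if tm_tag u = 1 then sarg 2 (enc_tm u) else SNil)"
    for u :: "('r, 'w, 'p, 's, 'e) tm"
    by (cases u) (auto simp: eval_nat_numeral svars_def)
  ultimately show "computable D as (\<lambda>x. svars (tm_vars (t x)))" by simp
qed

lemma computable_sbool_disj:
  assumes "computable D as (\<lambda>x. sbool (P x))" "computable D as (\<lambda>x. sbool (Q x))"
  shows "computable D as (\<lambda>x. sbool (P x \<or> Q x))"
proof (rule computable_cong)
  show "computable D as (\<lambda>x. if P x then sbool True else sbool (Q x))"
    by (intro computable_if' computable_const assms)
qed auto

text \<open>The inclusion is decided along the term without collecting its variables: a leaf lists
  them, and otherwise both operands have to pass.\<close>

lemma computable_free_tm:
  fixes t :: "'x \<Rightarrow> ('r, 'w, 'p, 's, 'e) tm"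
  assumes "computable D as (\<lambda>x. enc_tm (t x))" "computable D as (\<lambda>x. svars (L x))"
    and "\<And>x. x \<in> D \<Longrightarrow> no_agg_tm (t x)"
  shows "computable D as (\<lambda>x. sbool (free_tm (t x) \<subseteq> set (L x)))"
proof -
  let ?E = "{x :: ('r, 'w, 'p, 's, 'e) tm \<times> nat list. no_agg_tm (fst x)}"
  let ?c = "\<lambda>x :: ('r, 'w, 'p, 's, 'e) tm \<times> nat list. tm_tag (fst x) = 0 \<or> tm_tag (fst x) = 1"
  let ?bs = "[\<lambda>x. enc_tm (fst x), \<lambda>x. svars (snd x)]"
  let ?f = "\<lambda>x :: ('r, 'w, 'p, 's, 'e) tm \<times> nat list. sbool (free_tm (fst x) \<subseteq> set (snd x))"
  have t: "computable E (?bs) (\<lambda>x. enc_tm (fst x))" for E by (rule computable_var) simp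
  have L: "computable E (?bs) (\<lambda>x. svars (snd x))" for E by (rule computable_var) simp
  have "computable ?E ?bs ?f"
  proof (rule computable_rec[where c = ?c and k = "\<lambda>x. (tm_left (fst x), snd x)" and
        k' = "\<lambda>x. (tm_right (fst x), snd x)" and m = "\<lambda>x. size (fst x)"])
    show "computable ?E ?bs (\<lambda>x. sbool (?c x))"
      by (intro computable_sbool_disj computable_tm_tag t)
    have "free_tm u \<subseteq> set M \<longleftrightarrow> (\<forall>v\<in>set (tm_vars u). v \<in> set M)" if "tm_tag u = 0 \<or> tm_tag u = 1"
      for u :: "('r, 'w, 'p, 's, 'e) tm" and M
      using that by (cases u) auto
    then show "computable {x \<in> ?E. ?c x} ?bs ?f"
      by (intro computable_cong[OF _ computable_all_mem(1)[OF computable_tm_parts(3)[OF t] L]]) auto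
    show "(tm_left (fst x), snd x) \<in> ?E \<and> (tm_right (fst x), snd x) \<in> ?E \<and>
        size (fst (tm_left (fst x), snd x)) < size (fst x) \<and> size (fst (tm_right (fst x), snd x)) < size (fst x)"
      if "x \<in> ?E" "\<not> ?c x" for x
      using that by (cases "fst x") auto
    show "computable {x \<in> ?E. \<not> ?c x} ?bs (\<lambda>x. a (tm_left (fst x), snd x))" if "a \<in> set ?bs" for a
      using that computable_tm_parts(1)[OF t[of ?E]] L by auto
    show "computable {x \<in> ?E. \<not> ?c x} ?bs (\<lambda>x. a (tm_right (fst x), snd x))" if "a \<in> set ?bs" for a
      using that computable_tm_parts(2)[OF t[of ?E]] L by auto
    show "computable {x \<in> ?E. \<not> ?c x}
      ((\<lambda>x. ?f (tm_left (fst x), snd x)) # (\<lambda>x. ?f (tm_right (fst x), snd x)) # ?bs) ?f"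
    proof (rule computable_cong)
      show "computable {x \<in> ?E. \<not> ?c x}
        ((\<lambda>x. ?f (tm_left (fst x), snd x)) # (\<lambda>x. ?f (tm_right (fst x), snd x)) # ?bs)
        (\<lambda>x. sbool (free_tm (tm_left (fst x)) \<subseteq> set (snd x) \<and> free_tm (tm_right (fst x)) \<subseteq> set (snd x)))"
        by (intro computable_sbool_conj computable_var) simp_all
      show "?f x = sbool (free_tm (tm_left (fst x)) \<subseteq> set (snd x) \<and> free_tm (tm_right (fst x)) \<subseteq> set (snd x))"
        if "x \<in> {x \<in> ?E. \<not> ?c x}" for x
        using that by (cases "fst x") auto
    qed
  qed
  moreover have "computable D as (\<lambda>x. b (t x, L x))" if "b \<in> set ?bs" for b
    using that assms(1,2) by auto
  ultimately show ?thesis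
    using computable_call[of ?E ?bs ?f D "\<lambda>x. (t x, L x)" as] assms(3) by simp
qed

text \<open>As there are finitely many weight symbols, any function of them is a table.\<close>

lemma computable_weight_map:
  assumes "finite (weights V)" "computable D as (\<lambda>x. SAtom (AWt (w x)))" "\<And>x. x \<in> D \<Longrightarrow> w x \<in> weights V"
  shows "computable D as (\<lambda>x. h (w x))"
  using computable_finite_map[OF _ assms(2), of "(\<lambda>w. SAtom (AWt w)) ` weights V"
      "\<lambda>d. case d of SAtom (AWt w) \<Rightarrow> h w | _ \<Rightarrow> SNil"] assms(1,3)
  by simp

text \<open>The recursion follows left operands only, so both calls are \<open>tm_left\<close>. At a
  leaf the type is part of the constant or is looked up for the weight symbol.\<close>

lemma computable_tm_type:
  fixes t :: "'x \<Rightarrow> ('r, 'w, 'p, 's, 'e) tm"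
  assumes "finite (weights V)" "computable D as (\<lambda>x. enc_tm (t x))"
    and "\<And>x. x \<in> D \<Longrightarrow> no_agg_tm (t x) \<and> wa_tm V \<sigma> (t x)"
  shows "computable D as (\<lambda>x. SAtom (AAlg (tm_type V (t x))))"
proof -
  let ?E = "{t :: ('r, 'w, 'p, 's, 'e) tm. no_agg_tm t \<and> wa_tm V \<sigma> t}"
  let ?c = "\<lambda>t :: ('r, 'w, 'p, 's, 'e) tm. tm_tag t = 0 \<or> tm_tag t = 1"
  let ?bs = "[enc_tm]"
  let ?f = "\<lambda>t :: ('r, 'w, 'p, 's, 'e) tm. SAtom (AAlg (tm_type V t))"
  have t: "computable E ?bs enc_tm" for E by (rule computable_var) simp
  have "computable ?E ?bs ?f"
  proof (rule computable_rec[where c = ?c and k = tm_left and k' = tm_left and m = size])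
    show "computable ?E ?bs (\<lambda>x. sbool (?c x))"
      by (intro computable_sbool_disj computable_tm_tag t)
    show "computable {x \<in> ?E. ?c x} ?bs ?f"
    proof (rule computable_cases[where P = "\<lambda>x. tm_tag x = 0"])
      show "computable {x \<in> ?E. ?c x} ?bs (\<lambda>x. sbool (tm_tag x = 0))"
        by (intro computable_tm_tag t)
      show "computable {x \<in> {x \<in> ?E. ?c x}. tm_tag x = 0} ?bs ?f"
      proof (rule computable_cong[OF _ computable_sarg[OF t, of _ 1]])
        show "?f x = sarg 1 (enc_tm x)" if "x \<in> {x \<in> {x \<in> ?E. ?c x}. tm_tag x = 0}" for x
          using that by (cases x) auto
      qed
      let ?w = "\<lambda>t :: ('r, 'w, 'p, 's, 'e) tm. case t of Wt w xs \<Rightarrow> w"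
      let ?D1 = "{x \<in> {x \<in> ?E. ?c x}. tm_tag x \<noteq> 0}"
      have "computable ?D1 ?bs (\<lambda>x. SAtom (AWt (?w x)))"
      proof (rule computable_cong[OF _ computable_sarg[OF t, of _ 1]])
        show "SAtom (AWt (?w x)) = sarg 1 (enc_tm x)" if "x \<in> ?D1" for x
          using that by (cases x) auto
      qed
      moreover have w: "?w x \<in> weights V \<and> tm_type V x = wt_type V (?w x)" if "x \<in> ?D1" for x
        using that by (cases x) auto
      ultimately have "computable ?D1 ?bs (\<lambda>x. SAtom (AAlg (wt_type V (?w x))))"
        using computable_weight_map[OF assms(1), of ?D1 ?bs ?w "\<lambda>w. SAtom (AAlg (wt_type V w))"] by blast
      then show "computable ?D1 ?bs ?f"
        by (rule computable_cong[rotated]) (use w in auto)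
    qed
    show "tm_left x \<in> ?E \<and> tm_left x \<in> ?E \<and> size (tm_left x) < size x \<and> size (tm_left x) < size x"
      if "x \<in> ?E" "\<not> ?c x" for x
      using that by (cases x) auto
    show "computable {x \<in> ?E. \<not> ?c x} ?bs (\<lambda>x. a (tm_left x))" if "a \<in> set ?bs" for a
      using that computable_tm_parts(1)[OF t[of ?E]] by auto
    then show "computable {x \<in> ?E. \<not> ?c x} ?bs (\<lambda>x. a (tm_left x))" if "a \<in> set ?bs" for a
      using that by blast
    show "computable {x \<in> ?E. \<not> ?c x} ((\<lambda>x. ?f (tm_left x)) # (\<lambda>x. ?f (tm_left x)) # ?bs) ?f"
    proof (rule computable_cong[OF _ computable_var1])
      show "?f x = ?f (tm_left x)" if "x \<in> {x \<in> ?E. \<not> ?c x}" for x using that by (cases x) auto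
    qed
  qed
  from computable_call[OF this, of D t as] assms show ?thesis by auto
qed

fun tag :: "('r, 'w, 'p, 's, 'e) fm \<Rightarrow> nat" where
  "tag (EqV x y) = 0"
| "tag (Rel R xs) = 1"
| "tag (WtEq s w xs) = 2"
| "tag (Neg \<phi>) = 3"
| "tag (Or \<phi> \<psi>) = 4"
| "tag (Ex y \<phi>) = 5"
| "tag (SumEq s w ys \<phi>) = 6"
| "tag (Pred P ts) = 7"

fun left_sub where
  "left_sub (Neg \<phi>) = \<phi>"
| "left_sub (Or \<phi> \<psi>) = \<phi>"
| "left_sub (Ex y \<phi>) = \<phi>"
| "left_sub (SumEq s w ys \<phi>) = \<phi>"
| "left_sub \<phi> = \<phi>"

fun right_sub where
  "right_sub (Or \<phi> \<psi>) = \<psi>"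
| "right_sub \<phi> = left_sub \<phi>"

fun fm_vars where
  "fm_vars (EqV x y) = [x, y]"
| "fm_vars (Rel R xs) = xs"
| "fm_vars (WtEq s w xs) = xs"
| "fm_vars (Ex y \<phi>) = [y]"
| "fm_vars (SumEq s w ys \<phi>) = ys"
| "fm_vars \<phi> = []"

fun fm_elem where
  "fm_elem (WtEq s w xs) = s"
| "fm_elem (SumEq s w ys \<phi>) = s"

fun fm_weight where
  "fm_weight (WtEq s w xs) = w"
| "fm_weight (SumEq s w ys \<phi>) = w"

fun fm_args where
  "fm_args (Pred P ts) = ts"
| "fm_args \<phi> = []"

text \<open>Empty unless there is a binder, so that together with \<open>left_sub\<close> and
  \<open>right_sub\<close> the recursive calls of \<open>dec\<close> have one shape for all compound
  formulas.\<close>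

definition bound_vars where
  "bound_vars \<phi> = (if tag \<phi> = 5 \<or> tag \<phi> = 6 then fm_vars \<phi> else [])"

abbreviation atomic :: "('r, 'w, 'p, 's, 'e) fm \<Rightarrow> bool" where
  "atomic \<phi> \<equiv> tag \<phi> = 0 \<or> tag \<phi> = 1 \<or> tag \<phi> = 2 \<or> tag \<phi> = 7"

lemma computable_tag:
  fixes \<phi> :: "'x \<Rightarrow> ('r, 'w, 'p, 's, 'e) fm"
  assumes "computable D as (\<lambda>x. enc (\<phi> x))"
  shows "computable D as (\<lambda>x. sbool (tag (\<phi> x) = n))"
proof -
  have "computable D as (\<lambda>x. sbool (sarg 0 (enc (\<phi> x)) = snum n))"
    by (intro computable_eq computable_sarg computable_const assms)
  moreover have "sarg 0 (enc \<psi>) = snum (tag \<psi>)" for \<psi> :: "('r, 'w, 'p, 's, 'e) fm"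
    by (cases \<psi>) auto
  ultimately show ?thesis by simp
qed

lemma computable_fm_parts:
  fixes \<phi> :: "'x \<Rightarrow> ('r, 'w, 'p, 's, 'e) fm"
  assumes "computable D as (\<lambda>x. enc (\<phi> x))"
  shows computable_left_sub: "(\<And>x. x \<in> D \<Longrightarrow> \<not> atomic (\<phi> x)) \<Longrightarrow> computable D as (\<lambda>x. enc (left_sub (\<phi> x)))"
    and computable_right_sub: "(\<And>x. x \<in> D \<Longrightarrow> \<not> atomic (\<phi> x)) \<Longrightarrow> computable D as (\<lambda>x. enc (right_sub (\<phi> x)))"
    and computable_fm_vars: "computable D as (\<lambda>x. svars (fm_vars (\<phi> x)))"
    and computable_bound_vars: "computable D as (\<lambda>x. svars (bound_vars (\<phi> x)))"
    and computable_fm_elem: "(\<And>x. x \<in> D \<Longrightarrow> tag (\<phi> x) = 2 \<or> tag (\<phi> x) = 6) \<Longrightarrow>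
      computable D as (\<lambda>x. SAtom (AElem (fm_elem (\<phi> x))))"
    and computable_fm_weight: "(\<And>x. x \<in> D \<Longrightarrow> tag (\<phi> x) = 2 \<or> tag (\<phi> x) = 6) \<Longrightarrow>
      computable D as (\<lambda>x. SAtom (AWt (fm_weight (\<phi> x))))"
    and computable_fm_args: "computable D as (\<lambda>x. slist (map enc_tm (fm_args (\<phi> x))))"
proof -
  have sarg: "computable D as (\<lambda>x. sarg n (enc (\<phi> x)))" for n
    by (intro computable_sarg assms)
  note tag = computable_tag[OF assms]
  show "computable D as (\<lambda>x. enc (left_sub (\<phi> x)))" if "\<And>x. x \<in> D \<Longrightarrow> \<not> atomic (\<phi> x)"
  proof (rule computable_cong)
    show "computable D as (\<lambda>x. if tag (\<phi> x) = 5 then sarg 2 (enc (\<phi> x))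
      else if tag (\<phi> x) = 6 then sarg 4 (enc (\<phi> x)) else sarg 1 (enc (\<phi> x)))"
      by (intro computable_if' tag sarg)
    show "enc (left_sub (\<phi> x)) = (if tag (\<phi> x) = 5 then sarg 2 (enc (\<phi> x))
      else if tag (\<phi> x) = 6 then sarg 4 (enc (\<phi> x)) else sarg 1 (enc (\<phi> x)))" if "x \<in> D" for x
      using \<open>\<And>x. x \<in> D \<Longrightarrow> \<not> atomic (\<phi> x)\<close>[OF that] by (cases "\<phi> x") (auto simp: eval_nat_numeral)
  qed
  show "computable D as (\<lambda>x. enc (right_sub (\<phi> x)))" if "\<And>x. x \<in> D \<Longrightarrow> \<not> atomic (\<phi> x)"
  proof (rule computable_cong)
    show "computable D as (\<lambda>x. if tag (\<phi> x) = 3 then sarg 1 (enc (\<phi> x))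
      else if tag (\<phi> x) = 6 then sarg 4 (enc (\<phi> x)) else sarg 2 (enc (\<phi> x)))"
      by (intro computable_if' tag sarg)
    show "enc (right_sub (\<phi> x)) = (if tag (\<phi> x) = 3 then sarg 1 (enc (\<phi> x))
      else if tag (\<phi> x) = 6 then sarg 4 (enc (\<phi> x)) else sarg 2 (enc (\<phi> x)))" if "x \<in> D" for x
      using \<open>\<And>x. x \<in> D \<Longrightarrow> \<not> atomic (\<phi> x)\<close>[OF that] by (cases "\<phi> x") (auto simp: eval_nat_numeral)
  qed
  show vars: "computable D as (\<lambda>x. svars (fm_vars (\<phi> x)))"
  proof (rule computable_cong)
    show "computable D as (\<lambda>x. if tag (\<phi> x) = 0 then SCons (sarg 1 (enc (\<phi> x))) (SCons (sarg 2 (enc (\<phi> x))) SNil)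
      else if tag (\<phi> x) = 1 then sarg 2 (enc (\<phi> x)) else if tag (\<phi> x) = 2 \<or> tag (\<phi> x) = 6 then sarg 3 (enc (\<phi> x))
      else if tag (\<phi> x) = 5 then SCons (sarg 1 (enc (\<phi> x))) SNil else SNil)"
      by (intro computable_if' computable_sbool_disj tag sarg computable_SCons computable_const)
    show "svars (fm_vars (\<phi> x)) = (if tag (\<phi> x) = 0 then SCons (sarg 1 (enc (\<phi> x))) (SCons (sarg 2 (enc (\<phi> x))) SNil)
      else if tag (\<phi> x) = 1 then sarg 2 (enc (\<phi> x)) else if tag (\<phi> x) = 2 \<or> tag (\<phi> x) = 6 then sarg 3 (enc (\<phi> x))
      else if tag (\<phi> x) = 5 then SCons (sarg 1 (enc (\<phi> x))) SNil else SNil)" for x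
      by (cases "\<phi> x") (auto simp: eval_nat_numeral svars_def)
  qed
  show "computable D as (\<lambda>x. svars (bound_vars (\<phi> x)))"
  proof (rule computable_cong)
    show "computable D as (\<lambda>x. if tag (\<phi> x) = 5 \<or> tag (\<phi> x) = 6 then svars (fm_vars (\<phi> x)) else SNil)"
      by (intro computable_if' computable_sbool_disj tag vars computable_const)
  qed (auto simp: bound_vars_def svars_def)
  show "computable D as (\<lambda>x. SAtom (AElem (fm_elem (\<phi> x))))" if *: "\<And>x. x \<in> D \<Longrightarrow> tag (\<phi> x) = 2 \<or> tag (\<phi> x) = 6"
  proof (rule computable_cong[OF _ sarg[of 1]])
    show "SAtom (AElem (fm_elem (\<phi> x))) = sarg 1 (enc (\<phi> x))" if "x \<in> D" for x
      using *[OF that] by (cases "\<phi> x") auto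
  qed
  show "computable D as (\<lambda>x. SAtom (AWt (fm_weight (\<phi> x))))" if *: "\<And>x. x \<in> D \<Longrightarrow> tag (\<phi> x) = 2 \<or> tag (\<phi> x) = 6"
  proof (rule computable_cong[OF _ sarg[of 2]])
    show "SAtom (AWt (fm_weight (\<phi> x))) = sarg 2 (enc (\<phi> x))" if "x \<in> D" for x
      using *[OF that] by (cases "\<phi> x") (auto simp: eval_nat_numeral)
  qed
  show "computable D as (\<lambda>x. slist (map enc_tm (fm_args (\<phi> x))))"
  proof (rule computable_cong)
    show "computable D as (\<lambda>x. if tag (\<phi> x) = 7 then sarg 2 (enc (\<phi> x)) else SNil)"
      by (intro computable_if' tag sarg computable_const)
    show "slist (map enc_tm (fm_args (\<phi> x))) = (if tag (\<phi> x) = 7 then sarg 2 (enc (\<phi> x)) else SNil)" for x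
      by (cases "\<phi> x") (auto simp: eval_nat_numeral)
  qed
qed

text \<open>The keys of the table are pairs of a weight symbol of finite type and an element of this
  type. They are finitely many even if there are infinitely many rings or groups.\<close>

lemma computable_addends:
  fixes as :: "('x \<Rightarrow> ('r, 'w, 'p, 's, 'e) atom sexp) list"
  assumes "wa_setting_ok V"
    and "computable D as (\<lambda>x. SAtom (AWt (w x)))" "computable D as (\<lambda>x. SAtom (AElem (s x)))"
    and "\<And>x. x \<in> D \<Longrightarrow> w x \<in> weights V \<and> finite (carrier (alg V (wt_type V (w x)))) \<and>
      s x \<in> carrier (alg V (wt_type V (w x)))"
  shows "computable D as (\<lambda>x. slist (map enc_pair (addends V (w x) (s x))))"
proof -
  let ?W = "{w \<in> weights V. finite (carrier (alg V (wt_type V w)))}"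
  let ?K = "\<Union>w\<in>?W. (\<lambda>s. SCons (SAtom (AWt w)) (SAtom (AElem s)) :: ('r, 'w, 'p, 's, 'e) atom sexp) ` carrier (alg V (wt_type V w))"
  let ?f = "\<lambda>d. case d of SCons (SAtom (AWt w)) (SAtom (AElem s)) \<Rightarrow> slist (map enc_pair (addends V w s)) | _ \<Rightarrow> SNil"
  have "finite ?K" using assms(1) by (auto simp: wa_setting_ok_def)
  moreover have "computable D as (\<lambda>x. SCons (SAtom (AWt (w x))) (SAtom (AElem (s x))))"
    by (intro computable_SCons assms)
  moreover have "(SCons (SAtom (AWt (w x))) (SAtom (AElem (s x))) :: ('r, 'w, 'p, 's, 'e) atom sexp) \<in> ?K" if "x \<in> D" for x
    using assms(4)[OF that] by auto
  ultimately show ?thesis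
    using computable_finite_map[of ?K D as "\<lambda>x. SCons (SAtom (AWt (w x))) (SAtom (AElem (s x)))" ?f] by simp
qed

text \<open>The arguments of the recursive calls are \<open>?k\<close> and \<open>?k'\<close> in
  every compound case. For a negation the two coincide, and the result of the first is used.\<close>

lemma computable_dec:
  fixes V :: "('r, 'w, 'p, 's, 'e) wa_setting"
  assumes V: "wa_setting_ok V"
  shows "computable {x. fst x \<in> FOW1 V \<tau>} [\<lambda>x. enc (fst x), \<lambda>x. svars (snd x)]
    (\<lambda>x. enc_rows (dec V X Y (fst x) (snd x)))"
proof -
  let ?D = "{x. fst x \<in> FOW1 V \<tau>}"
  let ?as = "[\<lambda>x. enc (fst x), \<lambda>x. svars (snd x)]"
  let ?f = "\<lambda>x. enc_rows (dec V X Y (fst x) (snd x))"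
  let ?c = "\<lambda>x. atomic (fst x)"
  let ?k = "\<lambda>x. (left_sub (fst x), bound_vars (fst x) @ snd x)"
  let ?k' = "\<lambda>x. (right_sub (fst x), filter (\<lambda>v. v \<notin> set (bound_vars (fst x))) (snd x))"
  have fin: "finite (weights V)" using V by (auto simp: wa_setting_ok_def)
  have e: "computable E ?as (\<lambda>x. enc (fst x))" for E by (rule computable_var) simp
  have L: "computable E ?as (\<lambda>x. svars (snd x))" for E by (rule computable_var) simp
  show ?thesis
  proof (rule computable_rec[where c = ?c and k = ?k and k' = ?k' and m = "\<lambda>x. size (fst x)"])
    show "computable ?D ?as (\<lambda>x. sbool (?c x))"
      by (intro computable_sbool_disj computable_tag e)
    show "?k x \<in> ?D \<and> ?k' x \<in> ?D \<and> size (fst (?k x)) < size (fst x) \<and> size (fst (?k' x)) < size (fst x)"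
      if "x \<in> ?D" "\<not> ?c x" for x
      using that by (cases "fst x") (auto simp: FOW1_def WA1_def)
    show "computable {x \<in> ?D. \<not> ?c x} ?as (\<lambda>x. a (?k x))" if "a \<in> set ?as" for a
      using that computable_left_sub[OF e, of "{x \<in> ?D. \<not> ?c x}"]
        computable_append_vars[OF computable_bound_vars[OF e] L, of "{x \<in> ?D. \<not> ?c x}"] by auto
    show "computable {x \<in> ?D. \<not> ?c x} ?as (\<lambda>x. a (?k' x))" if "a \<in> set ?as" for a
      using that computable_right_sub[OF e, of "{x \<in> ?D. \<not> ?c x}"]
        computable_filter_vars[OF computable_bound_vars[OF e] L, of "{x \<in> ?D. \<not> ?c x}"] by auto
    let ?l = "\<lambda>x. \<forall>v\<in>set (fm_vars (fst x)). v \<in> set (snd x)"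
    let ?r = "\<lambda>x. \<forall>v\<in>set (fm_vars (fst x)). v \<notin> set (snd x)"
    let ?t = "\<lambda>x. enc_rows [(None, None)] :: ('r, 'w, 'p, 's, 'e) atom sexp"
    let ?n = "\<lambda>x. enc_rows [] :: ('r, 'w, 'p, 's, 'e) atom sexp"
    let ?s = "\<lambda>x. enc_rows (sided (fst x) (?l x) (?r x))"
    have l: "computable E ?as (\<lambda>x. sbool (?l x))" and r: "computable E ?as (\<lambda>x. sbool (?r x))" for E
      by (rule computable_all_mem[OF computable_fm_vars[OF e] L])+
    have s: "computable E ?as ?s" for E by (intro computable_sided e l r)
    show "computable {x \<in> ?D. ?c x} ?as ?f"
    proof (rule computable_cases[where P = "\<lambda>x. tag (fst x) = 7"])
      let ?E = "{x \<in> {x \<in> ?D. ?c x}. tag (fst x) = 7}"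
      let ?p = "\<lambda>x. \<forall>t\<in>set (fm_args (fst x)). free_tm t \<subseteq> set (snd x)"
      have "computable ?E ?as (\<lambda>x. sbool (?p x))"
      proof (rule computable_Ball[where e = enc_tm, OF computable_fm_args[OF e]],
          rule computable_free_tm[OF computable_var1 computable_lift(1)[OF L]])
        fix y assume "y \<in> {y. fst y \<in> ?E \<and> snd y \<in> set (fm_args (fst (fst y)))}"
        then show "no_agg_tm (snd y)" by (cases "fst (fst y)") (auto simp: FOW1_def WA1_def)
      qed
      then have "computable ?E ?as (\<lambda>x. enc_rows (sided (fst x) (?p x) (\<not> ?p x)))"
        by (intro computable_sided computable_sbool_not e)
      then show "computable ?E ?as ?f"
      proof (rule computable_cong[rotated])
        show "?f x = enc_rows (sided (fst x) (?p x) (\<not> ?p x))" if "x \<in> ?E" for x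
          using that by (cases "fst x") auto
      qed
    next
      let ?E = "{x \<in> {x \<in> ?D. ?c x}. tag (fst x) \<noteq> 7}"
      show "computable ?E ?as ?f"
      proof (rule computable_cases[where P = "\<lambda>x. tag (fst x) = 2"])
        let ?E2 = "{x \<in> ?E. tag (fst x) = 2}"
        let ?w = "\<lambda>x. fm_weight (fst x)"
        have "computable ?E2 ?as (\<lambda>x. SAtom (AWt (?w x)))"
          by (rule computable_fm_weight[OF e]) simp
        then have "computable ?E2 ?as (\<lambda>x. SAtom (AElem \<zero>\<^bsub>alg V (wt_type V (?w x))\<^esub>))"
        proof (rule computable_weight_map[OF fin])
          show "?w x \<in> weights V" if "x \<in> ?E2" for x
            using that by (cases "fst x") (auto simp: FOW1_def WA1_def)
        qed
        then have "computable ?E2 ?as (\<lambda>x. sbool (SAtom (AElem (fm_elem (fst x))) =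
            (SAtom (AElem \<zero>\<^bsub>alg V (wt_type V (?w x))\<^esub>) :: ('r, 'w, 'p, 's, 'e) atom sexp)))"
          by (intro computable_eq computable_fm_elem e) simp
        then have "computable ?E2 ?as (\<lambda>x. if ?l x then enc_rows [(Some (fst x), None)]
            else if ?r x then enc_rows [(None, Some (fst x))]
            else if SAtom (AElem (fm_elem (fst x))) =
              (SAtom (AElem \<zero>\<^bsub>alg V (wt_type V (?w x))\<^esub>) :: ('r, 'w, 'p, 's, 'e) atom sexp) then ?t x else ?n x)"
          by (intro computable_if' l r computable_rows_Cons computable_rows_Nil computable_row
              computable_Some computable_None e)
        then show "computable ?E2 ?as ?f"
        proof (rule computable_cong[rotated])
          show "?f x = (if ?l x then enc_rows [(Some (fst x), None)]
            else if ?r x then enc_rows [(None, Some (fst x))]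
            else if SAtom (AElem (fm_elem (fst x))) =
              (SAtom (AElem \<zero>\<^bsub>alg V (wt_type V (?w x))\<^esub>) :: ('r, 'w, 'p, 's, 'e) atom sexp) then ?t x else ?n x)"
            if "x \<in> ?E2" for x
            using that by (cases "fst x") auto
        qed
      next
        let ?E3 = "{x \<in> ?E. tag (fst x) \<noteq> 2}"
        let ?rel = "\<lambda>R x. tag (fst x) = 1 \<and> sarg 1 (enc (fst x)) = SAtom (ARel R)"
        have "computable ?E3 ?as (\<lambda>x. sbool (?rel R x))" for R
          by (intro computable_sbool_conj computable_restrict computable_tag computable_eq computable_sarg
              computable_const e)
        then have "computable ?E3 ?as (\<lambda>x. if ?rel X x then if ?l x then ?t x else ?n x
            else if ?rel Y x then if ?r x then ?t x else ?n x else ?s x)"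
          by (intro computable_if' l r s computable_const)
        then show "computable ?E3 ?as ?f"
        proof (rule computable_cong[rotated])
          show "?f x = (if ?rel X x then if ?l x then ?t x else ?n x
            else if ?rel Y x then if ?r x then ?t x else ?n x else ?s x)" if "x \<in> ?E3" for x
            using that by (cases "fst x") auto
        qed
      qed (intro computable_tag e)
    qed (intro computable_tag e)
    let ?E = "{x \<in> ?D. \<not> ?c x}"
    let ?bs = "(\<lambda>x. ?f (?k x)) # (\<lambda>x. ?f (?k' x)) # ?as"
    have e': "computable E ?bs (\<lambda>x. enc (fst x))" for E by (rule computable_var) simp
    let ?rs = "\<lambda>x. dec V X Y (left_sub (fst x)) (bound_vars (fst x) @ snd x)"
    let ?qs = "\<lambda>x. dec V X Y (right_sub (fst x)) (filter (\<lambda>v. v \<notin> set (bound_vars (fst x))) (snd x))"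
    have rs: "computable E ?bs (\<lambda>x. enc_rows (?rs x))" for E by (rule computable_var) simp
    have qs: "computable E ?bs (\<lambda>x. enc_rows (?qs x))" for E by (rule computable_var) simp
    have vars: "computable E ?bs (\<lambda>x. svars (fm_vars (fst x)))" for E by (rule computable_fm_vars[OF e'])
    show "computable ?E ?bs ?f"
    proof (rule computable_cases[where P = "\<lambda>x. tag (fst x) = 6"])
      let ?E6 = "{x \<in> ?E. tag (fst x) = 6}"
      have ok: "fm_weight (fst x) \<in> weights V \<and> finite (carrier (alg V (wt_type V (fm_weight (fst x))))) \<and>
          fm_elem (fst x) \<in> carrier (alg V (wt_type V (fm_weight (fst x)))) \<and> fm_vars (fst x) \<noteq> []"
        if "x \<in> ?E6" for x
        using that V by (cases "fst x") (auto simp: FOW1_def WA1_def wa_setting_ok_def)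
      have w: "computable ?E6 ?bs (\<lambda>x. SAtom (AWt (fm_weight (fst x))))"
        by (rule computable_fm_weight[OF e']) simp
      have el: "computable ?E6 ?bs (\<lambda>x. SAtom (AElem (fm_elem (fst x))))"
        by (rule computable_fm_elem[OF e']) simp
      have "computable ?E6 ?bs (\<lambda>x. enc_rows (split_sum
          (addends V (fm_weight (fst x)) (fm_elem (fst x))) (fm_weight (fst x)) (fm_vars (fst x)) (?rs x) (?qs x)))"
        by (rule computable_split_sum[OF computable_addends[OF V w el] w vars rs qs]) (use ok in auto)
      then show "computable ?E6 ?bs ?f"
      proof (rule computable_cong[rotated])
        show "?f x = enc_rows (split_sum (addends V (fm_weight (fst x)) (fm_elem (fst x)))
            (fm_weight (fst x)) (fm_vars (fst x)) (?rs x) (?qs x))" if "x \<in> ?E6" for x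
          using that by (cases "fst x") (auto simp: bound_vars_def)
      qed
    next
      let ?F = "{x \<in> ?E. tag (fst x) \<noteq> 6}"
      show "computable ?F ?bs ?f"
      proof (rule computable_cases[where P = "\<lambda>x. tag (fst x) = 5"])
        let ?E5 = "{x \<in> ?F. tag (fst x) = 5}"
        have "fm_vars (fst x) \<noteq> []" if "x \<in> ?E5" for x using that by (cases "fst x") auto
        then have "computable ?E5 ?bs (\<lambda>x. snum (hd (fm_vars (fst x))))"
          by (rule computable_hd[OF vars])
        then have "computable ?E5 ?bs (\<lambda>x. enc_rows (ex_rows (hd (fm_vars (fst x))) (?rs x) @
            swap_rows (ex_rows (hd (fm_vars (fst x))) (swap_rows (?qs x)))))"
          by (intro computable_append[where e = enc_row] computable_ex_rows computable_swap_rows rs qs)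
        then show "computable ?E5 ?bs ?f"
        proof (rule computable_cong[rotated])
          show "?f x = enc_rows (ex_rows (hd (fm_vars (fst x))) (?rs x) @
            swap_rows (ex_rows (hd (fm_vars (fst x))) (swap_rows (?qs x))))" if "x \<in> ?E5" for x
            using that by (cases "fst x") (auto simp: bound_vars_def)
        qed
      next
        let ?E4 = "{x \<in> ?F. tag (fst x) \<noteq> 5}"
        have "computable ?E4 ?bs (\<lambda>x. if tag (fst x) = 3 then enc_rows (neg_rows (?rs x)) else enc_rows (?rs x @ ?qs x))"
          by (intro computable_if' computable_tag e' computable_neg_rows
              computable_append[where e = enc_row] rs qs)
        then show "computable ?E4 ?bs ?f"
        proof (rule computable_cong[rotated])
          show "?f x = (if tag (fst x) = 3 then enc_rows (neg_rows (?rs x)) else enc_rows (?rs x @ ?qs x))"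
            if "x \<in> ?E4" for x
            using that by (cases "fst x") (auto simp: bound_vars_def)
        qed
      qed (intro computable_tag e')
    qed (intro computable_tag e')
  qed
qed

section \<open>Computing the decomposition\<close>

text \<open>The table consists of the pairs of a weight symbol and its type.\<close>

lemma computable_names_weight:
  fixes V :: "('r, 'w, 'p, 's, 'e) wa_setting"
  assumes "finite (weights V)" "computable D as (\<lambda>x. SAtom (AAlg (S x)))" "computable D as d"
  shows "computable D as (\<lambda>x. sbool (names_weight V (S x) (d x)))"
proof -
  let ?K = "(\<lambda>w. SCons (SAtom (AWt w)) (SAtom (AAlg (wt_type V w))) :: ('r, 'w, 'p, 's, 'e) atom sexp) ` weights V"
  have "computable D as (\<lambda>x. sbool (SCons (d x) (SAtom (AAlg (S x))) \<in> ?K))"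
    by (intro computable_member_finite computable_SCons assms finite_imageI)
  moreover have "SCons e (SAtom (AAlg T)) \<in> ?K \<longleftrightarrow> names_weight V T e" for e T
    by (auto simp: names_weight_def)
  ultimately show ?thesis by simp
qed

text \<open>The search is defined on all S-expressions, so the recursion over the two halves of a
  pair needs no invariant.\<close>

lemma computable_find_elem:
  fixes V :: "('r, 'w, 'p, 's, 'e) wa_setting"
  assumes "finite (weights V)" "computable D as (\<lambda>x. SAtom (AAlg (S x)))" "computable D as d"
  shows "computable D as (\<lambda>x. find_elem V (S x) (d x))"
proof -
  let ?bs = "[\<lambda>x. SAtom (AAlg (fst x)), snd] :: ('s \<times> ('r, 'w, 'p, 's, 'e) atom sexp \<Rightarrow> _) list"
  let ?a = "\<lambda>x. car (snd x)" and ?b = "\<lambda>x. car (cdr (snd x))"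
  let ?pair = "\<lambda>x. \<exists>u v. snd x = SCons u v"
  let ?alg = "\<lambda>x. ?a x = SAtom (AAlg (fst x))"
  let ?wt = "\<lambda>x. names_weight V (fst x) (?b x) \<and> \<not> (\<exists>u v. ?a x = SCons u v)"
  let ?c = "\<lambda>x. \<not> ?pair x \<or> ?alg x \<or> ?wt x"
  let ?f = "\<lambda>x. find_elem V (fst x) (snd x)"
  have S: "computable E ?bs (\<lambda>x. SAtom (AAlg (fst x)))" for E by (rule computable_var) simp
  have d: "computable E ?bs snd" for E by (rule computable_var) simp
  have pair: "computable E ?bs (\<lambda>x. sbool (?pair x))" for E by (rule computable_is_pair[OF d])
  have alg: "computable E ?bs (\<lambda>x. sbool (?alg x))" for E by (intro computable_eq computable_car d S)
  have wt: "computable E ?bs (\<lambda>x. sbool (?wt x))" for E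
    by (intro computable_sbool_conj computable_names_weight computable_sbool_not computable_is_pair
        computable_car computable_cdr d S assms(1))
  have "computable UNIV ?bs ?f"
  proof (rule computable_rec[where c = ?c and k = "\<lambda>x. (fst x, car (snd x))" and
        k' = "\<lambda>x. (fst x, cdr (snd x))" and m = "\<lambda>x. size (snd x)"])
    show "computable UNIV ?bs (\<lambda>x. sbool (?c x))"
      by (intro computable_sbool_disj computable_sbool_not pair alg wt)
    have "computable {x \<in> UNIV. ?c x} ?bs (\<lambda>x. if \<not> ?pair x then SNil else if ?alg x then ?b x else ?a x)"
      by (intro computable_if' computable_sbool_not pair alg computable_car computable_cdr d computable_const)
    then show "computable {x \<in> UNIV. ?c x} ?bs ?f"
    proof (rule computable_cong[rotated])
      show "?f x = (if \<not> ?pair x then SNil else if ?alg x then ?b x else ?a x)" if "x \<in> {x \<in> UNIV. ?c x}" for x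
        using that by (cases "snd x") auto
    qed
    show "(fst x, car (snd x)) \<in> UNIV \<and> (fst x, cdr (snd x)) \<in> UNIV \<and>
        size (snd (fst x, car (snd x))) < size (snd x) \<and> size (snd (fst x, cdr (snd x))) < size (snd x)"
      if "x \<in> UNIV" "\<not> ?c x" for x :: "'s \<times> ('r, 'w, 'p, 's, 'e) atom sexp"
      using that by (cases "snd x") auto
    show "computable {x \<in> UNIV. \<not> ?c x} ?bs (\<lambda>x. a (fst x, car (snd x)))" if "a \<in> set ?bs" for a
      using that S computable_car[OF d] by auto
    show "computable {x \<in> UNIV. \<not> ?c x} ?bs (\<lambda>x. a (fst x, cdr (snd x)))" if "a \<in> set ?bs" for a
      using that S computable_cdr[OF d] by auto
    let ?r = "\<lambda>x. ?f (fst x, car (snd x))" and ?r' = "\<lambda>x. ?f (fst x, cdr (snd x))"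
    have "computable {x \<in> UNIV. \<not> ?c x} (?r # ?r' # ?bs) (\<lambda>x. if ?r x \<noteq> SNil then ?r x else ?r' x)"
      by (intro computable_if' computable_sbool_not computable_eq computable_const computable_var1 computable_var2)
    then show "computable {x \<in> UNIV. \<not> ?c x} (?r # ?r' # ?bs) ?f"
    proof (rule computable_cong[rotated])
      show "?f x = (if ?r x \<noteq> SNil then ?r x else ?r' x)" if "x \<in> {x \<in> UNIV. \<not> ?c x}" for x
        using that by (cases "snd x") auto
    qed
  qed
  moreover have "computable D as (\<lambda>x. b (S x, d x))" if "b \<in> set ?bs" for b
    using that assms(2,3) by auto
  ultimately show ?thesis
    using computable_call[of UNIV ?bs ?f D "\<lambda>x. (S x, d x)" as] by simp
qed

lemma computable_const_of:
  fixes V :: "('r, 'w, 'p, 's, 'e) wa_setting"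
  assumes "finite (weights V)" "computable D as (\<lambda>x. enc (\<phi> x))" "computable D as (\<lambda>x. SAtom (AAlg (S x)))"
  shows "computable D as (\<lambda>x. const_of V (\<phi> x) (S x))"
proof -
  \<comment> \<open>Each of these types belongs to a weight symbol, so the table of their zeros is
    finite.\<close>
  let ?T = "{S \<in> wt_type V ` weights V. finite (carrier (alg V S))}"
  let ?K = "(\<lambda>S. SAtom (AAlg S) :: ('r, 'w, 'p, 's, 'e) atom sexp) ` ?T"
  let ?h = "\<lambda>d :: ('r, 'w, 'p, 's, 'e) atom sexp. case d of SAtom (AAlg S) \<Rightarrow> SAtom (AElem \<zero>\<^bsub>alg V S\<^esub>) | _ \<Rightarrow> SNil"
  let ?f = "\<lambda>x. find_elem V (S x) (enc (\<phi> x))"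
  have K: "finite ?K" using assms(1) by simp
  have "computable {x \<in> D. SAtom (AAlg (S x)) \<in> ?K} as (\<lambda>x. ?h (SAtom (AAlg (S x))))"
    by (rule computable_finite_map[OF K computable_restrict[OF assms(3)]]) simp
  then have t: "computable D as (\<lambda>x. if SAtom (AAlg (S x)) \<in> ?K then ?h (SAtom (AAlg (S x))) else SNil)"
    by (intro computable_if computable_member_finite[OF K assms(3)] computable_const)
  have "computable D as (\<lambda>x. if ?f x \<noteq> SNil then ?f x else
      if SAtom (AAlg (S x)) \<in> ?K then ?h (SAtom (AAlg (S x))) else SNil)"
    by (rule computable_if'[OF _ _ t]; intro computable_sbool_not computable_eq computable_const computable_find_elem assms)
  then show ?thesis
    by (rule computable_cong[rotated]) (auto simp: const_of_def)
qed

text \<open>The index keeps the whole formula, in which constants are sought, next to the subformula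
  that has been reached.\<close>

lemma computable_closed_atom:
  fixes V :: "('r, 'w, 'p, 's, 'e) wa_setting"
  assumes V: "wa_setting_ok V"
  shows "computable {x. fst x \<in> FOW1 V \<tau> \<and> snd x \<in> FOW1 V \<tau>} [\<lambda>x. enc (fst x), \<lambda>x. enc (snd x)]
    (\<lambda>x. enc_opt (closed_atom V (const_of V (fst x)) (snd x)))"
proof -
  let ?D = "{x. fst x \<in> FOW1 V \<tau> \<and> snd x \<in> FOW1 V \<tau>}"
  let ?bs = "[\<lambda>x. enc (fst x), \<lambda>x. enc (snd x)]"
  let ?f = "\<lambda>x. enc_opt (closed_atom V (const_of V (fst x)) (snd x))"
  let ?c = "\<lambda>x. \<not> (tag (snd x) = 3 \<or> tag (snd x) = 4)"
  let ?k = "\<lambda>x. (fst x, left_sub (snd x))" and ?k' = "\<lambda>x. (fst x, right_sub (snd x))"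
  have fin: "finite (weights V)" using V by (auto simp: wa_setting_ok_def)
  have e: "computable E ?bs (\<lambda>x. enc (fst x))" for E by (rule computable_var) simp
  have e': "computable E ?bs (\<lambda>x. enc (snd x))" for E by (rule computable_var) simp
  show ?thesis
  proof (rule computable_rec[where c = ?c and k = ?k and k' = ?k' and m = "\<lambda>x. size (snd x)"])
    show "computable ?D ?bs (\<lambda>x. sbool (?c x))"
      by (intro computable_sbool_disj computable_sbool_not computable_tag e')
    show "?k x \<in> ?D \<and> ?k' x \<in> ?D \<and> size (snd (?k x)) < size (snd x) \<and> size (snd (?k' x)) < size (snd x)"
      if "x \<in> ?D" "\<not> ?c x" for x
      using that by (cases "snd x") (auto simp: FOW1_def WA1_def)
    let ?D' = "{x \<in> ?D. \<not> ?c x}"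
    have l: "computable ?D' ?bs (\<lambda>x. enc (left_sub (snd x)))"
      and r: "computable ?D' ?bs (\<lambda>x. enc (right_sub (snd x)))"
      by (rule computable_left_sub[OF e'] computable_right_sub[OF e'], force)+
    show "computable ?D' ?bs (\<lambda>x. a (?k x))" if "a \<in> set ?bs" for a
      using that unfolding list.set insert_iff empty_iff by (elim disjE) (simp_all only: fst_conv snd_conv e l)
    show "computable ?D' ?bs (\<lambda>x. a (?k' x))" if "a \<in> set ?bs" for a
      using that unfolding list.set insert_iff empty_iff by (elim disjE) (simp_all only: fst_conv snd_conv e r)
    let ?r = "\<lambda>x. ?f (?k x)" and ?r' = "\<lambda>x. ?f (?k' x)"
    have "computable {x \<in> ?D. \<not> ?c x} (?r # ?r' # ?bs) (\<lambda>x. if ?r x \<noteq> SNil then ?r x else ?r' x)"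
      by (intro computable_if' computable_sbool_not computable_eq computable_const computable_var1 computable_var2)
    then show "computable {x \<in> ?D. \<not> ?c x} (?r # ?r' # ?bs) ?f"
    proof (rule computable_cong[rotated])
      show "?f x = (if ?r x \<noteq> SNil then ?r x else ?r' x)" if "x \<in> {x \<in> ?D. \<not> ?c x}" for x
        using that by (cases "snd x") auto
    qed
    let ?E = "{x \<in> ?D. ?c x}"
    let ?co = "\<lambda>x t. const_of V (fst x) (tm_type V t)"
    let ?ct = "\<lambda>x t. SCons (snum 0) (SCons (SAtom (AAlg (tm_type V t))) (SCons (?co x t) SNil))"
    let ?all = "\<lambda>x. \<forall>t\<in>set (fm_args (snd x)). ?co x t \<noteq> SNil"
    \<comment> \<open>The encoded atom is assembled from the values of \<open>const_of\<close> as
      they are. The identity map brings the argument list into the form of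
      \<open>computable_map\<close>.\<close>
    let ?p = "\<lambda>x. SCons (snum 7) (SCons (sarg 1 (enc (snd x)))
      (SCons (slist (map (\<lambda>d. d) (map (?ct x) (fm_args (snd x))))) SNil))"
    have args: "no_agg_tm t \<and> wa_tm V \<tau> t" if "x \<in> ?D" "t \<in> set (fm_args (snd x))" for x t
      using that by (cases "snd x") (auto simp: FOW1_def WA1_def)
    let ?F = "{y. fst y \<in> ?E \<and> snd y \<in> set (fm_args (snd (fst y)))}"
    have ty: "computable ?F ((\<lambda>y. enc_tm (snd y)) # map (\<lambda>a y. a (fst y)) ?bs)
        (\<lambda>y. SAtom (AAlg (tm_type V (snd y))))"
      by (rule computable_tm_type[OF fin computable_var1]) (use args in blast)
    have co: "computable ?F ((\<lambda>y. enc_tm (snd y)) # map (\<lambda>a y. a (fst y)) ?bs)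
        (\<lambda>y. ?co (fst y) (snd y))"
      by (rule computable_const_of[OF fin computable_lift(1)[OF e] ty])
    have all: "computable ?E ?bs (\<lambda>x. sbool (?all x))"
      by (intro computable_Ball[where e = enc_tm, OF computable_fm_args[OF e']] computable_sbool_not
          computable_eq computable_const co)
    have p: "computable ?E ?bs ?p"
      by (intro computable_SCons computable_const computable_sarg e'
          computable_map[where e = enc_tm, OF computable_fm_args[OF e']] ty co)
    have "computable ?E ?bs (\<lambda>x. if tag (snd x) = 5 \<or> tag (snd x) = 6 then enc (Ex 0 (EqV 0 0))
        else if tag (snd x) = 7 then if ?all x then ?p x else SNil else SNil)"
      by (intro computable_if' computable_sbool_disj computable_tag e' all p computable_const)
    then show "computable ?E ?bs ?f"
    proof (rule computable_cong[rotated])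
      show "?f x = (if tag (snd x) = 5 \<or> tag (snd x) = 6 then enc (Ex 0 (EqV 0 0))
        else if tag (snd x) = 7 then if ?all x then ?p x else SNil else SNil)" if x: "x \<in> ?E" for x
      proof (cases "snd x")
        case (Pred P ts)
        \<comment> \<open>A value of \<open>const_of\<close> other than \<open>SNil\<close> is
          always the atom of an element, so decoding it loses nothing.\<close>
        have "SAtom (AElem (the_elem_atom (const_of V (fst x) S))) = const_of V (fst x) S"
          if "const_of V (fst x) S \<noteq> SNil" for S
          using const_of_cases[OF V, of \<tau> "fst x" S] that x by (auto simp: FOW1_def WA1_def)
        then show ?thesis using Pred
          by (auto simp: eval_nat_numeral comp_def intro!: arg_cong[where f = slist])
      qed (use x in auto)
    qed
  qed
qed

lemma computable_candidate:
  fixes V :: "('r, 'w, 'p, 's, 'e) wa_setting"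
  assumes V: "wa_setting_ok V"
    and "computable D as (\<lambda>x. enc (\<phi> x))" "computable D as (\<lambda>x. svars (xs x))"
    and \<phi>: "\<And>x. x \<in> D \<Longrightarrow> \<phi> x \<in> FOW1 V \<tau>"
  shows "computable D as (\<lambda>x. enc (candidate V N (\<phi> x) (xs x)))"
proof -
  let ?g = "\<lambda>x. enc_opt (closed_atom V (const_of V (fst x)) (snd x))"
  have "computable D as (\<lambda>x. b (\<phi> x, \<phi> x))" if "b \<in> set [\<lambda>x. enc (fst x), \<lambda>x. enc (snd x)]" for b
    using that assms(2) by auto
  then have "computable D as (\<lambda>x. enc_opt (closed_atom V (const_of V (\<phi> x)) (\<phi> x)))"
    using computable_call[OF computable_closed_atom[OF V, of \<tau>], of D "\<lambda>x. (\<phi> x, \<phi> x)" as] \<phi> by simp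
  then have else_case: "computable D as (\<lambda>x. enc (case N of Some R \<Rightarrow> Rel R []
      | None \<Rightarrow> plain 0 (closed_atom V (const_of V (\<phi> x)) (\<phi> x))))"
    by (cases N) (simp_all add: computable_plain computable_const del: enc.simps)
  have then_case: "computable {x \<in> D. xs x \<noteq> []} as (\<lambda>x. enc (EqV (hd (xs x)) (hd (xs x))))"
    by (intro computable_EqV computable_hd computable_restrict assms(3)) auto
  have "computable D as (\<lambda>x. if xs x \<noteq> [] then enc (EqV (hd (xs x)) (hd (xs x)))
      else enc (case N of Some R \<Rightarrow> Rel R [] | None \<Rightarrow> plain 0 (closed_atom V (const_of V (\<phi> x)) (\<phi> x))))"
    by (rule computable_if[OF computable_vars_nonempty[OF assms(3)] then_case computable_restrict[OF else_case]])
  then show ?thesis by (rule computable_cong[rotated]) (simp add: candidate_def)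
qed

lemma computable_taut:
  "computable D as (\<lambda>x. enc (\<alpha> x)) \<Longrightarrow> computable D as (\<lambda>x. enc (taut (\<alpha> x)))"
  unfolding taut_def by (intro computable_Or computable_Neg)

lemma computable_fill:
  fixes a :: "'x \<Rightarrow> ('r, 'w, 'p, 's, 'e) fm option"
  assumes "computable D as (\<lambda>x. enc (\<alpha> x))" "computable D as (\<lambda>x. enc_opt (a x))"
  shows "computable D as (\<lambda>x. enc (fill (\<alpha> x) (a x)))"
proof -
  have "computable D as (\<lambda>x. if a x = None then enc (taut (\<alpha> x)) else enc_opt (a x))"
    by (intro computable_if' computable_is_None computable_taut assms)
  moreover have "enc (fill \<alpha> a) = (if a = None then enc (taut \<alpha>) else enc_opt a)"
    for a :: "('r, 'w, 'p, 's, 'e) fm option" and \<alpha>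
    by (cases a) simp_all
  ultimately show ?thesis by simp
qed

lemma computable_decomposition:
  fixes V :: "('r, 'w, 'p, 's, 'e) wa_setting"
  assumes V: "wa_setting_ok V"
  shows "computable {x. fst x \<in> FOW1 V \<tau>}
    [\<lambda>x. enc (fst x), \<lambda>x. svars (fst (snd x)), \<lambda>x. svars (snd (snd x))]
    (\<lambda>x. enc_output (decomposition V N X Y (fst x) (fst (snd x)) (snd (snd x))))"
proof -
  let ?D = "{x. fst x \<in> FOW1 V \<tau>}"
  let ?as = "[\<lambda>x. enc (fst x), \<lambda>x. svars (fst (snd x)), \<lambda>x. svars (snd (snd x))]"
  let ?d = "\<lambda>x. dec V X Y (fst x) (fst (snd x))"
  let ?cx = "\<lambda>x. candidate V N (fst x) (fst (snd x))" and ?cy = "\<lambda>x. candidate V N (fst x) (snd (snd x))"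
  let ?o = "\<lambda>(\<alpha>, \<beta>). SCons (enc \<alpha>) (enc \<beta>) :: ('r, 'w, 'p, 's, 'e) atom sexp"
  have e: "computable ?D ?as (\<lambda>x. enc (fst x))" by (rule computable_var) simp
  have cx: "computable ?D ?as (\<lambda>x. enc (?cx x))" and cy: "computable ?D ?as (\<lambda>x. enc (?cy x))"
    by (rule computable_candidate[OF V e, of _ \<tau>]; (rule computable_var)?; simp)+
  have "computable ?D ?as (\<lambda>x. b (fst x, fst (snd x)))" if "b \<in> set [\<lambda>x. enc (fst x), \<lambda>x. svars (snd x)]" for b
    using that by (auto intro: computable_var)
  then have d: "computable ?D ?as (\<lambda>x. enc_rows (?d x))"
    using computable_call[OF computable_dec[OF V, of \<tau> X Y], of ?D "\<lambda>x. (fst x, fst (snd x))" ?as] by simp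
  let ?out = "\<lambda>x. slist (map ?o (map (\<lambda>r. (fill (?cx x) (fst r), fill (?cy x) (snd r))) (?d x)))"
  have "computable ?D ?as ?out"
  proof (rule computable_map[where e = enc_row, OF d], unfold prod.case)
    show "computable {y. fst y \<in> ?D \<and> snd y \<in> set (?d (fst y))}
      ((\<lambda>y. enc_row (snd y)) # map (\<lambda>a y. a (fst y)) ?as)
      (\<lambda>y. SCons (enc (fill (?cx (fst y)) (fst (snd y)))) (enc (fill (?cy (fst y)) (snd (snd y)))))"
      by (intro computable_SCons computable_fill computable_row_fst computable_row_snd computable_var1
          computable_lift(1)[OF cx] computable_lift(1)[OF cy])
  qed
  then have "computable ?D ?as (\<lambda>x. if enc_rows (?d x) = SNil
      then SCons (SCons (enc (Neg (taut (?cx x)))) (enc (Neg (taut (?cy x))))) SNil else ?out x)"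
    by (intro computable_if' computable_eq computable_const d computable_SCons computable_Neg
        computable_taut cx cy)
  moreover have "enc_output (decomposition V N X Y (fst x) (fst (snd x)) (snd (snd x))) =
      (if enc_rows (?d x) = SNil
       then SCons (SCons (enc (Neg (taut (?cx x)))) (enc (Neg (taut (?cy x))))) SNil else ?out x)" for x
    by (cases "?d x") (simp_all add: decomposition_def enc_output_def)
  ultimately show ?thesis by simp
qed

theorem theorem4p3:
  fixes V :: "('r, 'w, 'p, 's, 'e) wa_setting"
    and \<sigma> :: "'r set" and X Y :: 'r
  assumes "wa_setting_ok V"
    and "finite \<sigma>"
    and "X \<notin> \<sigma>" and "Y \<notin> \<sigma>" and "X \<noteq> Y"
    and "rel_ar V X = 1" and "rel_ar V Y = 1"
  shows
    "(\<forall>\<phi> xs ys.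
        distinct (xs @ ys) \<and> \<phi> \<in> FOW1 V (\<sigma> \<union> {X, Y}) \<and> free \<phi> \<subseteq> set xs \<union> set ys \<and>
        has_fv_candidates (fv_class V \<sigma> \<phi>) xs ys \<longrightarrow>
        (\<exists>\<Delta>. fv_decomposition TYPE('a) V \<sigma> X Y (fv_class V \<sigma> \<phi>) \<phi> xs ys \<Delta>)) \<and>
     (\<exists>F :: ('r, 'w, 'p, 's, 'e) atom expr. \<forall>\<phi> xs ys.
        distinct (xs @ ys) \<and> \<phi> \<in> FOW1 V (\<sigma> \<union> {X, Y}) \<and> free \<phi> \<subseteq> set xs \<union> set ys \<and>
        has_fv_candidates (fv_class V \<sigma> \<phi>) xs ys \<longrightarrow>
        (\<exists>ps. computes F (enc_input \<phi> xs ys) (enc_output ps) \<and>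
              fv_decomposition TYPE('a) V \<sigma> X Y (fv_class V \<sigma> \<phi>) \<phi> xs ys (set ps)))"
proof -
  \<comment> \<open>The choice depends only on \<open>V\<close> and \<sigma>, not on the input, so
    \<open>N\<close> may be built into the program.\<close>
  obtain N where N: "\<And>R. N = Some R \<Longrightarrow> R \<in> \<sigma> \<and> rel_ar V R = 0" "N = None \<Longrightarrow> \<forall>R\<in>\<sigma>. rel_ar V R \<noteq> 0"
  proof (cases "\<exists>R\<in>\<sigma>. rel_ar V R = 0")
    case True
    then obtain R where "R \<in> \<sigma>" "rel_ar V R = 0" by blast
    then show thesis by (intro that[of "Some R"]) auto
  next
    case False
    then show thesis by (intro that[of None]) auto
  qed
  have fv: "fv_decomposition TYPE('a) V \<sigma> X Y (fv_class V \<sigma> \<phi>) \<phi> xs ys (set (decomposition V N X Y \<phi> xs ys))"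
    if "distinct (xs @ ys)" "\<phi> \<in> FOW1 V (\<sigma> \<union> {X, Y})" "free \<phi> \<subseteq> set xs \<union> set ys"
      "has_fv_candidates (fv_class V \<sigma> \<phi>) xs ys" for \<phi> xs ys
    using fv_decomposition_decomposition[OF assms(1,3-7) N that] .
  \<comment> \<open>The first entry of the input is an encoded formula and hence not
    \<open>SNil\<close>, as the entry test of \<open>computes_computable\<close> requires.\<close>
  obtain F :: "('r, 'w, 'p, 's, 'e) atom expr" where F: "\<forall>x\<in>{x. fst x \<in> FOW1 V (\<sigma> \<union> {X, Y})}.
      computes F (slist (map (\<lambda>a. a x) [\<lambda>x. enc (fst x), \<lambda>x. svars (fst (snd x)), \<lambda>x. svars (snd (snd x))]))
        (enc_output (decomposition V N X Y (fst x) (fst (snd x)) (snd (snd x))))"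
    using computes_computable[OF computable_decomposition[OF assms(1)]] by fastforce
  have "computes F (enc_input \<phi> xs ys) (enc_output (decomposition V N X Y \<phi> xs ys))"
    if "\<phi> \<in> FOW1 V (\<sigma> \<union> {X, Y})" for \<phi> xs ys
    using bspec[OF F, of "(\<phi>, xs, ys)"] that by (simp add: enc_input_def)
  with fv show ?thesis by blast
qed

end
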